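(* Assume $A$ is associative. Let $D$ be a nonempty open subset of $\mathbb{R}_{0,t_0}\times\mathbb{R}^\tau$, invariant under the reflection $(\alpha,\beta)\mapsto(\alpha,\overline{\beta}^h)$ for every $h\in\{1,\ldots,\tau\}$, and assume that the $T$-symmetric set $\Omega_D$ is a $T$-slice domain. If $f:\Omega_D\to A$ is $T$-regular, then $f$ is strongly $T$-regular and, for all $(\alpha,\beta)\in D$ and all $I,J\in\mathbb{T}$, \[f(\alpha+\beta J)=2^{-\tau}\sum_{K,H\in\mathscr{P}(\tau)}(-1)^{|K\cap H|}\,J_K\,I_K^{-1}\,f(\alpha+\overline{\beta}^H I)=\sum_{H\in\mathscr{P}(\tau)}\gamma_H\,f(\alpha+\overline{\beta}^H I),\] where $\gamma_H:=2^{-\tau}\sum_{K\in\mathscr{P}(\tau)}(-1)^{|K\cap H|}J_K\,I_K^{-1}$. As a consequence, $f$ is real analytic.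
   Context: $\mathbb{N}$ includes $0$. $A$ is a finite-dimensional alternative (unital) real $*$-algebra: a finite-dimensional real vector space with an $\mathbb{R}$-bilinear multiplication such that $x(xy)=x^2y$, $(xy)y=xy^2$ (automatic if $A$ is associative), and with an involutive real-linear antiautomorphism $x\mapsto x^c$; $\mathbb{R}$ is identified with $\mathbb{R}1$. Set $t(x)=x+x^c$, $n(x)=xx^c$, $\mathbb{S}_A=\{x\in A:t(x)=0,\ n(x)=1\}$, assumed nonempty. Let $Q_A=\bigcup_{J\in\mathbb{S}_A}(\mathbb{R}+J\mathbb{R})$. A hypercomplex subspace of $A$ is a real vector subspace $V$ with $\mathbb{R}\subsetneq V\subseteq Q_A$; a hypercomplex basis of $V$ is an ordered real basis $(v_0,\ldots,v_n)$ with $n\ge1$, $v_0=1$, $v_s\in\mathbb{S}_A$ and $v_sv_u=-v_uv_s$ for distinct $s,u\in\{1,\ldots,n\}$. Setting. $V$ is a hypercomplex subspace of $A$ with hypercomplex basis $\mathcal{B}=(v_0,\ldots,v_n)$, completed to a real basis $\mathcal{B}'=(v_0,\ldots,v_d)$ of $A$; $\langle\cdot,\cdot\rangle$ and $\|\cdot\|$ are the Euclidean scalar product and norm on $A$ making $\mathcal{B}'$ orthonormal. A domain is a nonempty connected open subset. Fix $\tau\in\{0,\ldots,n\}$ and a list of steps $T=(t_0,\ldots,t_\tau)\in\mathbb{N}^{\tau+1}$ with $0\le t_0<t_1<\cdots<t_\tau=n$. For $0\le\ell\le m\le n$, $\mathbb{R}_{\ell,m}=\mathrm{Span}(v_\ell,\ldots,v_m)$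 and $\mathbb{S}_{\ell,m}$ is its unit sphere. The mirror is $\mathbb{R}_{0,t_0}$; the $T$-torus is $\mathbb{T}=\mathbb{S}_{t_0+1,t_1}\times\cdots\times\mathbb{S}_{t_{\tau-1}+1,t_\tau}$ if $\tau\ge1$. For $J=(J_1,\ldots,J_\tau)\in\mathbb{T}$, $\mathcal{B}_J=(v_0,v_1,\ldots,v_{t_0},J_1,\ldots,J_\tau)$ and $\mathbb{R}_J^{t_0+\tau+1}=\mathrm{Span}(\mathcal{B}_J)$, with elements written $x_0+v_1x_1+\cdots+v_{t_0}x_{t_0}+\beta_1J_1+\cdots+\beta_\tau J_\tau$. If $\tau=0$, "$J\in\mathbb{T}$" is read as $J=\emptyset$, with $\mathcal{B}_\emptyset=\mathcal{B}$ and $\mathbb{R}_\emptyset^{t_0+1}=V$. For $Y\subseteq V$ and $f:Y\to A$: $Y_J=Y\cap\mathbb{R}_J^{t_0+\tau+1}$ and $f_J=f|_{Y_J}$. A function $f:\Omega\to A$ on a domain $\Omega\subseteq V$ is $T$-regular if for every $J\in\mathbb{T}$ the restriction $f_J$ is $J$-monogenic, i.e. of class $\mathscr{C}^1$ on the open subset $\Omega_J$ of $\mathbb{R}_J^{t_0+\tau+1}$ with $(\partial_{x_0}+v_1\partial_{x_1}+\cdots+v_{t_0}\partial_{x_{t_0}}+J_1\partial_{\beta_1}+\cdots+J_\tau\partial_{\beta_\tau})f_J\equiv0$ (vacuous if $\Omega_J=\emptyset$). A domain $\Omega\subseteq V$ is a $T$-slice domain if it intersects the mirror and, for every $J\in\mathbb{T}$,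 $\Omega_J$ is connected. For $\beta\in\mathbb{R}^\tau$, $J\in\mathbb{T}$: $\beta J:=\beta_1J_1+\cdots+\beta_\tau J_\tau\in V$ (zero if $\tau=0$). $\overline{\beta}^h$ is $\beta$ with its $h$-th component changed in sign; $\mathscr{P}(\tau)$ is the power set of $\{1,\ldots,\tau\}$; for $H\in\mathscr{P}(\tau)$, $\overline{\beta}^H$ is $\beta$ with the components of index in $H$ changed in sign. $\Omega_D:=\{\alpha+\beta J:(\alpha,\beta)\in D,\ J\in\mathbb{T}\}$ (and $\Omega_D=\{\alpha\in V:(\alpha,0)\in D\}$ if $\tau=0$); sets of this form are called $T$-symmetric. For $A$ associative: $J_\emptyset=1$ and $J_K=J_{k_1}\cdots J_{k_p}$ if $K=\{k_1<\cdots<k_p\}$; $I_K^{-1}$ is the multiplicative inverse of $I_K$. Let $(E_K)_{K\in\mathscr{P}(\tau)}$ be the canonical basis of $\mathbb{R}^{2^\tau}$. A $T$-stem function is a map $F=\sum_KE_KF_K:D\to A\otimes\mathbb{R}^{2^\tau}$, with $F_K:D\to A$, such that $F_K(\alpha,\overline{\beta}^h)=F_K(\alpha,\beta)$ if $h\notin K$ and $F_K(\alpha,\overline{\beta}^h)=-F_K(\alpha,\beta)$ if $h\in K$, for all $K$, $(\alpha,\beta)\in D$, $h$. It induces the (well-defined) function $\mathcal{I}(F):\Omega_D\to A$, $\mathcal{I}(F)(\alpha+\beta J)=\sum_{K\in\mathscr{P}(\tau)}J_K\,F_K(\alpha,\beta)$; functions of the form $\mathcal{I}(F)$ are called $T$-functions.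 If $\Omega_D$ is a domain, a function $\Omega_D\to A$ is strongly $T$-regular if it is both a $T$-function and $T$-regular. *)

theory Defs
  imports "HOL-Analysis.Analysis"
begin

text \<open>
  The finite-dimensional associative unital real algebra is a type of sort
  \<open>{real_algebra_1, euclidean_space}\<close>. The class \<open>euclidean_space\<close> contributes only finite
  dimension and the (unique) vector space topology together with the notions of differentiability
  and summability, none of which depends on the choice of a norm. No compatibility between its
  inner product and the multiplication is assumed. The Euclidean structure attached to a basis
  \<open>(v 0, \<dots>, v d)\<close> of the algebra is \<open>basis_inner\<close>, \<open>basis_norm\<close> below.
\<close>

definition star_involution :: "('a::real_algebra_1 \<Rightarrow> 'a) \<Rightarrow> bool" where
  "star_involution cj \<longleftrightarrow>
     linear cj \<and> (\<forall>x. cj (cj x) = x) \<and> (\<forall>x y. cj (x * y) = cj y * cj x)"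

definition star_trace :: "('a::real_algebra_1 \<Rightarrow> 'a) \<Rightarrow> 'a \<Rightarrow> 'a" where
  "star_trace cj x = x + cj x"

definition star_norm :: "('a::real_algebra_1 \<Rightarrow> 'a) \<Rightarrow> 'a \<Rightarrow> 'a" where
  "star_norm cj x = x * cj x"

definition imag_units :: "('a::real_algebra_1 \<Rightarrow> 'a) \<Rightarrow> 'a set" where
  "imag_units cj = {x. star_trace cj x = 0 \<and> star_norm cj x = 1}"

definition quadratic_cone :: "('a::real_algebra_1 \<Rightarrow> 'a) \<Rightarrow> 'a set" where
  "quadratic_cone cj = (\<Union>J\<in>imag_units cj. {of_real a + J * of_real b |a b. True})"

definition hypercomplex_subspace :: "('a::real_algebra_1 \<Rightarrow> 'a) \<Rightarrow> 'a set \<Rightarrow> bool" where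
  "hypercomplex_subspace cj V \<longleftrightarrow> subspace V \<and> \<real> \<subset> V \<and> V \<subseteq> quadratic_cone cj"

text \<open>\<open>(v 0, \<dots>, v m)\<close> is an ordered real basis of the subspace \<open>W\<close>; values of \<open>v\<close> beyond \<open>m\<close>
  are irrelevant.\<close>

definition ordered_basis :: "'a::real_vector set \<Rightarrow> (nat \<Rightarrow> 'a) \<Rightarrow> nat \<Rightarrow> bool" where
  "ordered_basis W v m \<longleftrightarrow>
     inj_on v {0..m} \<and> independent (v ` {0..m}) \<and> span (v ` {0..m}) = W"

definition hypercomplex_basis ::
    "('a::real_algebra_1 \<Rightarrow> 'a) \<Rightarrow> 'a set \<Rightarrow> (nat \<Rightarrow> 'a) \<Rightarrow> nat \<Rightarrow> bool" where
  "hypercomplex_basis cj V v n \<longleftrightarrow>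
     ordered_basis V v n \<and> 1 \<le> n \<and> v 0 = 1 \<and>
     (\<forall>s\<in>{1..n}. v s \<in> imag_units cj) \<and>
     (\<forall>s\<in>{1..n}. \<forall>u\<in>{1..n}. s \<noteq> u \<longrightarrow> v s * v u = - (v u * v s))"

text \<open>The scalar product making the basis \<open>(v 0, \<dots>, v d)\<close> of the algebra orthonormal.\<close>

definition basis_inner :: "(nat \<Rightarrow> 'a::real_vector) \<Rightarrow> nat \<Rightarrow> 'a \<Rightarrow> 'a \<Rightarrow> real" where
  "basis_inner v d x y =
     (\<Sum>i=0..d. representation (v ` {0..d}) x (v i) * representation (v ` {0..d}) y (v i))"

definition basis_norm :: "(nat \<Rightarrow> 'a::real_vector) \<Rightarrow> nat \<Rightarrow> 'a \<Rightarrow> real" where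
  "basis_norm v d x = sqrt (basis_inner v d x x)"

definition domain_in :: "'a::topological_space set \<Rightarrow> 'a set \<Rightarrow> bool" where
  "domain_in V \<Omega> \<longleftrightarrow> \<Omega> \<noteq> {} \<and> connected \<Omega> \<and> openin (top_of_set V) \<Omega>"

definition list_of_steps :: "nat \<Rightarrow> nat \<Rightarrow> (nat \<Rightarrow> nat) \<Rightarrow> bool" where
  "list_of_steps n \<tau> t \<longleftrightarrow> \<tau> \<le> n \<and> (\<forall>h<\<tau>. t h < t (Suc h)) \<and> t \<tau> = n"

definition span_range :: "(nat \<Rightarrow> 'a::real_vector) \<Rightarrow> nat \<Rightarrow> nat \<Rightarrow> 'a set" where
  "span_range v l m = span (v ` {l..m})"

definition unit_sphere :: "(nat \<Rightarrow> 'a::real_vector) \<Rightarrow> nat \<Rightarrow> nat \<Rightarrow> nat \<Rightarrow> 'a set" where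
  "unit_sphere v d l m = {x \<in> span_range v l m. basis_norm v d x = 1}"

definition mirror :: "(nat \<Rightarrow> 'a::real_vector) \<Rightarrow> (nat \<Rightarrow> nat) \<Rightarrow> 'a set" where
  "mirror v t = span_range v 0 (t 0)"

text \<open>Tuples indexed by \<open>1, \<dots>, \<tau>\<close> are extensional functions on \<open>{1..\<tau>}\<close>. For \<open>\<tau> = 0\<close> there is
  exactly one such function, which plays the role of the empty tuple; so the conventions
  for \<open>\<tau> = 0\<close> are instances of the general definitions.\<close>

definition torus ::
    "(nat \<Rightarrow> 'a::real_vector) \<Rightarrow> nat \<Rightarrow> nat \<Rightarrow> (nat \<Rightarrow> nat) \<Rightarrow> (nat \<Rightarrow> 'a) set" where
  "torus v d \<tau> t = (\<Pi>\<^sub>E h\<in>{1..\<tau>}. unit_sphere v d (t (h - 1) + 1) (t h))"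

definition slice_space ::
    "(nat \<Rightarrow> 'a::real_vector) \<Rightarrow> nat \<Rightarrow> (nat \<Rightarrow> nat) \<Rightarrow> (nat \<Rightarrow> 'a) \<Rightarrow> 'a set" where
  "slice_space v \<tau> t J = span (v ` {0..t 0} \<union> J ` {1..\<tau>})"

definition slice ::
    "(nat \<Rightarrow> 'a::real_vector) \<Rightarrow> nat \<Rightarrow> (nat \<Rightarrow> nat) \<Rightarrow> 'a set \<Rightarrow> (nat \<Rightarrow> 'a) \<Rightarrow> 'a set" where
  "slice v \<tau> t \<Omega> J = \<Omega> \<inter> slice_space v \<tau> t J"

definition T_slice_domain ::
    "'a::{real_algebra_1,euclidean_space} set \<Rightarrow> (nat \<Rightarrow> 'a) \<Rightarrow> nat \<Rightarrow> nat \<Rightarrow> (nat \<Rightarrow> nat) \<Rightarrow> 'a set \<Rightarrow> bool"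
  where
  "T_slice_domain V v d \<tau> t \<Omega> \<longleftrightarrow>
     domain_in V \<Omega> \<and> \<Omega> \<inter> mirror v t \<noteq> {} \<and>
     (\<forall>J\<in>torus v d \<tau> t. connected (slice v \<tau> t \<Omega> J))"

text \<open>Class \<open>C\<^sup>1\<close> on a relatively open subset \<open>Y\<close> of a linear subspace \<open>W\<close>. The derivative
  within \<open>Y\<close> is determined on \<open>W\<close> only, so only its values on \<open>W\<close> are constrained.\<close>

definition C1_on_subspace ::
    "'a::real_normed_vector set \<Rightarrow> 'a set \<Rightarrow> ('a \<Rightarrow> 'b::real_normed_vector) \<Rightarrow> bool" where
  "C1_on_subspace W Y f \<longleftrightarrow>
     (\<exists>f'. (\<forall>x\<in>Y. (f has_derivative f' x) (at x within Y)) \<and>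
           (\<forall>w\<in>W. continuous_on Y (\<lambda>x. f' x w)))"

text \<open>The derivative with respect to the coordinate along the basis vector \<open>w\<close>. If \<open>x\<close> lies in a
  relatively open subset \<open>Y\<close> of a subspace containing \<open>w\<close>, only values of \<open>f\<close> on \<open>Y\<close> matter.\<close>

definition coord_deriv :: "('a::real_normed_vector \<Rightarrow> 'b::real_normed_vector) \<Rightarrow> 'a \<Rightarrow> 'a \<Rightarrow> 'b" where
  "coord_deriv f w x = vector_derivative (\<lambda>r. f (x + r *\<^sub>R w)) (at 0)"

text \<open>For \<open>v 0 = 1\<close> the term with index \<open>0\<close> is the derivative with respect to the real
  coordinate.\<close>

definition CR_operator ::
    "(nat \<Rightarrow> 'a::{real_algebra_1,euclidean_space}) \<Rightarrow> nat \<Rightarrow> (nat \<Rightarrow> nat) \<Rightarrow> (nat \<Rightarrow> 'a) \<Rightarrow>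
     ('a \<Rightarrow> 'a) \<Rightarrow> 'a \<Rightarrow> 'a" where
  "CR_operator v \<tau> t J f x =
     (\<Sum>s=0..t 0. v s * coord_deriv f (v s) x) + (\<Sum>h=1..\<tau>. J h * coord_deriv f (J h) x)"

definition J_monogenic ::
    "(nat \<Rightarrow> 'a::{real_algebra_1,euclidean_space}) \<Rightarrow> nat \<Rightarrow> (nat \<Rightarrow> nat) \<Rightarrow> (nat \<Rightarrow> 'a) \<Rightarrow>
     'a set \<Rightarrow> ('a \<Rightarrow> 'a) \<Rightarrow> bool" where
  "J_monogenic v \<tau> t J Y f \<longleftrightarrow>
     C1_on_subspace (slice_space v \<tau> t J) Y f \<and> (\<forall>x\<in>Y. CR_operator v \<tau> t J f x = 0)"

definition T_regular ::
    "(nat \<Rightarrow> 'a::{real_algebra_1,euclidean_space}) \<Rightarrow> nat \<Rightarrow> nat \<Rightarrow> (nat \<Rightarrow> nat) \<Rightarrow>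
     'a set \<Rightarrow> ('a \<Rightarrow> 'a) \<Rightarrow> bool" where
  "T_regular v d \<tau> t \<Omega> f \<longleftrightarrow>
     (\<forall>J\<in>torus v d \<tau> t. J_monogenic v \<tau> t J (slice v \<tau> t \<Omega> J) f)"

definition torus_comb :: "nat \<Rightarrow> (nat \<Rightarrow> real) \<Rightarrow> (nat \<Rightarrow> 'a::real_vector) \<Rightarrow> 'a" where
  "torus_comb \<tau> \<beta> J = (\<Sum>h=1..\<tau>. \<beta> h *\<^sub>R J h)"

definition reflect :: "nat set \<Rightarrow> (nat \<Rightarrow> real) \<Rightarrow> nat \<Rightarrow> real" where
  "reflect H \<beta> = (\<lambda>h. if h \<in> H then - \<beta> h else \<beta> h)"

definition T_symmetrize ::
    "(nat \<Rightarrow> 'a::real_vector) \<Rightarrow> nat \<Rightarrow> nat \<Rightarrow> (nat \<Rightarrow> nat) \<Rightarrow> ('a \<times> (nat \<Rightarrow> real)) set \<Rightarrow> 'a set" where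
  "T_symmetrize v d \<tau> t D =
     {\<alpha> + torus_comb \<tau> \<beta> J |\<alpha> \<beta> J. (\<alpha>, \<beta>) \<in> D \<and> J \<in> torus v d \<tau> t}"

definition ordered_prod :: "(nat \<Rightarrow> 'a::monoid_mult) \<Rightarrow> nat set \<Rightarrow> 'a" where
  "ordered_prod J K = prod_list (map J (sorted_list_of_set K))"

definition mult_inverse :: "'a::monoid_mult \<Rightarrow> 'a" where
  "mult_inverse x = (THE y. x * y = 1 \<and> y * x = 1)"

text \<open>A map \<open>F\<close> into the tensor product of the algebra with the real space having basis
  \<open>(E\<^sub>K)\<close>, \<open>K \<subseteq> {1..\<tau>}\<close>, is given by the family of its components \<open>F K\<close>.\<close>

definition T_stem_function ::
    "nat \<Rightarrow> ('a \<times> (nat \<Rightarrow> real)) set \<Rightarrow> (nat set \<Rightarrow> 'a \<times> (nat \<Rightarrow> real) \<Rightarrow> 'a::real_algebra_1) \<Rightarrow> bool"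
  where
  "T_stem_function \<tau> D F \<longleftrightarrow>
     (\<forall>K\<in>Pow {1..\<tau>}. \<forall>(\<alpha>, \<beta>)\<in>D. \<forall>h\<in>{1..\<tau>}.
        F K (\<alpha>, reflect {h} \<beta>) = (if h \<in> K then - F K (\<alpha>, \<beta>) else F K (\<alpha>, \<beta>)))"

text \<open>\<open>f\<close> coincides on the T-symmetric set defined by \<open>D\<close> with the function induced by \<open>F\<close>.\<close>

definition induced_by_stem ::
    "(nat \<Rightarrow> 'a::real_algebra_1) \<Rightarrow> nat \<Rightarrow> nat \<Rightarrow> (nat \<Rightarrow> nat) \<Rightarrow> ('a \<times> (nat \<Rightarrow> real)) set \<Rightarrow>
     (nat set \<Rightarrow> 'a \<times> (nat \<Rightarrow> real) \<Rightarrow> 'a) \<Rightarrow> ('a \<Rightarrow> 'a) \<Rightarrow> bool" where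
  "induced_by_stem v d \<tau> t D F f \<longleftrightarrow>
     (\<forall>(\<alpha>, \<beta>)\<in>D. \<forall>J\<in>torus v d \<tau> t.
        f (\<alpha> + torus_comb \<tau> \<beta> J) = (\<Sum>K\<in>Pow {1..\<tau>}. ordered_prod J K * F K (\<alpha>, \<beta>)))"

definition T_function ::
    "(nat \<Rightarrow> 'a::real_algebra_1) \<Rightarrow> nat \<Rightarrow> nat \<Rightarrow> (nat \<Rightarrow> nat) \<Rightarrow> ('a \<times> (nat \<Rightarrow> real)) set \<Rightarrow>
     ('a \<Rightarrow> 'a) \<Rightarrow> bool" where
  "T_function v d \<tau> t D f \<longleftrightarrow>
     (\<exists>F. T_stem_function \<tau> D F \<and> induced_by_stem v d \<tau> t D F f)"

definition strongly_T_regular ::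
    "(nat \<Rightarrow> 'a::{real_algebra_1,euclidean_space}) \<Rightarrow> nat \<Rightarrow> nat \<Rightarrow> (nat \<Rightarrow> nat) \<Rightarrow>
     ('a \<times> (nat \<Rightarrow> real)) set \<Rightarrow> ('a \<Rightarrow> 'a) \<Rightarrow> bool" where
  "strongly_T_regular v d \<tau> t D f \<longleftrightarrow>
     T_function v d \<tau> t D f \<and> T_regular v d \<tau> t (T_symmetrize v d \<tau> t D) f"

definition gamma_coeff ::
    "nat \<Rightarrow> (nat \<Rightarrow> 'a::real_algebra_1) \<Rightarrow> (nat \<Rightarrow> 'a) \<Rightarrow> nat set \<Rightarrow> 'a" where
  "gamma_coeff \<tau> I J H =
     (1 / 2 ^ \<tau>) *\<^sub>R (\<Sum>K\<in>Pow {1..\<tau>}.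
        (-1) ^ card (K \<inter> H) *\<^sub>R (ordered_prod J K * mult_inverse (ordered_prod I K)))"

text \<open>\<open>f\<close> is real analytic on \<open>\<Omega>\<close>, relatively open in the space with basis \<open>(v 0, \<dots>, v n)\<close>: near
  each point of \<open>\<Omega>\<close> it is the sum of an (absolutely) convergent power series in the coordinates;
  \<open>k\<close> ranges over multi-indices.\<close>

definition real_analytic_on ::
    "(nat \<Rightarrow> 'a::real_normed_vector) \<Rightarrow> nat \<Rightarrow> 'a set \<Rightarrow> ('a \<Rightarrow> 'b::real_normed_vector) \<Rightarrow> bool" where
  "real_analytic_on v n \<Omega> f \<longleftrightarrow>
     (\<forall>p\<in>\<Omega>. \<exists>r>0. \<exists>c :: (nat \<Rightarrow> nat) \<Rightarrow> 'b. \<forall>y :: nat \<Rightarrow> real.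
        (\<forall>i\<in>{0..n}. \<bar>y i\<bar> < r) \<longrightarrow>
          p + (\<Sum>i=0..n. y i *\<^sub>R v i) \<in> \<Omega> \<and>
          ((\<lambda>k. (\<Prod>i=0..n. y i ^ k i) *\<^sub>R c k) has_sum f (p + (\<Sum>i=0..n. y i *\<^sub>R v i)))
            ({0..n} \<rightarrow>\<^sub>E UNIV))"

end

(*
A monogenic function on a slice satisfies a mean value formula with a smooth compactly supported
radial kernel, by two integrations by parts. Hence its partial derivatives are again monogenic and
satisfy Cauchy estimates, so it is real analytic, and it vanishes on a connected domain as soon as
it vanishes on a hyperplane section (the equation gives the normal derivatives). Given a T-regular f,
replace in J one unit J_h by another unit j: the function
(1 - J_h j)/2 f(alpha + beta J') + (1 + J_h j)/2 f(alpha + beta J''), where J' and J'' have j and -j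
in place of J_h, is J-monogenic and agrees with f for beta_h = 0, hence everywhere. Iterating over h
gives the representation formula, and f is induced by a stem function whose components are analytic
on one slice. Near a point of the domain beta_h is the norm of the h-th block of coordinates; since the
components are even or odd in each beta_h, they are analytic in these coordinates as well. This is
checked by extending to separately holomorphic functions, which have power series by Osgood's lemma.
*)

theory Submission
  imports Defs "HOL-Complex_Analysis.Complex_Analysis" "HOL-Real_Asymp.Real_Asymp"
begin

text \<open>Harmonicity is obtained in integrated form, with all second derivatives falling on the
  kernel. The inner product of the type is unrelated to the multiplication, so the analysis on a
  slice takes from the algebra only associativity, linearity and the Clifford relation of the units.
  Analyticity on the domain is harder than on a slice: \<beta>_h is the square root of a quadratic
  form in the coordinates and is singular where it vanishes, and the unit J_h is singular there too.
  The two singularities cancel only in the product of J_K with the stem component of index K.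
  Complex extensions serve as bookkeeping: bounded separately holomorphic functions are stable under
  sums, products, compositions and uniform limits, so that no multi-index series has to be
  substituted into another.\<close>

section \<open>Mean value formula for monogenic functions\<close>

text \<open>The exponent is at least 2 so that the kink at 0 is invisible to the first derivative:
  there the difference quotient is at most |h|^(n+1).\<close>

lemma max_zero_power_deriv:
  "((\<lambda>s::real. max 0 s ^ Suc (Suc n)) has_real_derivative real (n + 2) * max 0 s ^ Suc n) (at s)"
proof -
  consider "s > 0" | "s < 0" | "s = 0" by linarith
  then show ?thesis
  proof cases
    case 1
    have "((\<lambda>s::real. s ^ Suc (Suc n)) has_real_derivative real (n + 2) * s ^ Suc n) (at s)"
      using DERIV_pow [of "Suc (Suc n)" s] by simp
    then have "((\<lambda>s::real. max 0 s ^ Suc (Suc n)) has_real_derivative real (n + 2) * s ^ Suc n) (at s)"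
      by (rule has_field_derivative_transform_within [where d = s]) (use 1 in \<open>auto simp: dist_real_def max_def\<close>)
    then show ?thesis using 1 by (simp add: max_def)
  next
    case 2
    have "((\<lambda>s::real. 0) has_real_derivative 0) (at s)" by simp
    then have "((\<lambda>s::real. max 0 s ^ Suc (Suc n)) has_real_derivative 0) (at s)"
      by (rule has_field_derivative_transform_within [where d = "-s"]) (use 2 in \<open>auto simp: dist_real_def max_def\<close>)
    then show ?thesis using 2 by (simp add: max_def)
  next
    case 3
    have "(\<lambda>h::real. (max 0 h ^ Suc (Suc n)) / h) \<midarrow>0\<rightarrow> 0"
    proof (rule Lim_null_comparison)
      show "\<forall>\<^sub>F h::real in at 0. norm ((max 0 h ^ Suc (Suc n)) / h) \<le> \<bar>h\<bar> ^ Suc n"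
      proof (intro always_eventually allI)
        fix h :: real
        show "norm ((max 0 h ^ Suc (Suc n)) / h) \<le> \<bar>h\<bar> ^ Suc n"
          by (cases "h > 0") (simp add: max_def, simp add: max_def zero_power del: power_Suc)
      qed
      show "((\<lambda>h::real. \<bar>h\<bar> ^ Suc n) \<longlongrightarrow> 0) (at 0)"
        by (auto intro!: tendsto_eq_intros)
    qed
    then show ?thesis using 3 by (simp add: has_field_derivative_iff)
  qed
qed

text \<open>The square is the kernel of the mean value formula. A power of 1 - |x|^2 is convenient
  because x times cutoff(x)^2 is the gradient of -cutoff(x)^3/6, which makes the matrix in the
  double integration by parts symmetric.\<close>

definition cutoff :: "'b::real_inner \<Rightarrow> real" where
  "cutoff x = max 0 (1 - x \<bullet> x)"

lemma cutoff_nonneg: "0 \<le> cutoff x" and cutoff_le_one: "cutoff x \<le> 1"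
  by (auto simp: cutoff_def)

lemma cutoff_eq_0: "1 \<le> norm x \<Longrightarrow> cutoff x = 0"
  by (simp add: cutoff_def dot_square_norm)

lemma continuous_on_cutoff [continuous_intros]:
  "continuous_on S f \<Longrightarrow> continuous_on S (\<lambda>x. cutoff (f x))"
  unfolding cutoff_def by (intro continuous_intros)

lemma cutoff_power_deriv:
  "((\<lambda>x. cutoff x ^ Suc (Suc n)) has_derivative
     (\<lambda>h. - 2 * real (n + 2) * (x \<bullet> h) * cutoff x ^ Suc n)) (at x)"
proof -
  have 1: "((\<lambda>s::real. max 0 s ^ Suc (Suc n)) has_derivative
      (*) (real (n + 2) * max 0 (1 - x \<bullet> x) ^ Suc n)) (at (1 - x \<bullet> x))"
    using max_zero_power_deriv by (simp add: has_field_derivative_def)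
  have 2: "((\<lambda>x. 1 - x \<bullet> x) has_derivative (\<lambda>h. - 2 * (x \<bullet> h))) (at x)"
    by (auto intro!: derivative_eq_intros simp: inner_commute)
  show ?thesis
    unfolding cutoff_def
    by (rule has_derivative_eq_rhs [OF has_derivative_compose [OF 2 1]]) (simp add: algebra_simps fun_eq_iff)
qed

lemma cutoff_sq_deriv:
  "((\<lambda>x. (cutoff x)\<^sup>2) has_derivative (\<lambda>h. - 4 * (x \<bullet> h) * cutoff x)) (at x)"
  using cutoff_power_deriv [of 0 x] by (simp add: numeral_2_eq_2)

text \<open>Integrals run over a box, the shape for which substitution and differentiation under the
  integral are at hand. Half-width 2 is 1 for the support of the kernel plus 1 for the
  translations.\<close>

definition base_box :: "'b::euclidean_space set" where
  "base_box = cbox (- 2 *\<^sub>R One) (2 *\<^sub>R One)"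

text \<open>The radius is chosen such that translates of \<open>base_box\<close> by vectors of norm at most 1 stay in the ball.\<close>

definition base_radius :: "'b::euclidean_space itself \<Rightarrow> real" where
  "base_radius _ = 2 * DIM('b) + 1"

lemma base_radius_gt_1: "1 < base_radius TYPE('b::euclidean_space)"
  by (simp add: base_radius_def)

lemma mem_base_box: "x \<in> base_box \<longleftrightarrow> (\<forall>u\<in>Basis. \<bar>x \<bullet> u\<bar> \<le> 2)"
  by (auto simp: base_box_def mem_box abs_le_iff)

lemma norm_base_box: "x \<in> base_box \<Longrightarrow> norm (x::'b::euclidean_space) \<le> base_radius TYPE('b) - 1"
proof -
  assume x: "x \<in> base_box"
  have "norm x \<le> (\<Sum>u\<in>Basis. \<bar>x \<bullet> u\<bar>)" by (rule norm_le_l1)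
  also have "\<dots> \<le> (\<Sum>u\<in>(Basis::'b set). 2)" by (rule sum_mono) (use x in \<open>auto simp: mem_base_box\<close>)
  finally show ?thesis by (simp add: base_radius_def)
qed

text \<open>The integral of a directional derivative of a compactly supported function vanishes because
  its translates all have the same integral.\<close>

lemma integral_directional_derivative_eq_0:
  fixes g :: "'b::euclidean_space \<Rightarrow> 'a::banach"
  assumes u: "norm u \<le> 1"
    and der: "\<And>x. norm x \<le> base_radius TYPE('b) \<Longrightarrow> (g has_derivative g' x) (at x)"
    and cont: "continuous_on (cball 0 (base_radius TYPE('b))) (\<lambda>x. g' x u)"
    and supp: "\<And>x. 1 \<le> norm x \<Longrightarrow> norm x \<le> base_radius TYPE('b) \<Longrightarrow> g x = 0"
  shows "integral base_box (\<lambda>x. g' x u) = 0"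
proof -
  define R where "R = base_radius TYPE('b)"
  define \<Phi> where "\<Phi> s = integral base_box (\<lambda>x. g (x + s *\<^sub>R u))" for s
  define P where "P = cbox (- One) (One::'b)"
  have nrm: "norm (x + s *\<^sub>R u) \<le> R" if "x \<in> base_box" "s \<in> {-1..1}" for x :: 'b and s
  proof -
    have "norm (s *\<^sub>R u) \<le> 1 * 1" unfolding norm_scaleR
      by (rule mult_mono) (use that u in \<open>auto\<close>)
    then show ?thesis using norm_triangle_ineq [of x "s *\<^sub>R u"] norm_base_box [OF that(1)] by (simp add: R_def)
  qed
  have contg: "continuous_on (cball 0 R) g"
    by (intro continuous_at_imp_continuous_on ballI has_derivative_continuous [OF der]) (auto simp: R_def)
  \<comment> \<open>Substitution turns \<Phi> s into the integral of \<open>g\<close> over the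
    shifted box \<open>cbox a c\<close>. That box still contains \<open>P\<close>, which in turn
    contains the support of \<open>g\<close>, so the value does not depend on s.\<close>
  have const: "\<Phi> s = integral P g" if s: "s \<in> {-1..1}" for s
  proof -
    define a c where "a = - 2 *\<^sub>R One + s *\<^sub>R u" and "c = 2 *\<^sub>R One + s *\<^sub>R u"
    have box: "cbox (a - s *\<^sub>R u) (c - s *\<^sub>R u) = base_box"
      by (simp add: base_box_def a_def c_def)
    have mem: "x - s *\<^sub>R u \<in> base_box" if "x \<in> cbox a c" for x
      using that unfolding box [symmetric] by (auto simp: mem_box algebra_simps)
    have sub: "norm x \<le> R" if "x \<in> cbox a c" for x
      using nrm [OF mem [OF that] s] by simp
    have "g integrable_on cbox a c"
      by (rule integrable_continuous) (rule continuous_on_subset [OF contg], use sub in auto)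
    then have "(g has_integral integral (cbox a c) g) (cbox a c)" by blast
    from has_integral_affinity' [OF this, of 1 "s *\<^sub>R u"]
    have "((\<lambda>x. g (x + s *\<^sub>R u)) has_integral integral (cbox a c) g) base_box"
      by (simp add: box)
    then have "\<Phi> s = integral (cbox a c) g" by (auto simp: \<Phi>_def)
    also have "\<dots> = integral (cbox a c) (\<lambda>x. if x \<in> P then g x else 0)"
    proof (rule integral_cong)
      fix x assume x: "x \<in> cbox a c"
      have "1 \<le> norm x" if "x \<notin> P"
      proof -
        have "\<not> (\<forall>w\<in>Basis. - 1 \<le> x \<bullet> w \<and> x \<bullet> w \<le> 1)"
          using that by (rule contrapos_nn) (auto simp: P_def mem_box)
        then obtain w where "w \<in> Basis" "\<not> (- 1 \<le> x \<bullet> w \<and> x \<bullet> w \<le> 1)" by blast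
        then show ?thesis using Basis_le_norm [of w x] by linarith
      qed
      then show "g x = (if x \<in> P then g x else 0)"
        using supp [of x] sub [OF x] by (auto simp: R_def)
    qed
    also have "\<dots> = integral P g"
    proof -
      have "x \<in> cbox a c" if "x \<in> P" for x
      proof -
        have "\<bar>s * (u \<bullet> w)\<bar> \<le> 1 * 1" if "w \<in> Basis" for w unfolding abs_mult
          by (rule mult_mono) (use s u Basis_le_norm [OF that, of u] in \<open>auto intro: order_trans\<close>)
        moreover have "- 1 \<le> x \<bullet> w \<and> x \<bullet> w \<le> 1" if "w \<in> Basis" for w
          using \<open>x \<in> P\<close> that by (auto simp: P_def mem_box)
        ultimately have "- 2 + s * (u \<bullet> w) \<le> x \<bullet> w \<and> x \<bullet> w \<le> 2 + s * (u \<bullet> w)" if "w \<in> Basis" for w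
          using that by (fastforce simp: abs_le_iff)
        then show ?thesis by (simp add: mem_box a_def c_def inner_add_left inner_diff_left)
      qed
      then have "P \<inter> cbox a c = P" by blast
      then show ?thesis by (simp add: integral_restrict_Int)
    qed
    finally show ?thesis .
  qed
  have "(\<Phi> has_vector_derivative integral base_box (\<lambda>x. g' (x + 0 *\<^sub>R u) u)) (at 0 within {-1..1})"
    unfolding \<Phi>_def base_box_def
  proof (rule leibniz_rule_vector_derivative, unfold base_box_def [symmetric])
    fix s :: real and x :: 'b assume s: "s \<in> {-1..1}" "x \<in> base_box"
    have "((\<lambda>s. g (x + s *\<^sub>R u)) has_derivative (\<lambda>h. g' (x + s *\<^sub>R u) (h *\<^sub>R u))) (at s)"
      by (rule has_derivative_compose [where f="\<lambda>s. x + s *\<^sub>R u"])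
        (use nrm [OF s(2,1)] in \<open>auto intro!: derivative_eq_intros der simp: R_def\<close>)
    moreover have "(\<lambda>h. g' (x + s *\<^sub>R u) (h *\<^sub>R u)) = (\<lambda>h. h *\<^sub>R g' (x + s *\<^sub>R u) u)"
      using has_derivative_linear [OF der [of "x + s *\<^sub>R u"]] nrm [OF s(2,1)]
      by (auto simp: linear_cmul R_def)
    ultimately show "((\<lambda>s. g (x + s *\<^sub>R u)) has_vector_derivative g' (x + s *\<^sub>R u) u) (at s within {-1..1})"
      unfolding has_vector_derivative_def by (auto intro: has_derivative_at_withinI)
  next
    fix s :: real assume s: "s \<in> {-1..1}"
    show "(\<lambda>x. g (x + s *\<^sub>R u)) integrable_on base_box" unfolding base_box_def
      by (rule integrable_continuous, unfold base_box_def [symmetric], rule continuous_on_compose2 [OF contg])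
        (use nrm s in \<open>auto intro!: continuous_intros\<close>)
  next
    show "continuous_on ({- 1..1} \<times> base_box) (\<lambda>(x, t). g' (t + x *\<^sub>R u) u)"
      unfolding split_def
      by (rule continuous_on_compose2 [OF cont]) (use nrm in \<open>auto intro!: continuous_intros simp: R_def\<close>)
  qed auto
  moreover have "(\<Phi> has_vector_derivative 0) (at 0 within {-1..1})"
    by (rule has_vector_derivative_transform [where f = "\<lambda>_. integral P g"]) (auto simp: const)
  ultimately have "integral base_box (\<lambda>x. g' (x + 0 *\<^sub>R u) u) = 0"
    by (rule vector_derivative_unique_within_closed_interval [of "-1" 1 0, unfolded cbox_interval, rotated 2]) auto
  then show ?thesis by simp
qed

text \<open>\<open>b\<close> selects N coordinates, \<open>e\<close> are the units of the operator
  sum_i e_i d_i and \<open>eb\<close> those of its conjugate. \<open>cliff\<close> is the polarized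
  form of the statement that the conjugate operator times the operator is the Laplacian in these N
  coordinates.\<close>

locale cr_system =
  fixes N :: nat and b :: "nat \<Rightarrow> 'b::euclidean_space"
    and e eb :: "nat \<Rightarrow> 'a::{real_algebra_1,euclidean_space}"
  assumes inj: "inj_on b {..<N}" and basis: "b ` {..<N} \<subseteq> Basis"
    and cliff: "\<And>i j. i < N \<Longrightarrow> j < N \<Longrightarrow> eb i * e j + eb j * e i = (if i = j then 2 else 0)"
begin

text \<open>The last clause makes \<open>f\<close> insensitive to the coordinates outside
  \<open>b\<close>, so that integrals over the full-dimensional box still see only the N variables
  of the operator.\<close>

definition monogenic_deriv :: "'b set \<Rightarrow> ('b \<Rightarrow> 'a) \<Rightarrow> ('b \<Rightarrow> 'b \<Rightarrow>\<^sub>L 'a) \<Rightarrow> bool" where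
  "monogenic_deriv U f f' \<longleftrightarrow> open U \<and>
     (\<forall>x\<in>U. (f has_derivative blinfun_apply (f' x)) (at x)) \<and> continuous_on U f' \<and>
     (\<forall>x\<in>U. (\<Sum>i<N. e i * f' x (b i)) = 0) \<and>
     (\<forall>x\<in>U. \<forall>u\<in>Basis - b ` {..<N}. f' x u = 0)"

definition monogenic_on :: "'b set \<Rightarrow> ('b \<Rightarrow> 'a) \<Rightarrow> bool" where
  "monogenic_on U f \<longleftrightarrow> (\<exists>f'. monogenic_deriv U f f')"

end

lemma base_ball_subset:
  fixes p :: "'b::euclidean_space"
  assumes "0 \<le> s" "cball p (s * base_radius TYPE('b)) \<subseteq> U" "norm x \<le> base_radius TYPE('b)"
  shows "p + s *\<^sub>R x \<in> U"
proof -
  have "norm (s *\<^sub>R x) \<le> s * base_radius TYPE('b)"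
    using assms(1,3) by (simp add: mult_left_mono)
  then show ?thesis using assms(2) by (auto simp: dist_norm subset_iff)
qed

lemma base_ball_box:
  fixes p :: "'b::euclidean_space"
  assumes "0 \<le> s" "cball p (s * base_radius TYPE('b)) \<subseteq> U" "x \<in> base_box"
  shows "p + s *\<^sub>R x \<in> U"
  by (rule base_ball_subset [OF assms(1,2)]) (use norm_base_box [OF assms(3)] in simp)

text \<open>The product of the kernel with f(p + s x) has compact support, so its directional
  derivative integrates to 0. The factor s is the chain rule for the rescaled argument.\<close>

lemma integral_cutoff_by_parts:
  fixes f :: "'b::euclidean_space \<Rightarrow> 'a::banach" and f' :: "'b \<Rightarrow> 'b \<Rightarrow>\<^sub>L 'a"
  assumes u: "u \<in> Basis" and s: "0 \<le> s" "cball p (s * base_radius TYPE('b)) \<subseteq> U"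
    and f: "\<And>x. x \<in> U \<Longrightarrow> (f has_derivative blinfun_apply (f' x)) (at x)" "continuous_on U f'"
    and \<kappa>: "\<And>x. (\<kappa> has_derivative \<kappa>' x) (at x)" "continuous_on UNIV (\<lambda>x. \<kappa>' x u)"
      "\<And>x. 1 \<le> norm x \<Longrightarrow> \<kappa> x = 0"
  shows "integral base_box (\<lambda>x. \<kappa>' x u *\<^sub>R f (p + s *\<^sub>R x)) =
    - s *\<^sub>R integral base_box (\<lambda>x. \<kappa> x *\<^sub>R f' (p + s *\<^sub>R x) u)"
proof -
  let ?r = "base_radius TYPE('b)"
  have cf: "continuous_on U f"
    by (intro continuous_at_imp_continuous_on ballI has_derivative_continuous [OF f(1)])
  have c\<kappa>: "continuous_on S \<kappa>" for S
    by (intro continuous_at_imp_continuous_on ballI has_derivative_continuous [OF \<kappa>(1)])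
  have 1: "continuous_on (cball 0 ?r) (\<lambda>x. \<kappa>' x u *\<^sub>R f (p + s *\<^sub>R x))"
    by (intro continuous_intros continuous_on_compose2 [OF cf] continuous_on_subset [OF \<kappa>(2)])
       (use base_ball_subset [OF s] in auto)
  have 2: "continuous_on (cball 0 ?r) (\<lambda>x. \<kappa> x *\<^sub>R f' (p + s *\<^sub>R x) u)"
    by (intro continuous_intros c\<kappa> continuous_on_compose2 [OF f(2)] blinfun.continuous_on)
       (use base_ball_subset [OF s] in auto)
  have sub: "base_box \<subseteq> cball (0::'b) ?r" using norm_base_box by force
  note i1 = integrable_continuous [OF continuous_on_subset [OF 1 sub [unfolded base_box_def]], folded base_box_def]
  note i2 = integrable_continuous [OF continuous_on_subset [OF 2 sub [unfolded base_box_def]], folded base_box_def]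
  have "integral base_box (\<lambda>x. \<kappa>' x u *\<^sub>R f (p + s *\<^sub>R x) + \<kappa> x *\<^sub>R f' (p + s *\<^sub>R x) (s *\<^sub>R u)) = 0"
  proof (rule integral_directional_derivative_eq_0 [where g = "\<lambda>x. \<kappa> x *\<^sub>R f (p + s *\<^sub>R x)"
        and g' = "\<lambda>x h. \<kappa>' x h *\<^sub>R f (p + s *\<^sub>R x) + \<kappa> x *\<^sub>R f' (p + s *\<^sub>R x) (s *\<^sub>R h)"])
    fix x :: 'b assume x: "norm x \<le> ?r"
    have "((\<lambda>x. f (p + s *\<^sub>R x)) has_derivative (\<lambda>h. f' (p + s *\<^sub>R x) (s *\<^sub>R h))) (at x)"
      by (rule has_derivative_compose [where f="\<lambda>x. p + s *\<^sub>R x"])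
         (auto intro!: derivative_eq_intros f base_ball_subset [OF s x])
    from has_derivative_scaleR [OF \<kappa>(1) this]
    show "((\<lambda>x. \<kappa> x *\<^sub>R f (p + s *\<^sub>R x)) has_derivative
      (\<lambda>h. \<kappa>' x h *\<^sub>R f (p + s *\<^sub>R x) + \<kappa> x *\<^sub>R f' (p + s *\<^sub>R x) (s *\<^sub>R h))) (at x)"
      by (simp add: add.commute)
  next
    show "continuous_on (cball 0 ?r) (\<lambda>x. \<kappa>' x u *\<^sub>R f (p + s *\<^sub>R x) + \<kappa> x *\<^sub>R f' (p + s *\<^sub>R x) (s *\<^sub>R u))"
      using continuous_on_add [OF 1 continuous_on_scaleR [OF continuous_on_const [of _ s] 2]]
      by (simp add: blinfun.scaleR_right mult.commute)
  qed (use u \<kappa>(3) in auto)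
  then have "integral base_box (\<lambda>x. \<kappa>' x u *\<^sub>R f (p + s *\<^sub>R x) + s *\<^sub>R (\<kappa> x *\<^sub>R f' (p + s *\<^sub>R x) u)) = 0"
    by (simp add: blinfun.scaleR_right mult.commute)
  moreover have "integral base_box (\<lambda>x. \<kappa>' x u *\<^sub>R f (p + s *\<^sub>R x) + s *\<^sub>R (\<kappa> x *\<^sub>R f' (p + s *\<^sub>R x) u)) =
      integral base_box (\<lambda>x. \<kappa>' x u *\<^sub>R f (p + s *\<^sub>R x)) + s *\<^sub>R integral base_box (\<lambda>x. \<kappa> x *\<^sub>R f' (p + s *\<^sub>R x) u)"
    by (simp only: integral_add [OF i1 integrable_cmul [OF i2]] integral_cmul)
  ultimately show ?thesis by (simp add: eq_neg_iff_add_eq_0)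
qed

text \<open>Boundedness comes from finite dimension, since the norm need not be
  submultiplicative.\<close>

lemma bounded_linear_left_mult:
  fixes c :: "'a::{real_algebra_1,euclidean_space}"
  shows "bounded_linear (\<lambda>x. c * x)"
  by (rule linear_conv_bounded_linear [THEN iffD1]) (auto intro!: linearI simp: algebra_simps)

section \<open>Weak harmonicity and the mean value formula\<close>

context cr_system begin

lemma integrable_box:
  fixes f' :: "'b \<Rightarrow> 'b \<Rightarrow>\<^sub>L 'a"
  assumes s: "0 \<le> s" "cball p (s * base_radius TYPE('b)) \<subseteq> U" and f: "continuous_on U f'" and \<kappa>: "continuous_on UNIV \<kappa>"
  shows "(\<lambda>x. \<kappa> x *\<^sub>R f' (p + s *\<^sub>R x) u) integrable_on base_box"
  unfolding base_box_def
  by (intro integrable_continuous continuous_intros continuous_on_subset [OF \<kappa>] continuous_on_compose2 [OF f] blinfun.continuous_on)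
     (use base_ball_box [OF s, unfolded base_box_def] in auto)

text \<open>Integrating by parts twice shows that the matrix \<open>S\<close> of integrals of \<open>\<partial>\<^sub>a\<psi> \<partial>\<^sub>bf\<close> is symmetric;
  contracting the Cauchy-Riemann equation with the conjugate units leaves its trace.\<close>

lemma weakly_harmonic:
  assumes f: "monogenic_deriv U f f'" and s: "0 < s" "cball p (s * base_radius TYPE('b)) \<subseteq> U"
  shows "(\<Sum>u\<in>Basis. integral base_box (\<lambda>x. ((x \<bullet> u) * cutoff x ^ 2) *\<^sub>R f' (p + s *\<^sub>R x) u)) = 0"
proof -
  have der: "\<And>x. x \<in> U \<Longrightarrow> (f has_derivative blinfun_apply (f' x)) (at x)" and cont: "continuous_on U f'"
    and cr: "\<And>x. x \<in> U \<Longrightarrow> (\<Sum>i<N. e i * f' x (b i)) = 0"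
    and zero: "\<And>x u. x \<in> U \<Longrightarrow> u \<in> Basis - b ` {..<N} \<Longrightarrow> f' x u = 0"
    using f by (auto simp: monogenic_deriv_def)
  define S where "S u w = integral base_box (\<lambda>x. ((x \<bullet> u) * cutoff x ^ 2) *\<^sub>R f' (p + s *\<^sub>R x) w)" for u w
  have int: "(\<lambda>x. ((x \<bullet> u) * cutoff x ^ 2) *\<^sub>R f' (p + s *\<^sub>R x) w) integrable_on base_box" for u w
    by (rule integrable_box [OF _ s(2) cont]) (use s in \<open>auto intro!: continuous_intros\<close>)
  \<comment> \<open>With \<psi> = -cutoff^3/6, whose u-derivative is (x.u) cutoff^2, integration by
    parts moves the derivative off \<open>f\<close>. What remains under the integral is the Hessian
    of \<psi>, which is symmetric in u and w.\<close>
  have sym: "S u w = S w u" if "u \<in> Basis" "w \<in> Basis" for u w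
  proof -
    have *: "s *\<^sub>R S u w = - integral base_box (\<lambda>x. ((w \<bullet> u) * cutoff x ^ 2 - 4 * (x \<bullet> u) * (x \<bullet> w) * cutoff x) *\<^sub>R f (p + s *\<^sub>R x))"
      if w: "w \<in> Basis" for u w
      unfolding S_def
    proof (subst integral_cutoff_by_parts [where \<kappa>' = "\<lambda>x h. (h \<bullet> u) * cutoff x ^ 2 - 4 * (x \<bullet> u) * (x \<bullet> h) * cutoff x"
          and U = U and \<kappa> = "\<lambda>x. (x \<bullet> u) * cutoff x ^ 2" and f' = f'])
      fix x
      show "((\<lambda>x. (x \<bullet> u) * cutoff x ^ 2) has_derivative
         (\<lambda>h. (h \<bullet> u) * cutoff x ^ 2 - 4 * (x \<bullet> u) * (x \<bullet> h) * cutoff x)) (at x)"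
        by (rule has_derivative_eq_rhs, rule has_derivative_mult [OF _ cutoff_sq_deriv], rule derivative_intros)
           (auto simp: algebra_simps fun_eq_iff)
      show "continuous_on UNIV (\<lambda>x. (w \<bullet> u) * cutoff x ^ 2 - 4 * (x \<bullet> u) * (x \<bullet> w) * cutoff x)"
        by (intro continuous_intros)
    qed (use w s der cont in \<open>auto simp: cutoff_eq_0\<close>)
    have "s *\<^sub>R S u w = s *\<^sub>R S w u"
      unfolding * [OF that(1)] * [OF that(2)] by (simp add: inner_commute mult.commute mult.left_commute)
    then show ?thesis using s by simp
  qed
  \<comment> \<open>The Cauchy-Riemann equation holds at each point of the box and left
    multiplication by e_j is linear, so the equation survives weighted integration.\<close>
  have contr: "(\<Sum>j<N. e j * S u (b j)) = 0" for u
  proof -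
    have "(\<Sum>j<N. e j * S u (b j)) =
        (\<Sum>j<N. integral base_box (\<lambda>x. e j * (((x \<bullet> u) * cutoff x ^ 2) *\<^sub>R f' (p + s *\<^sub>R x) (b j))))"
      unfolding S_def by (intro sum.cong refl integral_linear [OF int bounded_linear_left_mult, unfolded o_def, symmetric])
    also have "\<dots> = integral base_box (\<lambda>x. \<Sum>j<N. e j * (((x \<bullet> u) * cutoff x ^ 2) *\<^sub>R f' (p + s *\<^sub>R x) (b j)))"
      by (rule integral_sum [symmetric])
         (simp, rule integrable_linear [OF int bounded_linear_left_mult, unfolded o_def])
    also have "\<dots> = integral base_box (\<lambda>x::'b. 0)"
    proof (rule integral_cong)
      fix x :: 'b assume "x \<in> base_box"
      then have "p + s *\<^sub>R x \<in> U" using base_ball_box s by (metis less_imp_le)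
      then show "(\<Sum>j<N. e j * (((x \<bullet> u) * cutoff x ^ 2) *\<^sub>R f' (p + s *\<^sub>R x) (b j))) = 0"
        using cr by (simp flip: scaleR_right.sum)
    qed
    finally show ?thesis by simp
  qed
  have bB: "b i \<in> Basis" if "i < N" for i using basis that by auto
  \<comment> \<open>Symmetry of S allows the coefficient eb_i e_j to be replaced by half of eb_i e_j
    + eb_j e_i, which \<open>cliff\<close> reduces to the identity matrix.\<close>
  have "(\<Sum>i<N. \<Sum>j<N. eb i * e j * S (b i) (b j)) = 0"
    by (simp add: mult.assoc contr flip: sum_distrib_left)
  moreover have "(\<Sum>i<N. \<Sum>j<N. eb i * e j * S (b i) (b j)) = (\<Sum>i<N. \<Sum>j<N. eb j * e i * S (b i) (b j))"
    by (subst sum.swap) (auto intro!: sum.cong simp: sym bB)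
  ultimately have "0 = (\<Sum>i<N. \<Sum>j<N. (eb i * e j + eb j * e i) * S (b i) (b j))"
    by (simp add: distrib_right sum.distrib)
  also have "\<dots> = (\<Sum>i<N. \<Sum>j<N. if i = j then 2 * S (b i) (b j) else 0)"
    by (intro sum.cong) (auto simp: cliff)
  also have "\<dots> = 2 * (\<Sum>i<N. S (b i) (b i))"
    by (simp add: sum_distrib_left)
  finally have "2 *\<^sub>R (\<Sum>i<N. S (b i) (b i)) = 0"
    by (simp add: scaleR_2 mult_2)
  then have *: "(\<Sum>u\<in>b ` {..<N}. S u u) = 0"
    by (simp add: sum.reindex [OF inj])
  have "S u u = 0" if "u \<in> Basis - b ` {..<N}" for u
  proof -
    have "S u u = integral base_box (\<lambda>x::'b. 0)" unfolding S_def
    proof (rule integral_cong)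
      fix x :: 'b assume "x \<in> base_box"
      then have "p + s *\<^sub>R x \<in> U" using base_ball_box s by (metis less_imp_le)
      then show "((x \<bullet> u) * cutoff x ^ 2) *\<^sub>R f' (p + s *\<^sub>R x) u = 0"
        using zero [OF _ that] by simp
    qed
    then show ?thesis by simp
  qed
  then have "(\<Sum>u\<in>Basis. S u u) = (\<Sum>u\<in>b ` {..<N}. S u u)"
    by (intro sum.mono_neutral_right) (use basis in auto)
  then show ?thesis using * by (simp add: S_def)
qed

end

definition cutoff_mass :: "'b::euclidean_space itself \<Rightarrow> real" where
  "cutoff_mass _ = integral base_box (\<lambda>x::'b. (cutoff x)\<^sup>2)"

lemma cutoff_mass_pos: "0 < cutoff_mass TYPE('b::euclidean_space)"
proof -
  have int: "(\<lambda>x::'b. (cutoff x)\<^sup>2) integrable_on base_box"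
    unfolding base_box_def by (intro integrable_continuous continuous_intros)
  have "cutoff_mass TYPE('b) \<ge> 0"
    unfolding cutoff_mass_def by (rule integral_nonneg [OF int]) simp
  moreover have "cutoff_mass TYPE('b) \<noteq> 0"
  proof
    assume "cutoff_mass TYPE('b) = 0"
    then have "((\<lambda>x::'b. (cutoff x)\<^sup>2) has_integral 0) base_box"
      using integrable_integral [OF int] by (simp add: cutoff_mass_def)
    then have "(cutoff (0::'b))\<^sup>2 = 0" unfolding base_box_def
      by (rule has_integral_0_cbox_imp_0 [rotated 2])
         (auto intro!: continuous_intros simp: mem_box box_eq_empty)
    then show False by (simp add: cutoff_def)
  qed
  ultimately show ?thesis by simp
qed

lemma integral_cutoff_const:
  fixes c :: "'a::euclidean_space"
  shows "integral base_box (\<lambda>x::'b::euclidean_space. (cutoff x)\<^sup>2 *\<^sub>R c) = cutoff_mass TYPE('b) *\<^sub>R c"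
proof -
  have int: "(\<lambda>x::'b. (cutoff x)\<^sup>2) integrable_on base_box"
    unfolding base_box_def by (intro integrable_continuous continuous_intros)
  show ?thesis
    using integral_linear [OF int bounded_linear_scaleR_left [of c]] by (simp add: o_def cutoff_mass_def)
qed

context cr_system begin

lemma monogenic_derivD:
  assumes "monogenic_deriv U f f'"
  shows "open U" "\<And>x. x \<in> U \<Longrightarrow> (f has_derivative blinfun_apply (f' x)) (at x)" "continuous_on U f'"
    "\<And>x. x \<in> U \<Longrightarrow> (\<Sum>i<N. e i * f' x (b i)) = 0"
    "\<And>x u. x \<in> U \<Longrightarrow> u \<in> Basis - b ` {..<N} \<Longrightarrow> f' x u = 0"
    "continuous_on U f"
  using assms
  by (auto simp: monogenic_deriv_def intro!: continuous_at_imp_continuous_on has_derivative_continuous)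

text \<open>The average at scale s has as s-derivative the sum that \<open>weakly_harmonic\<close>
  makes vanish. It therefore keeps its value at s = 0, the mass of the kernel times
  \<open>f p\<close>.\<close>

lemma mean_value:
  assumes f: "monogenic_deriv U f f'" and r: "0 \<le> r" "cball p (r * base_radius TYPE('b)) \<subseteq> U"
  shows "integral base_box (\<lambda>x. (cutoff x)\<^sup>2 *\<^sub>R f (p + r *\<^sub>R x)) = cutoff_mass TYPE('b) *\<^sub>R f p"
proof (cases "r = 0")
  case True
  then show ?thesis by (simp add: integral_cutoff_const)
next
  case False
  note D = monogenic_derivD [OF f]
  define G where "G s = integral base_box (\<lambda>x. (cutoff x)\<^sup>2 *\<^sub>R f (p + s *\<^sub>R x))" for s
  have sub: "cball p (s * base_radius TYPE('b)) \<subseteq> U" if "s \<in> {0..r}" for s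
  proof -
    have "s * base_radius TYPE('b) \<le> r * base_radius TYPE('b)"
      using that base_radius_gt_1 [where 'b='b] by (intro mult_right_mono) auto
    then show ?thesis using r(2) by (meson cball_subset_cball_iff subset_cball subset_trans)
  qed
  have U: "p + s *\<^sub>R x \<in> U" if "s \<in> {0..r}" "x \<in> base_box" for s x
    by (rule base_ball_box [OF _ sub]) (use that in auto)
  have G': "(G has_vector_derivative integral base_box (\<lambda>x. (cutoff x)\<^sup>2 *\<^sub>R f' (p + s *\<^sub>R x) x)) (at s within {0..r})"
    if s: "s \<in> {0..r}" for s
    unfolding G_def base_box_def
  proof (rule leibniz_rule_vector_derivative, unfold base_box_def [symmetric])
    fix s :: real and x :: 'b assume s: "s \<in> {0..r}" "x \<in> base_box"
    have "((\<lambda>s. f (p + s *\<^sub>R x)) has_derivative (\<lambda>h. f' (p + s *\<^sub>R x) (h *\<^sub>R x))) (at s)"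
      by (rule has_derivative_compose [where f="\<lambda>s. p + s *\<^sub>R x"])
         (auto intro!: derivative_eq_intros D U s)
    from has_derivative_scaleR_right [OF this, of "(cutoff x)\<^sup>2"]
    show "((\<lambda>s. (cutoff x)\<^sup>2 *\<^sub>R f (p + s *\<^sub>R x)) has_vector_derivative (cutoff x)\<^sup>2 *\<^sub>R f' (p + s *\<^sub>R x) x)
        (at s within {0..r})"
      unfolding has_vector_derivative_def
      by (auto intro: has_derivative_at_withinI simp: blinfun.scaleR_right mult.commute)
  next
    fix s :: real assume "s \<in> {0..r}"
    then show "(\<lambda>x. (cutoff x)\<^sup>2 *\<^sub>R f (p + s *\<^sub>R x)) integrable_on base_box"
      unfolding base_box_def
      by (intro integrable_continuous continuous_intros continuous_on_compose2 [OF D(6)])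
        (use U in \<open>auto simp: base_box_def\<close>)
  next
    show "continuous_on ({0..r} \<times> base_box) (\<lambda>(s, x). (cutoff x)\<^sup>2 *\<^sub>R f' (p + s *\<^sub>R x) x)"
      unfolding split_def
      by (intro continuous_intros continuous_on_compose2 [OF D(3)] blinfun.continuous_on) (use U in auto)
  qed (use s in auto)
  have G0: "integral base_box (\<lambda>x. (cutoff x)\<^sup>2 *\<^sub>R f' (p + s *\<^sub>R x) x) = 0" if s: "s \<in> {0<..r}" for s
  proof -
    have "integral base_box (\<lambda>x. (cutoff x)\<^sup>2 *\<^sub>R f' (p + s *\<^sub>R x) x) =
      integral base_box (\<lambda>x. \<Sum>u\<in>Basis. ((x \<bullet> u) * cutoff x ^ 2) *\<^sub>R f' (p + s *\<^sub>R x) u)"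
    proof (rule integral_cong)
      fix x :: 'b
      have "f' (p + s *\<^sub>R x) x = f' (p + s *\<^sub>R x) (\<Sum>u\<in>Basis. (x \<bullet> u) *\<^sub>R u)"
        by (simp add: euclidean_representation)
      then show "(cutoff x)\<^sup>2 *\<^sub>R f' (p + s *\<^sub>R x) x = (\<Sum>u\<in>Basis. ((x \<bullet> u) * cutoff x ^ 2) *\<^sub>R f' (p + s *\<^sub>R x) u)"
        by (simp add: blinfun.sum_right blinfun.scaleR_right scaleR_right.sum mult.commute)
    qed
    also have "\<dots> = (\<Sum>u\<in>Basis. integral base_box (\<lambda>x. ((x \<bullet> u) * cutoff x ^ 2) *\<^sub>R f' (p + s *\<^sub>R x) u))"
      by (intro integral_sum integrable_box [OF _ sub D(3)]) (use s in \<open>auto intro!: continuous_intros\<close>)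
    also have "\<dots> = 0" by (rule weakly_harmonic [OF f _ sub]) (use s in auto)
    finally show ?thesis .
  qed
  have G: "(G has_vector_derivative (if s = 0 then integral base_box (\<lambda>x. (cutoff x)\<^sup>2 *\<^sub>R f' (p + s *\<^sub>R x) x) else 0)) (at s within {0..r})"
    if "s \<in> {0..r}" for s using G' [OF that] G0 [of s] that by (cases "s = 0") auto
  have "G r = G 0"
  proof (rule has_derivative_zero_unique_strong_interval [of "{0}" 0 r G "G 0" r])
    show "continuous_on {0..r} G"
      by (rule continuous_on_vector_derivative [OF G])
    fix s assume "s \<in> {0..r} - {0}"
    then show "(G has_derivative (\<lambda>h. 0)) (at s within {0..r})"
      using G [of s] by (auto simp: has_vector_derivative_def)
  qed (use r in auto)
  then show ?thesis
    by (simp add: G_def integral_cutoff_const)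
qed

text \<open>The derivative of \<open>f\<close> with the differentiation moved onto the kernel: 4
  (x.u) cutoff(x) is minus the u-derivative of cutoff(x)^2. Only values of \<open>f\<close> enter,
  which is the source of smoothness and of the Cauchy estimates.\<close>

definition smoothed_deriv :: "('b \<Rightarrow> 'a) \<Rightarrow> real \<Rightarrow> 'b \<Rightarrow> 'b \<Rightarrow> 'a" where
  "smoothed_deriv f r u p = (4 / (r * cutoff_mass TYPE('b))) *\<^sub>R
     integral base_box (\<lambda>x. ((x \<bullet> u) * cutoff x) *\<^sub>R f (p + r *\<^sub>R x))"

text \<open>Applied to two kernels: cutoff^2, to differentiate the mean value formula, and (x.u)
  cutoff, to differentiate \<open>smoothed_deriv\<close>.\<close>

lemma leibniz_box:
  fixes \<kappa> :: "'b \<Rightarrow> real"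
  assumes f: "monogenic_deriv U f f'" and r: "0 \<le> r" "\<And>p. p \<in> P \<Longrightarrow> cball p (r * base_radius TYPE('b)) \<subseteq> U"
    and P: "convex P" "open P" "p \<in> P" and \<kappa>: "continuous_on UNIV \<kappa>"
  shows "((\<lambda>p. integral base_box (\<lambda>x. \<kappa> x *\<^sub>R f (p + r *\<^sub>R x))) has_derivative
          blinfun_apply (integral base_box (\<lambda>x. \<kappa> x *\<^sub>R f' (p + r *\<^sub>R x)))) (at p)" (is ?A)
    and "blinfun_apply (integral base_box (\<lambda>x. \<kappa> x *\<^sub>R f' (p + r *\<^sub>R x))) w =
          integral base_box (\<lambda>x. \<kappa> x *\<^sub>R f' (p + r *\<^sub>R x) w)" (is ?B)
    and "continuous_on P (\<lambda>p. integral base_box (\<lambda>x. \<kappa> x *\<^sub>R f' (p + r *\<^sub>R x)))" (is ?C)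
proof -
  note D = monogenic_derivD [OF f]
  have U: "p + r *\<^sub>R x \<in> U" if "p \<in> P" "x \<in> base_box" for p x
    by (rule base_ball_box [OF r(1) r(2)]) (use that in auto)
  have \<kappa>': "continuous_on S (\<lambda>x. \<kappa> (g x))" if "continuous_on S g" for S and g :: "'x::topological_space \<Rightarrow> 'b"
    by (rule continuous_on_compose2 [OF \<kappa> that]) auto
  have cont: "continuous_on (P \<times> base_box) (\<lambda>(p, x). \<kappa> x *\<^sub>R f' (p + r *\<^sub>R x))"
    unfolding split_def
    by (intro continuous_intros \<kappa>' continuous_on_compose2 [OF D(3)]) (use U in auto)
  have "((\<lambda>p. integral base_box (\<lambda>x. \<kappa> x *\<^sub>R f (p + r *\<^sub>R x))) has_derivative
          blinfun_apply (integral base_box (\<lambda>x. \<kappa> x *\<^sub>R f' (p + r *\<^sub>R x)))) (at p within P)"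
    unfolding base_box_def
  proof (rule leibniz_rule, unfold base_box_def [symmetric])
    fix p x :: 'b assume px: "p \<in> P" "x \<in> base_box"
    have "((\<lambda>p. f (p + r *\<^sub>R x)) has_derivative f' (p + r *\<^sub>R x)) (at p)"
      by (rule has_derivative_compose [where f="\<lambda>p. p + r *\<^sub>R x" and f'="\<lambda>h. h"])
         (auto intro!: derivative_eq_intros D U px)
    from has_derivative_scaleR_right [OF this, of "\<kappa> x"]
    show "((\<lambda>p. \<kappa> x *\<^sub>R f (p + r *\<^sub>R x)) has_derivative blinfun_apply (\<kappa> x *\<^sub>R f' (p + r *\<^sub>R x))) (at p within P)"
      by (auto intro: has_derivative_at_withinI simp: scaleR_blinfun.rep_eq)
  next
    fix p assume "p \<in> P"
    then show "(\<lambda>x. \<kappa> x *\<^sub>R f (p + r *\<^sub>R x)) integrable_on base_box"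
      unfolding base_box_def
      by (intro integrable_continuous continuous_intros \<kappa>' continuous_on_compose2 [OF D(6)])
        (use U in \<open>auto simp: base_box_def\<close>)
  qed (use cont P in auto)
  then show ?A by (simp add: at_within_open [OF P(3,2)])
  have int: "(\<lambda>x. \<kappa> x *\<^sub>R f' (p + r *\<^sub>R x)) integrable_on base_box"
    unfolding base_box_def
    by (intro integrable_continuous continuous_intros \<kappa>' continuous_on_compose2 [OF D(3)])
        (use U P in \<open>auto simp: base_box_def\<close>)
  show ?B
    by (simp add: blinfun_apply_integral [OF int] scaleR_blinfun.rep_eq)
  show ?C
    using integral_continuous_on_param [OF cont [unfolded base_box_def]] by (simp add: base_box_def)
qed

text \<open>Both sides of the mean value formula are differentiated in the centre p, and the
  derivative under the integral is then moved to the kernel.\<close>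

lemma deriv_eq_smoothed:
  assumes f: "monogenic_deriv U f f'" and r: "0 < r" "cball p (r * base_radius TYPE('b)) \<subseteq> U" and u: "u \<in> Basis"
  shows "f' p u = smoothed_deriv f r u p"
proof -
  note D = monogenic_derivD [OF f]
  \<comment> \<open>Differentiation needs the formula with the same r at all centres near p;
    compactness of the closed ball provides the margin.\<close>
  obtain \<delta> where \<delta>: "\<delta> > 0" "\<And>q. q \<in> ball p \<delta> \<Longrightarrow> cball q (r * base_radius TYPE('b)) \<subseteq> U"
  proof -
    have "compact (cball p (r * base_radius TYPE('b)))" by simp
    then obtain \<delta> where \<delta>: "\<delta> > 0" "(\<Union>x\<in>cball p (r * base_radius TYPE('b)). cball x \<delta>) \<subseteq> U"
      using compact_subset_open_imp_cball_epsilon_subset [OF _ D(1) r(2)] by blast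
    show thesis
    proof (rule that [OF \<delta>(1)])
      fix q assume q: "q \<in> ball p \<delta>"
      show "cball q (r * base_radius TYPE('b)) \<subseteq> U"
      proof
        fix x assume "x \<in> cball q (r * base_radius TYPE('b))"
        then have "x + (p - q) \<in> cball p (r * base_radius TYPE('b))" and "x \<in> cball (x + (p - q)) \<delta>"
          using q by (auto simp: dist_norm norm_minus_commute algebra_simps)
        then show "x \<in> U" using \<delta>(2) by blast
      qed
    qed
  qed
  have ball: "p \<in> ball p \<delta>" using \<delta> by simp
  note L = leibniz_box [OF f _ \<delta>(2) convex_ball open_ball ball]
  have "((\<lambda>p. integral base_box (\<lambda>x. (cutoff x)\<^sup>2 *\<^sub>R f (p + r *\<^sub>R x))) has_derivative
          blinfun_apply (integral base_box (\<lambda>x. (cutoff x)\<^sup>2 *\<^sub>R f' (p + r *\<^sub>R x)))) (at p)"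
    by (rule L) (use r in \<open>auto intro!: continuous_intros\<close>)
  then have a1: "((\<lambda>p. cutoff_mass TYPE('b) *\<^sub>R f p) has_derivative
          blinfun_apply (integral base_box (\<lambda>x. (cutoff x)\<^sup>2 *\<^sub>R f' (p + r *\<^sub>R x)))) (at p)"
    by (rule has_derivative_transform_within_open [OF _ open_ball ball])
       (use r in \<open>auto intro!: mean_value [OF f _ \<delta>(2)]\<close>)
  have a2: "((\<lambda>p. cutoff_mass TYPE('b) *\<^sub>R f p) has_derivative (\<lambda>h. cutoff_mass TYPE('b) *\<^sub>R f' p h)) (at p)"
    by (rule has_derivative_scaleR_right [OF D(2)])
       (use r base_radius_gt_1 [where 'b='b] in \<open>auto intro!: mult_nonneg_nonneg\<close>)
  have "cutoff_mass TYPE('b) *\<^sub>R f' p u = integral base_box (\<lambda>x. (cutoff x)\<^sup>2 *\<^sub>R f' (p + r *\<^sub>R x)) u"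
    by (rule fun_cong [OF has_derivative_unique [OF a2 a1]])
  also have "\<dots> = integral base_box (\<lambda>x. (cutoff x)\<^sup>2 *\<^sub>R f' (p + r *\<^sub>R x) u)"
    by (rule L(2)) (use r in \<open>auto intro!: continuous_intros\<close>)
  finally have 1: "cutoff_mass TYPE('b) *\<^sub>R f' p u = integral base_box (\<lambda>x. (cutoff x)\<^sup>2 *\<^sub>R f' (p + r *\<^sub>R x) u)" .
  have "integral base_box (\<lambda>x. (- 4 * (x \<bullet> u) * cutoff x) *\<^sub>R f (p + r *\<^sub>R x)) =
      - r *\<^sub>R integral base_box (\<lambda>x. (cutoff x)\<^sup>2 *\<^sub>R f' (p + r *\<^sub>R x) u)"
    by (rule integral_cutoff_by_parts [OF u _ r(2) D(2,3) cutoff_sq_deriv])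
       (use r in \<open>auto intro!: continuous_intros simp: cutoff_eq_0\<close>)
  moreover have "integral base_box (\<lambda>x. (- 4 * (x \<bullet> u) * cutoff x) *\<^sub>R f (p + r *\<^sub>R x)) =
      - 4 *\<^sub>R integral base_box (\<lambda>x. ((x \<bullet> u) * cutoff x) *\<^sub>R f (p + r *\<^sub>R x))"
    by (subst integral_cmul [symmetric]) (simp add: mult.assoc)
  ultimately have "(r * cutoff_mass TYPE('b)) *\<^sub>R f' p u =
      4 *\<^sub>R integral base_box (\<lambda>x. ((x \<bullet> u) * cutoff x) *\<^sub>R f (p + r *\<^sub>R x))"
    by (simp flip: 1)
  then have "(1 / (r * cutoff_mass TYPE('b))) *\<^sub>R ((r * cutoff_mass TYPE('b)) *\<^sub>R f' p u) =
      (1 / (r * cutoff_mass TYPE('b))) *\<^sub>R (4 *\<^sub>R integral base_box (\<lambda>x. ((x \<bullet> u) * cutoff x) *\<^sub>R f (p + r *\<^sub>R x)))"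
    by simp
  then show ?thesis using r cutoff_mass_pos [where 'b='b] by (simp add: smoothed_deriv_def)
qed

end

section \<open>Analyticity and the identity principle\<close>

text \<open>The left side is \<open>fact m\<close> times the term of index m in the exponential
  series at m. It turns the m^m produced by m successive gradient estimates into a
  factorial.\<close>

lemma power_self_le_exp_fact: "real m ^ m \<le> exp (real m) * fact m"
proof -
  have "real m ^ m / fact m \<le> exp (real m)"
    using sum_le_suminf [OF summable_exp [of "real m"], of "{m}"]
    by (simp add: exp_def divide_inverse mult.commute)
  then show ?thesis by (simp add: field_simps)
qed

context cr_system begin

lemma mem_Basis [simp]: "i < N \<Longrightarrow> b i \<in> Basis"
  using basis by auto

lemma monogenic_on_transform:
  assumes "monogenic_on U f" "\<And>x. x \<in> U \<Longrightarrow> f x = g x"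
  shows "monogenic_on U g"
proof -
  obtain f' where f: "monogenic_deriv U f f'" using assms(1) by (auto simp: monogenic_on_def)
  note D = monogenic_derivD [OF f]
  have "(g has_derivative f' x) (at x)" if "x \<in> U" for x
    by (rule has_derivative_transform_within_open [OF D(2) D(1)]) (use assms that in auto)
  then show ?thesis using f unfolding monogenic_on_def monogenic_deriv_def by blast
qed

text \<open>The local derivatives agree on overlaps because a derivative at a point is unique, so
  the Frechet derivative serves as one global witness.\<close>

lemma monogenic_on_local:
  assumes "\<And>p. p \<in> U \<Longrightarrow> \<exists>P. p \<in> P \<and> P \<subseteq> U \<and> monogenic_on P f"
  shows "monogenic_on U f"
proof -
  define F where "F x = Blinfun (frechet_derivative f (at x))" for x
  have F: "F x = f' x" if "monogenic_deriv P f f'" "x \<in> P" for P f' x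
  proof -
    have "(f has_derivative f' x) (at x)" using that by (auto simp: monogenic_deriv_def)
    then have "frechet_derivative f (at x) = blinfun_apply (f' x)" by (rule frechet_derivative_at [symmetric])
    then show ?thesis by (simp add: F_def blinfun_apply_inverse)
  qed
  have loc: "\<exists>P. p \<in> P \<and> P \<subseteq> U \<and> monogenic_deriv P f F" if p: "p \<in> U" for p
  proof -
    obtain P f' where P: "p \<in> P" "P \<subseteq> U" "monogenic_deriv P f f'"
      using assms [OF p] by (auto simp: monogenic_on_def)
    have "continuous_on P F \<longleftrightarrow> continuous_on P f'" by (rule continuous_on_cong) (auto simp: F [OF P(3)])
    then have "monogenic_deriv P f F" using P(3) by (simp add: monogenic_deriv_def F [OF P(3)])
    then show ?thesis using P by blast
  qed
  have "monogenic_deriv U f F"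
    unfolding monogenic_deriv_def
  proof (intro conjI ballI)
    show "open U" proof (subst open_subopen, rule ballI)
      fix p assume "p \<in> U"
      then obtain P where "p \<in> P" "P \<subseteq> U" "monogenic_deriv P f F" using loc by blast
      then show "\<exists>T. open T \<and> p \<in> T \<and> T \<subseteq> U" using monogenic_derivD(1) by blast
    qed
    show "continuous_on U F"
    proof (rule continuous_at_imp_continuous_on, rule ballI)
      fix p assume "p \<in> U"
      then obtain P where "p \<in> P" "monogenic_deriv P f F" using loc by blast
      then show "isCont F p" by (auto simp: monogenic_deriv_def continuous_on_eq_continuous_at)
    qed
  next
    fix p assume "p \<in> U"
    then obtain P where P: "p \<in> P" "monogenic_deriv P f F" using loc by blast
    show "(f has_derivative F p) (at p)" "(\<Sum>i<N. e i * F p (b i)) = 0"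
      using monogenic_derivD [OF P(2)] P(1) by auto
    fix u assume "u \<in> Basis - b ` {..<N}"
    then show "F p u = 0" using monogenic_derivD(5) [OF P(2)] P(1) by auto
  qed
  then show ?thesis by (auto simp: monogenic_on_def)
qed

text \<open>Near p the partial derivative equals \<open>smoothed_deriv\<close> with one fixed
  radius. That integral is again C^1, and its Cauchy-Riemann equation is the one of \<open>f\<close>
  integrated against the kernel. Iteration upgrades C^1 to derivatives of all orders.\<close>

lemma monogenic_on_deriv:
  assumes f: "monogenic_deriv U f f'" and u: "u \<in> Basis"
  shows "monogenic_on U (\<lambda>x. f' x u)"
proof (rule monogenic_on_local)
  fix p assume "p \<in> U"
  note D = monogenic_derivD [OF f]
  let ?R = "base_radius TYPE('b)"
  obtain \<delta> where \<delta>: "\<delta> > 0" "cball p \<delta> \<subseteq> U"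
    using D(1) \<open>p \<in> U\<close> open_contains_cball by blast
  \<comment> \<open>The kernel then reaches points at distance at most \<delta>/2, so centres within
    \<delta>/2 of p keep it inside \<open>cball p \<delta>\<close>.\<close>
  define r where "r = \<delta> / (2 * ?R)"
  define P where "P = ball p (\<delta> / 2)"
  have r: "r > 0" "r * ?R = \<delta> / 2" using \<delta> base_radius_gt_1 [where 'b='b] by (auto simp: r_def)
  have sub: "cball q (r * ?R) \<subseteq> U" if "q \<in> P" for q
  proof -
    have "cball q (\<delta> / 2) \<subseteq> cball p \<delta>" using that by (simp add: P_def cball_subset_cball_iff dist_commute)
    then show ?thesis using \<delta> unfolding r by blast
  qed
  define c where "c = 4 / (r * cutoff_mass TYPE('b))"
  have \<kappa>: "continuous_on UNIV (\<lambda>x. (x \<bullet> u) * cutoff x)" by (intro continuous_intros)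
  define L where "L q = integral base_box (\<lambda>x. ((x \<bullet> u) * cutoff x) *\<^sub>R f' (q + r *\<^sub>R x))" for q
  note LB = leibniz_box [OF f less_imp_le [OF r(1)] sub _ _ _ \<kappa>, of P, folded L_def]
  have P: "convex P" "open P" "p \<in> P" "P \<subseteq> U" using \<delta> by (auto simp: P_def)
  have U: "q + r *\<^sub>R x \<in> U" if "q \<in> P" "x \<in> base_box" for q x
    by (rule base_ball_box [OF _ sub]) (use that r in auto)
  have "monogenic_deriv P (smoothed_deriv f r u) (\<lambda>q. c *\<^sub>R L q)"
    unfolding monogenic_deriv_def
  proof (intro conjI ballI)
    show "open P" by fact
    show "continuous_on P (\<lambda>q. c *\<^sub>R L q)"
      by (intro continuous_intros LB(3) P) (use P in auto)
  next
    fix q assume q: "q \<in> P"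
    show "(smoothed_deriv f r u has_derivative (c *\<^sub>R L q)) (at q)"
      using has_derivative_scaleR_right [OF LB(1) [OF _ P(1,2) q], of c]
      by (simp add: smoothed_deriv_def [abs_def] c_def scaleR_blinfun.rep_eq)
    have int: "(\<lambda>x. ((x \<bullet> u) * cutoff x) *\<^sub>R f' (q + r *\<^sub>R x) w) integrable_on base_box" for w
      by (rule integrable_box [OF _ sub [OF q] D(3) \<kappa>]) (use r in auto)
    have "(\<Sum>i<N. e i * L q (b i)) = (\<Sum>i<N. integral base_box (\<lambda>x. e i * (((x \<bullet> u) * cutoff x) *\<^sub>R f' (q + r *\<^sub>R x) (b i))))"
      by (intro sum.cong refl, subst LB(2) [OF _ P(1,2) q], assumption)
         (rule integral_linear [OF int bounded_linear_left_mult, unfolded o_def, symmetric])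
    also have "\<dots> = integral base_box (\<lambda>x. \<Sum>i<N. e i * (((x \<bullet> u) * cutoff x) *\<^sub>R f' (q + r *\<^sub>R x) (b i)))"
      by (rule integral_sum [symmetric])
         (simp, rule integrable_linear [OF int bounded_linear_left_mult, unfolded o_def])
    also have "\<dots> = integral base_box (\<lambda>x::'b. 0)"
    proof (rule integral_cong)
      fix x :: 'b assume "x \<in> base_box"
      then show "(\<Sum>i<N. e i * (((x \<bullet> u) * cutoff x) *\<^sub>R f' (q + r *\<^sub>R x) (b i))) = 0"
        using D(4) [OF U [OF q]] by (simp flip: scaleR_right.sum)
    qed
    finally show "(\<Sum>i<N. e i * (c *\<^sub>R L q) (b i)) = 0"
      by (simp add: scaleR_blinfun.rep_eq flip: scaleR_right.sum)
    fix w assume w: "w \<in> Basis - b ` {..<N}"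
    have "L q w = integral base_box (\<lambda>x. ((x \<bullet> u) * cutoff x) *\<^sub>R f' (q + r *\<^sub>R x) w)"
      by (rule LB(2) [OF _ P(1,2) q])
    also have "\<dots> = integral base_box (\<lambda>x::'b. 0)"
      by (rule integral_cong) (use D(5) [OF U [OF q] w] in auto)
    finally show "(c *\<^sub>R L q) w = 0" by (simp add: scaleR_blinfun.rep_eq)
  qed
  then have "monogenic_on P (smoothed_deriv f r u)" by (auto simp: monogenic_on_def)
  then have "monogenic_on P (\<lambda>x. f' x u)"
    by (rule monogenic_on_transform) (use deriv_eq_smoothed [OF f r(1) sub u] in auto)
  then show "\<exists>P. p \<in> P \<and> P \<subseteq> U \<and> monogenic_on P (\<lambda>x. f' x u)" using P by blast
qed

text \<open>The constant 4/(s mass) of \<open>smoothed_deriv\<close> at s = r /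
  \<open>base_radius\<close>, with 1/r split off, times the volume of the box, on which |(x.u)
  cutoff(x)| is at most 1.\<close>

definition grad_const :: real where
  "grad_const = 4 * base_radius TYPE('b) * measure lborel (base_box :: 'b set) / cutoff_mass TYPE('b)"

lemma grad_const_nonneg: "0 \<le> grad_const"
  using cutoff_mass_pos [where 'b='b] base_radius_gt_1 [where 'b='b] by (simp add: grad_const_def)

lemma gradient_bound:
  assumes f: "monogenic_deriv U f f'" and u: "u \<in> Basis"
    and r: "0 < r" "cball p r \<subseteq> U" and S: "\<And>x. x \<in> cball p r \<Longrightarrow> norm (f x) \<le> S"
  shows "norm (f' p u) \<le> grad_const / r * S"
proof -
  note D = monogenic_derivD [OF f]
  let ?R = "base_radius TYPE('b)"
  define s where "s = r / ?R"
  have s: "s > 0" "s * ?R = r" using r base_radius_gt_1 [where 'b='b] by (auto simp: s_def)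
  have sub: "cball p (s * ?R) \<subseteq> U" using s r by simp
  have m: "cutoff_mass TYPE('b) > 0" by (rule cutoff_mass_pos)
  have S0: "0 \<le> S" using S [of p] r by (auto intro: order_trans [OF norm_ge_zero])
  have U: "p + s *\<^sub>R x \<in> cball p r" if "x \<in> base_box" for x
    by (rule base_ball_box [of s]) (use that s in auto)
  have int: "(\<lambda>x. ((x \<bullet> u) * cutoff x) *\<^sub>R f (p + s *\<^sub>R x)) integrable_on cbox (- 2 *\<^sub>R One) (2 *\<^sub>R One)"
    by (intro integrable_continuous continuous_intros continuous_on_compose2 [OF D(6)])
       (use U r in \<open>auto simp: base_box_def\<close>)
  have "norm (integral base_box (\<lambda>x. ((x \<bullet> u) * cutoff x) *\<^sub>R f (p + s *\<^sub>R x))) \<le> S * measure lborel (base_box :: 'b set)"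
    unfolding base_box_def
  proof (rule integrable_bound [OF S0 int])
    fix x :: 'b assume x: "x \<in> cbox (- 2 *\<^sub>R One) (2 *\<^sub>R One)"
    have "\<bar>(x \<bullet> u) * cutoff x\<bar> \<le> 1"
    proof (cases "norm x \<ge> 1")
      case False
      then have "\<bar>x \<bullet> u\<bar> * \<bar>cutoff x\<bar> \<le> 1 * 1"
        using Basis_le_norm [OF u, of x] cutoff_nonneg [of x] cutoff_le_one [of x] by (intro mult_mono) auto
      then show ?thesis by (simp add: abs_mult)
    qed (simp add: cutoff_eq_0)
    then have "\<bar>(x \<bullet> u) * cutoff x\<bar> * norm (f (p + s *\<^sub>R x)) \<le> 1 * S"
      using S [OF U] x by (intro mult_mono) (auto simp: base_box_def)
    then show "norm (((x \<bullet> u) * cutoff x) *\<^sub>R f (p + s *\<^sub>R x)) \<le> S" by simp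
  qed
  then have "norm (smoothed_deriv f s u p) \<le> 4 / (s * cutoff_mass TYPE('b)) * (S * measure lborel (base_box :: 'b set))"
    using s m by (simp add: smoothed_deriv_def divide_right_mono mult_left_mono)
  also have "\<dots> = grad_const / r * S"
    using r base_radius_gt_1 [where 'b='b] by (simp add: grad_const_def s_def mult_ac)
  finally show ?thesis using deriv_eq_smoothed [OF f s(1) sub u] by simp
qed

section \<open>Iterated derivatives and Taylor expansion\<close>

definition pd :: "nat \<Rightarrow> ('b \<Rightarrow> 'a) \<Rightarrow> 'b \<Rightarrow> 'a" where
  "pd i f x = frechet_derivative f (at x) (b i)"

text \<open>Words rather than multi-indices: the head of the list is the outermost derivative, and
  mixed derivatives never have to be reordered.\<close>

primrec pds :: "nat list \<Rightarrow> ('b \<Rightarrow> 'a) \<Rightarrow> 'b \<Rightarrow> 'a" where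
  "pds [] f = f"
| "pds (i # w) f = pd i (pds w f)"

lemma pd_eq: "monogenic_deriv U f f' \<Longrightarrow> x \<in> U \<Longrightarrow> pd i f x = f' x (b i)"
  by (simp add: pd_def frechet_derivative_at [OF monogenic_derivD(2), symmetric])

lemma monogenic_on_pd: "monogenic_on U f \<Longrightarrow> i < N \<Longrightarrow> monogenic_on U (pd i f)"
proof -
  assume "monogenic_on U f" "i < N"
  then obtain F where F: "monogenic_deriv U f F" by (auto simp: monogenic_on_def)
  show ?thesis
    by (rule monogenic_on_transform [OF monogenic_on_deriv [OF F mem_Basis [OF \<open>i < N\<close>]]])
       (simp add: pd_eq [OF F])
qed

lemma monogenic_on_pds: "monogenic_on U f \<Longrightarrow> set w \<subseteq> {..<N} \<Longrightarrow> monogenic_on U (pds w f)"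
  by (induction w) (auto intro: monogenic_on_pd)

text \<open>Each letter uses up one layer of width \<delta>: the outer derivative at p is estimated
  through the values of the inner one on \<open>cball p \<delta>\<close>, to which the induction
  applies with the remaining layers.\<close>

lemma pds_bound:
  fixes \<delta> :: real
  assumes "monogenic_on U f" "\<delta> > 0" "set w \<subseteq> {..<N}" "cball p (length w * \<delta>) \<subseteq> U"
    "\<And>x. x \<in> cball p (length w * \<delta>) \<Longrightarrow> norm (f x) \<le> S"
  shows "norm (pds w f p) \<le> (grad_const / \<delta>) ^ length w * S"
  using assms(3-)
proof (induction w arbitrary: p)
  case Nil
  then show ?case by simp
next
  case (Cons i w)
  obtain F where F: "monogenic_deriv U (pds w f) F"
    using monogenic_on_pds [OF assms(1), of w] Cons.prems(1) by (auto simp: monogenic_on_def)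
  have sub: "cball x (length w * \<delta>) \<subseteq> cball p (length (i # w) * \<delta>)" if "x \<in> cball p \<delta>" for x
    using that by (simp add: cball_subset_cball_iff dist_commute algebra_simps)
  have "norm (F p (b i)) \<le> grad_const / \<delta> * ((grad_const / \<delta>) ^ length w * S)"
  proof (rule gradient_bound [OF F _ assms(2)])
    have "\<delta> \<le> length (i # w) * \<delta>" using assms(2) by (simp add: algebra_simps)
    then have "cball p \<delta> \<subseteq> cball p (length (i # w) * \<delta>)" by (rule subset_cball)
    then show "cball p \<delta> \<subseteq> U" using Cons.prems by blast
    fix x assume x: "x \<in> cball p \<delta>"
    show "norm (pds w f x) \<le> (grad_const / \<delta>) ^ length w * S"
      using Cons.prems sub [OF x] by (intro Cons.IH) auto
  qed (use Cons.prems in auto)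
  moreover have "pds (i # w) f p = F p (b i)"
    using pd_eq [OF F] Cons.prems assms(2) by (auto simp: subset_iff)
  ultimately show ?case by (simp add: mult.assoc)
qed

definition words :: "nat \<Rightarrow> nat list set" where
  "words m = {w. set w \<subseteq> {..<N} \<and> length w = m}"

lemma finite_words [simp]: "finite (words m)"
  unfolding words_def by (rule finite_lists_length_eq) simp

lemma card_words: "card (words m) = N ^ m"
  unfolding words_def by (simp add: card_lists_length_eq)

lemma sum_words_Suc: "(\<Sum>w\<in>words (Suc m). g w) = (\<Sum>w\<in>words m. \<Sum>i<N. g (i # w))"
proof -
  have eq: "words (Suc m) = (\<lambda>(w, i). i # w) ` (words m \<times> {..<N})"
    by (auto simp: words_def length_Suc_conv image_iff)
  have "inj_on (\<lambda>(w, i). i # w) (words m \<times> {..<N})" by (auto simp: inj_on_def)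
  then show ?thesis
    unfolding eq by (subst sum.reindex) (auto simp: sum.cartesian_product split_def)
qed

lemma blinfun_directional:
  assumes "monogenic_deriv U f f'" "x \<in> U"
  shows "f' x h = (\<Sum>i<N. (h \<bullet> b i) *\<^sub>R f' x (b i))"
proof -
  have "f' x h = f' x (\<Sum>u\<in>Basis. (h \<bullet> u) *\<^sub>R u)" by (simp add: euclidean_representation)
  also have "\<dots> = (\<Sum>u\<in>Basis. (h \<bullet> u) *\<^sub>R f' x u)" by (simp add: blinfun.sum_right blinfun.scaleR_right)
  also have "\<dots> = (\<Sum>u\<in>b ` {..<N}. (h \<bullet> u) *\<^sub>R f' x u)"
    using monogenic_derivD(5) [OF assms(1,2)] by (intro sum.mono_neutral_right) (use basis in auto)
  finally show ?thesis by (simp add: sum.reindex [OF inj])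
qed

text \<open>Differentiating along the segment puts one more letter in front of every word, with the
  matching coordinate of h as factor; the word sums of length m are thus the m-th derivatives of a
  scalar function of s.\<close>

lemma taylor_deriv:
  assumes f: "monogenic_on U f" and x: "p + s *\<^sub>R h \<in> U"
  shows "((\<lambda>s. \<Sum>w\<in>words m. (\<Prod>i\<leftarrow>w. h \<bullet> b i) * (pds w f (p + s *\<^sub>R h) \<bullet> c)) has_real_derivative
      (\<Sum>w\<in>words (Suc m). (\<Prod>i\<leftarrow>w. h \<bullet> b i) * (pds w f (p + s *\<^sub>R h) \<bullet> c))) (at s)"
  unfolding sum_words_Suc
proof (rule DERIV_sum)
  fix w assume "w \<in> words m"
  then have w: "set w \<subseteq> {..<N}" by (auto simp: words_def)
  obtain F where F: "monogenic_deriv U (pds w f) F"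
    using monogenic_on_pds [OF f w] by (auto simp: monogenic_on_def)
  have "((\<lambda>s. pds w f (p + s *\<^sub>R h)) has_derivative (\<lambda>k. F (p + s *\<^sub>R h) (k *\<^sub>R h))) (at s)"
    by (rule has_derivative_compose [where f="\<lambda>s. p + s *\<^sub>R h"])
       (auto intro!: derivative_eq_intros monogenic_derivD(2) [OF F] x)
  from has_derivative_inner_left [OF this, of c]
  have "((\<lambda>s. pds w f (p + s *\<^sub>R h) \<bullet> c) has_real_derivative F (p + s *\<^sub>R h) h \<bullet> c) (at s)"
    by (simp add: has_field_derivative_def blinfun.scaleR_right mult.commute[of _ "_ \<bullet> c"])
  then have "((\<lambda>s. (\<Prod>i\<leftarrow>w. h \<bullet> b i) * (pds w f (p + s *\<^sub>R h) \<bullet> c)) has_real_derivative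
      (\<Prod>i\<leftarrow>w. h \<bullet> b i) * (F (p + s *\<^sub>R h) h \<bullet> c)) (at s)"
    by (rule DERIV_cmult)
  moreover have "(\<Prod>i\<leftarrow>w. h \<bullet> b i) * (F (p + s *\<^sub>R h) h \<bullet> c) =
     (\<Sum>i<N. (\<Prod>j\<leftarrow>i # w. h \<bullet> b j) * (pds (i # w) f (p + s *\<^sub>R h) \<bullet> c))"
    unfolding blinfun_directional [OF F x, of h]
    by (simp add: inner_sum_left sum_distrib_left pd_eq [OF F x] mult_ac)
  ultimately show "((\<lambda>s. (\<Prod>i\<leftarrow>w. h \<bullet> b i) * (pds w f (p + s *\<^sub>R h) \<bullet> c)) has_real_derivative
     (\<Sum>i<N. (\<Prod>j\<leftarrow>i # w. h \<bullet> b j) * (pds (i # w) f (p + s *\<^sub>R h) \<bullet> c))) (at s)" by simp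
qed

text \<open>With m layers of width \<delta>/m the bound for a word of length m becomes S K^m m!.
  There are N^m words and each monomial is at most \<rho>^m, so N \<rho> K \<le> 1/2 makes the
  series geometric. Pairing with a basis vector c reduces the claim to the scalar Maclaurin
  formula.\<close>

lemma taylor:
  assumes f: "monogenic_on U f" and p: "p \<in> U"
  obtains \<rho> S K where "\<rho> > 0" "S \<ge> 0" "K \<ge> 0" "real N * \<rho> * K \<le> 1 / 2" "cball p \<rho> \<subseteq> U"
    "\<And>w. set w \<subseteq> {..<N} \<Longrightarrow> norm (pds w f p) \<le> S * K ^ length w * fact (length w)"
    "\<And>h c. norm h \<le> \<rho> \<Longrightarrow> c \<in> Basis \<Longrightarrow>
       (\<lambda>m. (\<Sum>w\<in>words m. (\<Prod>i\<leftarrow>w. h \<bullet> b i) * (pds w f p \<bullet> c)) / fact m) sums (f (p + h) \<bullet> c)"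
proof -
  have "open U" and cf: "continuous_on U f"
    using f monogenic_derivD by (auto simp: monogenic_on_def)
  then obtain d where d: "d > 0" "cball p d \<subseteq> U"
    using p open_contains_cball [of U] by blast
  define \<delta> where "\<delta> = d / 2"
  have \<delta>: "\<delta> > 0" "cball p (2 * \<delta>) \<subseteq> U" using d by (auto simp: \<delta>_def)
  have "cball p \<delta> \<subseteq> cball p (2 * \<delta>)" using \<delta> by (intro subset_cball) simp
  then have \<delta>U: "cball p \<delta> \<subseteq> U" using \<delta>(2) by (rule subset_trans)
  have "bounded (f ` cball p (2 * \<delta>))"
    by (intro compact_imp_bounded compact_continuous_image continuous_on_subset [OF cf] \<delta>) simp
  then obtain S where S: "\<And>x. x \<in> cball p (2 * \<delta>) \<Longrightarrow> norm (f x) \<le> S" "S > 0"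
    by (metis bounded_pos imageI)
  define K where "K = grad_const * exp 1 / \<delta>"
  have K0: "K \<ge> 0" using grad_const_nonneg \<delta> by (simp add: K_def)
  have bd: "norm (pds w f x) \<le> S * K ^ length w * fact (length w)"
    if w: "set w \<subseteq> {..<N}" and x: "x \<in> cball p \<delta>" for w x
  proof (cases "w = []")
    case True
    then show ?thesis using S(1) [of x] x \<delta>(1) by auto
  next
    case False
    define m where "m = length w"
    have m: "m > 0" using False by (simp add: m_def)
    have sub: "cball x (m * (\<delta> / m)) \<subseteq> cball p (2 * \<delta>)"
      using x m \<delta>(1) by (simp add: cball_subset_cball_iff dist_commute)
    have "norm (pds w f x) \<le> (grad_const / (\<delta> / m)) ^ m * S"
      unfolding m_def by (rule pds_bound [OF f _ w])
        (use sub \<delta> m S in \<open>auto simp flip: m_def\<close>)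
    also have "\<dots> = S * (grad_const / \<delta>) ^ m * real m ^ m"
      by (simp add: power_divide power_mult_distrib)
    also have "\<dots> \<le> S * (grad_const / \<delta>) ^ m * (exp (real m) * fact m)"
      using S(2) grad_const_nonneg \<delta>(1) by (intro mult_left_mono power_self_le_exp_fact) auto
    also have "\<dots> = S * K ^ m * fact m"
      by (simp add: K_def power_divide power_mult_distrib exp_of_nat_mult [of m 1, simplified])
    finally show ?thesis by (simp add: m_def)
  qed
  \<comment> \<open>The first bound keeps the segment in the ball on which the derivatives are
    estimated. The second yields N \<rho> K \<le> 1/2; its added ones prevent a zero denominator
    when N or K is 0.\<close>
  define \<rho> where "\<rho> = min \<delta> (1 / (2 * (real N + 1) * (K + 1)))"
  have \<rho>: "\<rho> > 0" "\<rho> \<le> \<delta>" using \<delta> K0 by (auto simp: \<rho>_def add_nonneg_pos)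
  have "real N * \<rho> * K \<le> (real N + 1) * (1 / (2 * (real N + 1) * (K + 1))) * (K + 1)"
    using K0 \<rho>(1) by (intro mult_mono) (auto simp: \<rho>_def)
  also have "\<dots> = 1 / 2" using K0 by (simp add: divide_simps)
  finally have NK: "real N * \<rho> * K \<le> 1 / 2" .
  show thesis
  proof (rule that [OF \<rho>(1) less_imp_le [OF S(2)] K0 NK])
    show "cball p \<rho> \<subseteq> U" using subset_cball [OF \<rho>(2)] \<delta>U by (rule subset_trans)
    show "norm (pds w f p) \<le> S * K ^ length w * fact (length w)" if "set w \<subseteq> {..<N}" for w
      by (rule bd [OF that]) (use \<delta> in auto)
    fix h :: 'b and c :: 'a assume h: "norm h \<le> \<rho>" and c: "c \<in> Basis"
    define D where "D m s = (\<Sum>w\<in>words m. (\<Prod>i\<leftarrow>w. h \<bullet> b i) * (pds w f (p + s *\<^sub>R h) \<bullet> c))" for m s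
    have seg: "p + s *\<^sub>R h \<in> cball p \<delta>" if "0 \<le> s" "s \<le> 1" for s
    proof -
      have "\<bar>s\<bar> * norm h \<le> 1 * \<rho>" by (rule mult_mono) (use that h \<rho> in auto)
      then show ?thesis using \<rho> by (simp add: dist_norm)
    qed
    have segU: "p + s *\<^sub>R h \<in> U" if "0 \<le> s" "s \<le> 1" for s
      using seg [OF that] \<delta>U by blast
    have Dbd: "\<bar>D m s / fact m\<bar> \<le> S * (1 / 2) ^ m" if "0 \<le> s" "s \<le> 1" for m s
    proof -
      have "\<bar>D m s\<bar> \<le> (\<Sum>w\<in>words m. \<bar>(\<Prod>i\<leftarrow>w. h \<bullet> b i) * (pds w f (p + s *\<^sub>R h) \<bullet> c)\<bar>)"
        unfolding D_def by (rule sum_abs)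
      also have "\<dots> \<le> (\<Sum>w\<in>words m. \<rho> ^ m * (S * K ^ m * fact m))"
      proof (rule sum_mono)
        fix w assume "w \<in> words m"
        then have w: "set w \<subseteq> {..<N}" "length w = m" by (auto simp: words_def)
        have "\<bar>\<Prod>i\<leftarrow>w. h \<bullet> b i\<bar> \<le> \<rho> ^ length w" using w(1)
        proof (induction w)
          case (Cons i w)
          have "\<bar>h \<bullet> b i\<bar> \<le> \<rho>" using Basis_le_norm [of "b i" h] Cons.prems h by auto
          then show ?case using Cons \<rho>(1) by (auto simp: abs_mult intro!: mult_mono)
        qed simp
        moreover have "\<bar>pds w f (p + s *\<^sub>R h) \<bullet> c\<bar> \<le> S * K ^ m * fact m"
          using order_trans [OF Basis_le_norm [OF c] bd [OF w(1) seg [OF that]]] by (simp add: w(2))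
        ultimately show "\<bar>(\<Prod>i\<leftarrow>w. h \<bullet> b i) * (pds w f (p + s *\<^sub>R h) \<bullet> c)\<bar> \<le> \<rho> ^ m * (S * K ^ m * fact m)"
          unfolding abs_mult w(2) using \<rho>(1) by (intro mult_mono) auto
      qed
      also have "\<dots> = S * (real N * \<rho> * K) ^ m * fact m"
        by (simp add: card_words power_mult_distrib)
      also have "\<dots> \<le> S * (1 / 2) ^ m * fact m"
        using NK S(2) K0 \<rho>(1) by (intro mult_right_mono mult_left_mono power_mono) auto
      finally show ?thesis by (simp add: divide_le_eq)
    qed
    have D0: "D 0 s = f (p + s *\<^sub>R h) \<bullet> c" for s
    proof -
      have "words 0 = {[]}" by (auto simp: words_def)
      then show ?thesis by (simp add: D_def)
    qed
    \<comment> \<open>The Lagrange remainder sits at an unknown point of the segment, and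
      \<open>Dbd\<close> is uniform there. \<open>Maclaurin\<close> asks for n > 0, so n = 0 is read
      off from \<open>Dbd\<close> directly.\<close>
    have rem: "\<bar>f (p + h) \<bullet> c - (\<Sum>m<n. D m 0 / fact m)\<bar> \<le> S * (1 / 2) ^ n" for n
    proof (cases "n = 0")
      case True
      then show ?thesis using Dbd [of 1 0] D0 [of 1] by simp
    next
      case False
      have "\<exists>t>0. t < 1 \<and> D 0 1 = (\<Sum>m<n. D m 0 / fact m * 1 ^ m) + D n t / fact n * 1 ^ n"
        by (rule Maclaurin) (use False segU in \<open>auto simp: D_def intro!: taylor_deriv [OF f]\<close>)
      then obtain t where t: "t > 0" "t < 1" "D 0 1 = (\<Sum>m<n. D m 0 / fact m) + D n t / fact n" by auto
      then show ?thesis using Dbd [of t n] D0 [of 1] by simp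
    qed
    have "(\<lambda>n. f (p + h) \<bullet> c - (\<Sum>m<n. D m 0 / fact m)) \<longlonglongrightarrow> 0"
    proof (rule Lim_null_comparison)
      show "\<forall>\<^sub>F n in sequentially. norm (f (p + h) \<bullet> c - (\<Sum>m<n. D m 0 / fact m)) \<le> S * (1 / 2) ^ n"
        using rem by simp
      show "(\<lambda>n. S * (1 / 2) ^ n) \<longlonglongrightarrow> 0"
        by (intro tendsto_mult_right_zero LIMSEQ_power_zero) simp
    qed
    from tendsto_diff [OF tendsto_const [of "f (p + h) \<bullet> c"] this]
    have "(\<lambda>m. D m 0 / fact m) sums (f (p + h) \<bullet> c)" by (simp add: sums_def)
    then show "(\<lambda>m. (\<Sum>w\<in>words m. (\<Prod>i\<leftarrow>w. h \<bullet> b i) * (pds w f p \<bullet> c)) / fact m) sums (f (p + h) \<bullet> c)"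
      by (simp add: D_def)
  qed
qed

text \<open>Derivatives along the hyperplane vanish, so the equation leaves only e_i0 times the
  normal derivative; e_i0 cancels because \<open>cliff\<close> with equal indices makes eb_i0 a left
  inverse.\<close>

lemma pd_vanishes_on_hyperplane:
  assumes f: "monogenic_on U f" and i0: "i0 < N" and i: "i < N"
    and 0: "\<And>x. x \<in> U \<Longrightarrow> x \<bullet> b i0 = 0 \<Longrightarrow> f x = 0" and x: "x \<in> U" "x \<bullet> b i0 = 0"
  shows "pd i f x = 0"
proof -
  obtain F where F: "monogenic_deriv U f F" using f by (auto simp: monogenic_on_def)
  note D = monogenic_derivD [OF F]
  have tang: "F x (b j) = 0" if j: "j < N" "j \<noteq> i0" for j
  proof -
    have ort: "b j \<bullet> b i0 = 0" using inj j i0 by (auto simp: inner_Basis inj_on_def)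
    have "((\<lambda>s. f (x + s *\<^sub>R b j)) has_derivative (\<lambda>k. F (x + 0 *\<^sub>R b j) (k *\<^sub>R b j))) (at 0)"
      by (rule has_derivative_compose [where f="\<lambda>s. x + s *\<^sub>R b j"])
         (auto intro!: derivative_eq_intros D(2) x)
    moreover have "((\<lambda>s. f (x + s *\<^sub>R b j)) has_derivative (\<lambda>k. 0)) (at 0)"
    proof (rule has_derivative_transform_within_open [where f = "\<lambda>_. 0"])
      show "open ((\<lambda>s. x + s *\<^sub>R b j) -` U)"
        by (rule open_vimage [OF D(1)]) (intro continuous_intros)
    qed (use x 0 ort in \<open>auto simp: inner_add_left\<close>)
    ultimately have "(\<lambda>k. F (x + 0 *\<^sub>R b j) (k *\<^sub>R b j)) = (\<lambda>k. 0)" by (rule has_derivative_unique)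
    from fun_cong [OF this, of 1] show ?thesis by simp
  qed
  have "e i0 * F x (b i0) = 0"
    using D(4) [OF x(1)] i0 tang by (simp add: sum.remove [of "{..<N}" i0])
  then have "eb i0 * e i0 * F x (b i0) = 0" by (simp add: mult.assoc)
  moreover have "eb i0 * e i0 = 1"
  proof -
    have "2 *\<^sub>R (eb i0 * e i0) = 2 *\<^sub>R (1::'a)" using cliff [OF i0 i0] by (simp add: scaleR_2)
    then show ?thesis by simp
  qed
  ultimately have "F x (b i0) = 0" by simp
  then show ?thesis using tang i pd_eq [OF F x(1)] by (cases "i = i0") auto
qed

text \<open>The points where all iterated derivatives vanish and those where some does not form two
  open sets, the former open by Taylor expansion. On the hyperplane all derivatives vanish by
  induction on the word, each being monogenic and zero there, so p decides which of the two sets is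
  empty.\<close>

lemma identity_hyperplane:
  assumes f: "monogenic_on U f" and i0: "i0 < N" and U: "connected U"
    and 0: "\<And>x. x \<in> U \<Longrightarrow> x \<bullet> b i0 = 0 \<Longrightarrow> f x = 0" and p: "p \<in> U" "p \<bullet> b i0 = 0" and x: "x \<in> U"
  shows "f x = 0"
proof -
  define A where "A = {x\<in>U. \<exists>w. set w \<subseteq> {..<N} \<and> pds w f x \<noteq> 0}"
  define Z where "Z = {x\<in>U. \<forall>w. set w \<subseteq> {..<N} \<longrightarrow> pds w f x = 0}"
  have opU: "open U" and contw: "continuous_on U (pds w f)" if "set w \<subseteq> {..<N}" for w
    using monogenic_on_pds [OF f that] monogenic_derivD(1,6) by (auto simp: monogenic_on_def)
  have "A = (\<Union>w\<in>{w. set w \<subseteq> {..<N}}. {x\<in>U. pds w f x \<in> - {0}})" by (auto simp: A_def)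
  also have "open \<dots>"
  proof (intro open_UN ballI)
    fix w assume "w \<in> {w. set w \<subseteq> {..<N}}"
    then have w: "set w \<subseteq> {..<N}" by simp
    have "open (U \<inter> pds w f -` (- {0}))"
      by (rule continuous_open_preimage [OF contw [OF w] opU [OF w]]) auto
    then show "open {x\<in>U. pds w f x \<in> - {0}}" by (simp add: vimage_def Int_def)
  qed
  finally have "open A" .
  have "open Z"
  proof (subst open_subopen, rule ballI)
    fix q assume q: "q \<in> Z"
    then have "q \<in> U" by (simp add: Z_def)
    obtain \<rho> S K where \<rho>: "\<rho> > 0" "S \<ge> 0" "K \<ge> 0" "real N * \<rho> * K \<le> 1 / 2" "cball q \<rho> \<subseteq> U"
      "\<And>w. set w \<subseteq> {..<N} \<Longrightarrow> norm (pds w f q) \<le> S * K ^ length w * fact (length w)"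
      and t: "\<And>h c. norm h \<le> \<rho> \<Longrightarrow> c \<in> Basis \<Longrightarrow>
       (\<lambda>m. (\<Sum>w\<in>words m. (\<Prod>i\<leftarrow>w. h \<bullet> b i) * (pds w f q \<bullet> c)) / fact m) sums (f (q + h) \<bullet> c)"
      by (rule taylor [OF f \<open>q \<in> U\<close>], rule that, assumption+)
    have f0: "f y = 0" if "y \<in> ball q \<rho>" for y
    proof (rule euclidean_eqI)
      fix c :: 'a assume c: "c \<in> Basis"
      have "(\<lambda>m. (\<Sum>w\<in>words m. (\<Prod>i\<leftarrow>w. (y - q) \<bullet> b i) * (pds w f q \<bullet> c)) / fact m) sums (f (q + (y - q)) \<bullet> c)"
        by (rule t) (use that c in \<open>auto simp: dist_norm norm_minus_commute\<close>)
      moreover have "(\<lambda>m. (\<Sum>w\<in>words m. (\<Prod>i\<leftarrow>w. (y - q) \<bullet> b i) * (pds w f q \<bullet> c)) / fact m) = (\<lambda>m. 0)"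
        using q by (intro ext) (simp add: Z_def words_def)
      ultimately show "f y \<bullet> c = 0 \<bullet> c" by (simp add: sums_iff)
    qed
    have "pds w f y = 0" if "y \<in> ball q \<rho>" "set w \<subseteq> {..<N}" for w y using that
    proof (induction w arbitrary: y)
      case Nil
      then show ?case using f0 by simp
    next
      case (Cons i w)
      have "((\<lambda>y. 0) has_derivative (\<lambda>_. 0)) (at y)" by simp
      then have "(pds w f has_derivative (\<lambda>_. 0)) (at y)"
        by (rule has_derivative_transform_within_open [OF _ open_ball Cons.prems(1)]) (use Cons in auto)
      then show ?case by (simp add: pd_def frechet_derivative_at [symmetric])
    qed
    then have "ball q \<rho> \<subseteq> Z" using \<rho>(5) by (auto simp: Z_def)
    then show "\<exists>T. open T \<and> q \<in> T \<and> T \<subseteq> Z" using \<rho>(1) by (intro exI [of _ "ball q \<rho>"]) auto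
  qed
  have "pds w f y = 0" if "set w \<subseteq> {..<N}" "y \<in> U" "y \<bullet> b i0 = 0" for w y using that
  proof (induction w arbitrary: y)
    case (Cons i w)
    then show ?case using pd_vanishes_on_hyperplane [OF monogenic_on_pds [OF f] i0, of w i y] by auto
  qed (use 0 in auto)
  then have "p \<in> Z" using p by (auto simp: Z_def)
  moreover have "A \<inter> Z \<inter> U = {}" "U \<subseteq> A \<union> Z" by (auto simp: A_def Z_def)
  ultimately have "A \<inter> U = {}" using connectedD [OF U \<open>open A\<close> \<open>open Z\<close>] p by blast
  then have "x \<in> Z" using x \<open>U \<subseteq> A \<union> Z\<close> by blast
  then have "set [] \<subseteq> {..<N} \<longrightarrow> pds [] f x = 0" unfolding Z_def by blast
  then show ?thesis by simp
qed

end

section \<open>Separately holomorphic extensions\<close>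

definition polydisc :: "nat set \<Rightarrow> real \<Rightarrow> (nat \<Rightarrow> complex) set" where
  "polydisc X \<rho> = {z. \<forall>i\<in>X. norm (z i) < \<rho>}"

text \<open>Variables outside \<open>X\<close> are unrestricted parameters.\<close>

definition sep_holomorphic :: "nat set \<Rightarrow> real \<Rightarrow> ((nat \<Rightarrow> complex) \<Rightarrow> complex) \<Rightarrow> bool" where
  "sep_holomorphic X \<rho> H \<longleftrightarrow> (\<forall>z\<in>polydisc X \<rho>. \<forall>i\<in>X. (\<lambda>w. H (z(i := w))) holomorphic_on ball 0 \<rho>)"

definition diff_quot :: "(complex \<Rightarrow> complex) \<Rightarrow> complex \<Rightarrow> complex" where
  "diff_quot \<phi> w = (if w = 0 then deriv \<phi> 0 else (\<phi> w - \<phi> 0) / w)"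

lemma diff_quot_holomorphic:
  "\<phi> holomorphic_on ball 0 \<rho> \<Longrightarrow> diff_quot \<phi> holomorphic_on ball 0 \<rho>"
  using pole_lemma_open [of \<phi> "ball 0 \<rho>" 0] by (simp add: diff_quot_def [abs_def] cong: if_cong)

text \<open>Schwarz lemma for (\<phi>(\<rho> \<xi>) - \<phi>(0)) / (2 M) on the unit disc, its
  derivative part covering w = 0. The disc does not shrink, so quotients can be iterated.\<close>

lemma diff_quot_bound:
  assumes hol: "\<phi> holomorphic_on ball 0 \<rho>" and bd: "\<And>w. norm w < \<rho> \<Longrightarrow> norm (\<phi> w) < M"
    and w: "norm w < \<rho>"
  shows "norm (diff_quot \<phi> w) \<le> 2 * M / \<rho>"
proof -
  have \<rho>: "\<rho> > 0" using w norm_ge_zero [of w] by linarith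
  have M: "M > 0" using bd [of 0] \<rho> by (auto intro: le_less_trans [OF norm_ge_zero])
  define \<psi> where "\<psi> \<xi> = (\<phi> (of_real \<rho> * \<xi>) - \<phi> 0) / of_real (2 * M)" for \<xi>
  have in_ball: "norm (of_real \<rho> * \<xi>) < \<rho>" if "norm \<xi> < 1" for \<xi> :: complex
    using that \<rho> by (simp add: norm_mult)
  have hol\<psi>: "\<psi> holomorphic_on ball 0 1"
    unfolding \<psi>_def
    by (intro holomorphic_intros holomorphic_on_compose_gen [OF _ hol, unfolded o_def]) (use in_ball M in auto)
  have \<psi>0: "\<psi> 0 = 0" by (simp add: \<psi>_def)
  have \<psi>1: "norm (\<psi> \<xi>) < 1" if "norm \<xi> < 1" for \<xi>
  proof -
    have "norm (\<phi> (of_real \<rho> * \<xi>) - \<phi> 0) < M + M"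
      using norm_triangle_ineq4 [of "\<phi> (of_real \<rho> * \<xi>)" "\<phi> 0"] bd [OF in_ball [OF that]] bd [of 0] \<rho> by simp
    then show ?thesis using M by (simp add: \<psi>_def norm_divide)
  qed
  show ?thesis
  proof (cases "w = 0")
    case False
    have "norm (\<psi> (w / of_real \<rho>)) \<le> norm (w / of_real \<rho>)"
      by (rule Schwarz_Lemma(1) [OF hol\<psi> \<psi>0 \<psi>1]) (use w \<rho> in \<open>auto simp: norm_divide\<close>)
    then have "norm (\<phi> w - \<phi> 0) / (2 * M) \<le> norm w / \<rho>"
      using M \<rho> by (simp add: \<psi>_def norm_divide)
    then show ?thesis using False M \<rho> by (simp add: diff_quot_def norm_divide field_simps)
  next
    case True
    have "\<phi> field_differentiable at 0" using hol \<rho>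
      by (auto intro!: holomorphic_on_imp_differentiable_at [of _ "ball 0 \<rho>"])
    then have "(\<phi> has_field_derivative deriv \<phi> 0) (at (of_real \<rho> * 0))"
      by (simp add: DERIV_deriv_iff_field_differentiable)
    then have "((\<lambda>\<xi>. \<phi> (of_real \<rho> * \<xi>)) has_field_derivative deriv \<phi> 0 * of_real \<rho>) (at 0)"
      by (rule DERIV_chain2) (auto intro!: derivative_eq_intros)
    then have "(\<psi> has_field_derivative deriv \<phi> 0 * of_real \<rho> / of_real (2 * M)) (at 0)"
      unfolding \<psi>_def using M by (auto intro!: derivative_eq_intros)
    then have "norm (deriv \<phi> 0 * of_real \<rho> / of_real (2 * M)) \<le> 1"
      using Schwarz_Lemma(2) [OF hol\<psi> \<psi>0 \<psi>1, of 0] by (simp add: DERIV_imp_deriv)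
    then show ?thesis using True M \<rho> by (simp add: diff_quot_def norm_divide norm_mult field_simps)
  qed
qed

text \<open>The quotient of the quotient obeys the same estimate; 6 is 2 times 3, where 3 M/\<rho>
  is a strict bound replacing the weak one 2 M/\<rho>. The constant depends on M and \<rho> only,
  which gives uniformity in parameters.\<close>

lemma diff_quot_lipschitz:
  assumes hol: "\<phi> holomorphic_on ball 0 \<rho>" and bd: "\<And>w. norm w < \<rho> \<Longrightarrow> norm (\<phi> w) < M"
    and w: "norm w < \<rho>"
  shows "norm (diff_quot \<phi> w - deriv \<phi> 0) \<le> 6 * M / \<rho>\<^sup>2 * norm w"
proof (cases "w = 0")
  case False
  have \<rho>: "\<rho> > 0" using w norm_ge_zero [of w] by linarith
  have M: "M > 0" using bd [of 0] \<rho> by (auto intro: le_less_trans [OF norm_ge_zero])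
  have "norm (diff_quot (diff_quot \<phi>) w) \<le> 2 * (3 * M / \<rho>) / \<rho>"
  proof (rule diff_quot_bound [OF diff_quot_holomorphic [OF hol] _ w])
    fix w :: complex assume "norm w < \<rho>"
    then have "norm (diff_quot \<phi> w) \<le> 2 * M / \<rho>" using bd by (intro diff_quot_bound [OF hol])
    also have "\<dots> < 3 * M / \<rho>" using M \<rho> by (simp add: divide_strict_right_mono)
    finally show "norm (diff_quot \<phi> w) < 3 * M / \<rho>" .
  qed
  then show ?thesis
    using False by (simp add: diff_quot_def [of "diff_quot \<phi>"] diff_quot_def [of \<phi> 0] norm_divide power2_eq_square field_simps)
qed (simp add: diff_quot_def)

definition partial_quot :: "nat \<Rightarrow> ((nat \<Rightarrow> complex) \<Rightarrow> complex) \<Rightarrow> (nat \<Rightarrow> complex) \<Rightarrow> complex" where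
  "partial_quot i H z = diff_quot (\<lambda>w. H (z(i := w))) (z i)"

lemma partial_quot_eq: "H z = H (z(i := 0)) + z i * partial_quot i H z"
  by (cases "z i = 0") (auto simp: partial_quot_def diff_quot_def fun_upd_idem)

lemma polydisc_upd: "z \<in> polydisc X \<rho> \<Longrightarrow> norm w < \<rho> \<Longrightarrow> z(i := w) \<in> polydisc X \<rho>"
  by (auto simp: polydisc_def)

lemma sep_holomorphicD:
  "sep_holomorphic X \<rho> H \<Longrightarrow> z \<in> polydisc X \<rho> \<Longrightarrow> i \<in> X \<Longrightarrow> (\<lambda>w. H (z(i := w))) holomorphic_on ball 0 \<rho>"
  by (auto simp: sep_holomorphic_def)

lemma partial_quot_bound:
  assumes H: "sep_holomorphic X \<rho> H" "\<And>z. z \<in> polydisc X \<rho> \<Longrightarrow> norm (H z) < M" and i: "i \<in> X"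
    and z: "z \<in> polydisc X \<rho>"
  shows "norm (partial_quot i H z) \<le> 2 * M / \<rho>"
  unfolding partial_quot_def
  by (rule diff_quot_bound [OF sep_holomorphicD [OF H(1) z i]])
     (use z i in \<open>auto intro!: H(2) polydisc_upd simp: polydisc_def\<close>)

text \<open>The delicate case is another variable l at z i = 0, where the quotient is a derivative
  in direction i. It is the uniform limit of quotients at nonzero points tending to 0, by
  \<open>diff_quot_lipschitz\<close>; boundedness of \<open>H\<close> thus takes the place of joint
  continuity.\<close>

lemma partial_quot_sep_holomorphic:
  assumes H: "sep_holomorphic X \<rho> H" "\<And>z. z \<in> polydisc X \<rho> \<Longrightarrow> norm (H z) < M" and i: "i \<in> X"
  shows "sep_holomorphic X \<rho> (partial_quot i H)"
  unfolding sep_holomorphic_def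
proof (intro ballI)
  fix z l assume z: "z \<in> polydisc X \<rho>" and l: "l \<in> X"
  have "norm (z i) < \<rho>" using z i by (auto simp: polydisc_def)
  then have \<rho>: "\<rho> > 0" using norm_ge_zero [of "z i"] by linarith
  show "(\<lambda>w. partial_quot i H (z(l := w))) holomorphic_on ball 0 \<rho>"
  proof (cases "l = i")
    case True
    then show ?thesis
      using diff_quot_holomorphic [OF sep_holomorphicD [OF H(1) z i]] by (simp add: partial_quot_def)
  next
    case False
    have eq: "partial_quot i H (z(l := w)) = diff_quot (\<lambda>s. H (z(i := s, l := w))) (z i)" for w
      using False by (simp add: partial_quot_def fun_upd_twist)
    have hol: "(\<lambda>w. diff_quot (\<lambda>s. H (z(i := s, l := w))) s) holomorphic_on ball 0 \<rho>"
      if "s \<noteq> 0" "norm s < \<rho>" for s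
      using that \<rho> unfolding diff_quot_def
      by (auto intro!: holomorphic_intros sep_holomorphicD [OF H(1)] polydisc_upd z l)
    show ?thesis
    proof (cases "z i = 0")
      case False
      then show ?thesis unfolding eq by (intro hol) (use z i in \<open>auto simp: polydisc_def\<close>)
    next
      case True
      \<comment> \<open>Nonzero points of the disc tending to 0; the summand 2 puts even the first
        one at \<rho>/2, inside the open disc.\<close>
      define s where "s n = (of_real (\<rho> / (real n + 2)) :: complex)" for n :: nat
      have s: "s n \<noteq> 0" "norm (s n) < \<rho>" for n
      proof -
        have "\<rho> / (real n + 2) \<noteq> 0" using \<rho> by simp
        then show "s n \<noteq> 0" unfolding s_def of_real_eq_0_iff .
        show "norm (s n) < \<rho>" using \<rho> unfolding s_def norm_of_real by (simp add: divide_less_eq)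
      qed
      have lim: "uniform_limit (ball 0 \<rho>) (\<lambda>n w. diff_quot (\<lambda>s. H (z(i := s, l := w))) (s n))
          (\<lambda>w. deriv (\<lambda>s. H (z(i := s, l := w))) 0) sequentially"
      proof (rule uniform_limitI)
        fix \<epsilon> :: real assume \<epsilon>: "\<epsilon> > 0"
        have "(\<lambda>n. 6 * M / \<rho>\<^sup>2 * norm (s n)) \<longlonglongrightarrow> 6 * M / \<rho>\<^sup>2 * 0"
        proof (intro tendsto_intros)
          have "(\<lambda>n. \<rho> / (real n + 2)) \<longlonglongrightarrow> 0" by real_asymp
          then show "(\<lambda>n. norm (s n)) \<longlonglongrightarrow> 0" unfolding s_def norm_of_real by (rule tendsto_rabs_zero)
        qed
        then have "\<forall>\<^sub>F n in sequentially. 6 * M / \<rho>\<^sup>2 * norm (s n) < \<epsilon>"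
          using \<epsilon> by (intro order_tendstoD(2)) auto
        then show "\<forall>\<^sub>F n in sequentially. \<forall>w\<in>ball 0 \<rho>.
            dist (diff_quot (\<lambda>s. H (z(i := s, l := w))) (s n)) (deriv (\<lambda>s. H (z(i := s, l := w))) 0) < \<epsilon>"
        proof eventually_elim
          case (elim n)
          show ?case
          proof
            fix w :: complex assume w: "w \<in> ball 0 \<rho>"
            have up: "z(i := s, l := w) = z(l := w, i := s)" for s using False by (simp add: fun_upd_twist)
            have "norm (diff_quot (\<lambda>s. H (z(i := s, l := w))) (s n) - deriv (\<lambda>s. H (z(i := s, l := w))) 0)
                \<le> 6 * M / \<rho>\<^sup>2 * norm (s n)"
              unfolding up
              by (rule diff_quot_lipschitz)
                 (use w s in \<open>auto intro!: sep_holomorphicD [OF H(1)] H(2) polydisc_upd z i\<close>)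
            then show "dist (diff_quot (\<lambda>s. H (z(i := s, l := w))) (s n)) (deriv (\<lambda>s. H (z(i := s, l := w))) 0) < \<epsilon>"
              using elim by (simp add: dist_norm)
          qed
        qed
      qed
      have "(\<lambda>w. deriv (\<lambda>s. H (z(i := s, l := w))) 0) holomorphic_on ball 0 \<rho>"
      proof (rule holomorphic_uniform_sequence [OF open_ball])
        fix x :: complex assume "x \<in> ball 0 \<rho>"
        then obtain d where "d > 0" "cball x d \<subseteq> ball 0 \<rho>" using iffD1 [OF open_contains_cball open_ball] by blast
        then show "\<exists>d>0. cball x d \<subseteq> ball 0 \<rho> \<and> uniform_limit (cball x d)
            (\<lambda>n w. diff_quot (\<lambda>s. H (z(i := s, l := w))) (s n)) (\<lambda>w. deriv (\<lambda>s. H (z(i := s, l := w))) 0) sequentially"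
          using uniform_limit_on_subset [OF lim] by blast
      qed (use hol s in auto)
      then show ?thesis unfolding eq using True by (simp add: diff_quot_def)
    qed
  qed
qed

text \<open>A finite set of multi-indices lies in a cube, over which the sum factors into a product
  of geometric partial sums.\<close>

lemma summable_on_geometric_PiE:
  fixes x :: "'i \<Rightarrow> real"
  assumes X: "finite X" and x: "\<And>i. i \<in> X \<Longrightarrow> 0 \<le> x i" "\<And>i. i \<in> X \<Longrightarrow> x i < 1"
  shows "(\<lambda>k. \<Prod>i\<in>X. x i ^ k i) summable_on (X \<rightarrow>\<^sub>E (UNIV :: nat set))"
proof (rule nonneg_bounded_partial_sums_imp_summable_on)
  show "\<forall>\<^sub>F F in finite_subsets_at_top (X \<rightarrow>\<^sub>E UNIV). (\<Sum>k\<in>F. \<Prod>i\<in>X. x i ^ k i) \<le> (\<Prod>i\<in>X. 1 / (1 - x i))"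
  proof (rule eventually_finite_subsets_at_top_weakI)
    fix F assume F: "finite F" "F \<subseteq> X \<rightarrow>\<^sub>E (UNIV :: nat set)"
    define n where "n = Max (insert 0 ((\<lambda>(k, i). k i) ` (F \<times> X)))"
    have n: "k i \<le> n" if "k \<in> F" "i \<in> X" for k i
      unfolding n_def using that F X by (intro Max_ge) (auto intro: rev_image_eqI)
    have "(\<Sum>k\<in>F. \<Prod>i\<in>X. x i ^ k i) \<le> (\<Sum>k\<in>X \<rightarrow>\<^sub>E {..n}. \<Prod>i\<in>X. x i ^ k i)"
      using F n X x by (intro sum_mono2) (auto intro!: finite_PiE prod_nonneg simp: PiE_iff)
    also have "\<dots> = (\<Prod>i\<in>X. \<Sum>j\<le>n. x i ^ j)"
      by (rule prod_sum_PiE [symmetric]) (use X in auto)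
    also have "\<dots> \<le> (\<Prod>i\<in>X. 1 / (1 - x i))"
    proof (rule prod_mono, rule conjI)
      fix i assume i: "i \<in> X"
      show "0 \<le> (\<Sum>j\<le>n. x i ^ j)" using x i by (intro sum_nonneg) auto
      show "(\<Sum>j\<le>n. x i ^ j) \<le> 1 / (1 - x i)"
        using sum_le_suminf [OF summable_geometric, of "x i" "{..n}"] suminf_geometric [of "x i"] x [OF i]
        by auto
    qed
    finally show "(\<Sum>k\<in>F. \<Prod>i\<in>X. x i ^ k i) \<le> (\<Prod>i\<in>X. 1 / (1 - x i))" .
  qed
qed (use x in \<open>auto intro: prod_nonneg\<close>)

lemma PiE_insert_bij:
  assumes "i \<notin> X"
  shows "bij_betw (\<lambda>(m, k). k(i := m)) (UNIV \<times> (X \<rightarrow>\<^sub>E UNIV)) (insert i X \<rightarrow>\<^sub>E UNIV)"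
  unfolding bij_betw_def PiE_insert_eq using inj_combinator [OF assms, of "\<lambda>_. UNIV"] by simp

text \<open>Induction on the number of variables. Repeated division in the variable i produces
  coefficients \<open>a m\<close>, separately holomorphic in the other variables and bounded by M
  (3/\<rho>)^m, which the induction hypothesis expands. The point \<open>z0\<close> fixes the
  parameters outside \<open>X\<close>, and the coefficients may depend on it.\<close>

theorem osgood:
  assumes X: "finite X" and \<rho>: "\<rho> > 0"
    and H: "sep_holomorphic X \<rho> H" "\<And>z. z \<in> polydisc X \<rho> \<Longrightarrow> norm (H z) < M"
  shows "\<exists>c. (\<forall>k. norm (c k) \<le> M * (\<Prod>i\<in>X. (3 / \<rho>) ^ k i)) \<and>
    (\<forall>z\<in>polydisc X (\<rho> / 3). (\<forall>i. i \<notin> X \<longrightarrow> z i = z0 i) \<longrightarrow>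
       ((\<lambda>k. (\<Prod>i\<in>X. z i ^ k i) * c k) has_sum H z) (X \<rightarrow>\<^sub>E UNIV))"
  using X H
proof (induction X arbitrary: H M z0 rule: finite_induct)
  case empty
  have "norm (H z0) < M" by (rule empty.prems) (simp add: polydisc_def)
  moreover have "z = z0" if "\<forall>i. i \<notin> {} \<longrightarrow> z i = z0 i" for z using that by auto
  ultimately show ?case
    by (intro exI [of _ "\<lambda>_. H z0"]) (auto simp: has_sum_finite_iff)
next
  case (insert i X)
  define Q where "Q m = (partial_quot i ^^ m) H" for m
  have sub: "polydisc (insert i X) \<rho> \<subseteq> polydisc X \<rho>" by (auto simp: polydisc_def)
  have M: "M > 0"
  proof -
    have "(\<lambda>_. 0) \<in> polydisc (insert i X) \<rho>" using \<rho> by (simp add: polydisc_def)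
    then show ?thesis using insert.prems(2) norm_ge_zero le_less_trans by blast
  qed
  \<comment> \<open>Each division costs a factor 2/\<rho>. Taking 3/\<rho> instead keeps the bound
    strict, as the next division requires, and is the origin of the radius \<rho>/3.\<close>
  have Q: "sep_holomorphic (insert i X) \<rho> (Q m) \<and> (\<forall>z\<in>polydisc (insert i X) \<rho>. norm (Q m z) < M * (3 / \<rho>) ^ m)" for m
  proof (induction m)
    case 0
    then show ?case using insert.prems by (simp add: Q_def)
  next
    case (Suc m)
    have "norm (Q (Suc m) z) < M * (3 / \<rho>) ^ Suc m" if "z \<in> polydisc (insert i X) \<rho>" for z
    proof -
      have "norm (partial_quot i (Q m) z) \<le> 2 * (M * (3 / \<rho>) ^ m) / \<rho>"
        by (rule partial_quot_bound [OF _ _ _ that]) (use Suc in auto)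
      also have "\<dots> < 3 * (M * (3 / \<rho>) ^ m) / \<rho>" using M \<rho> by (simp add: divide_strict_right_mono)
      finally show ?thesis by (simp add: Q_def mult_ac)
    qed
    moreover have "sep_holomorphic (insert i X) \<rho> (partial_quot i (Q m))"
      by (rule partial_quot_sep_holomorphic) (use Suc in auto)
    ultimately show ?case by (simp add: Q_def)
  qed
  define a where "a m z = Q m (z(i := 0))" for m z
  have a: "sep_holomorphic X \<rho> (a m)" "\<And>z. z \<in> polydisc X \<rho> \<Longrightarrow> norm (a m z) < M * (3 / \<rho>) ^ m" for m
  proof -
    have mem: "z(i := 0) \<in> polydisc (insert i X) \<rho>" if "z \<in> polydisc X \<rho>" for z
      using that \<rho> by (auto simp: polydisc_def)
    show "sep_holomorphic X \<rho> (a m)"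
      unfolding sep_holomorphic_def
    proof (intro ballI)
      fix z l assume "z \<in> polydisc X \<rho>" "l \<in> X"
      moreover from this have "l \<noteq> i" using insert.hyps by auto
      ultimately show "(\<lambda>w. a m (z(l := w))) holomorphic_on ball 0 \<rho>"
        using sep_holomorphicD [OF conjunct1 [OF Q] mem, of z l m] by (simp add: a_def fun_upd_twist)
    qed
    show "norm (a m z) < M * (3 / \<rho>) ^ m" if "z \<in> polydisc X \<rho>" for z
      using Q mem [OF that] by (auto simp: a_def)
  qed
  have "\<forall>m. \<exists>c. (\<forall>k. norm (c k) \<le> M * (3 / \<rho>) ^ m * (\<Prod>i\<in>X. (3 / \<rho>) ^ k i)) \<and>
    (\<forall>z\<in>polydisc X (\<rho> / 3). (\<forall>l. l \<notin> X \<longrightarrow> z l = (z0(i := 0)) l) \<longrightarrow>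
       ((\<lambda>k. (\<Prod>i\<in>X. z i ^ k i) * c k) has_sum a m z) (X \<rightarrow>\<^sub>E UNIV))"
    using insert.IH [OF a] by blast
  from choice [OF this] obtain c where cbd: "\<And>m k. norm (c m k) \<le> M * (3 / \<rho>) ^ m * (\<Prod>i\<in>X. (3 / \<rho>) ^ k i)"
    and c: "\<And>m z. z \<in> polydisc X (\<rho> / 3) \<Longrightarrow> (\<forall>l. l \<notin> X \<longrightarrow> z l = (z0(i := 0)) l) \<Longrightarrow>
       ((\<lambda>k. (\<Prod>i\<in>X. z i ^ k i) * c m k) has_sum a m z) (X \<rightarrow>\<^sub>E UNIV)"
    by blast
  define C where "C k = c (k i) (restrict k X)" for k
  have Xi: "i \<notin> X" "finite X" by fact+
  have updX: "(\<Prod>l\<in>X. g l ((k(i := m)) l)) = (\<Prod>l\<in>X. g l (k l))" for g :: "nat \<Rightarrow> nat \<Rightarrow> 'z::comm_monoid_mult" and k m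
    by (rule prod.cong) (use Xi in auto)
  have "norm (C k) \<le> M * (\<Prod>l\<in>insert i X. (3 / \<rho>) ^ k l)" for k
    using cbd [of "k i" "restrict k X"] Xi by (simp add: C_def mult.assoc)
  moreover have "((\<lambda>k. (\<Prod>l\<in>insert i X. z l ^ k l) * C k) has_sum H z) (insert i X \<rightarrow>\<^sub>E UNIV)"
    if z: "z \<in> polydisc (insert i X) (\<rho> / 3)" and z0: "\<forall>l. l \<notin> insert i X \<longrightarrow> z l = z0 l" for z
  proof -
    have z': "z \<in> polydisc (insert i X) \<rho>" using z \<rho> by (force simp: polydisc_def)
    have zi: "norm (z i) < \<rho> / 3" using z by (auto simp: polydisc_def)
    define q where "q = 3 * norm (z i) / \<rho>"
    have q: "0 \<le> q" "q < 1" using zi \<rho> by (auto simp: q_def field_simps)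
    \<comment> \<open>Taylor formula with exact remainder in the single variable i; on the smaller
      polydisc the remainder is at most M q^n with q < 1.\<close>
    have rem: "H z = (\<Sum>m<n. a m z * z i ^ m) + Q n z * z i ^ n" for n
    proof (induction n)
      case (Suc n)
      have "Q n z = a n z + z i * Q (Suc n) z"
        using partial_quot_eq [of "Q n" z i] by (simp add: a_def Q_def)
      then show ?case using Suc by (simp add: algebra_simps)
    qed (simp add: Q_def)
    have "(\<lambda>n. Q n z * z i ^ n) \<longlonglongrightarrow> 0"
    proof (rule Lim_null_comparison)
      have "norm (Q n z * z i ^ n) \<le> M * q ^ n" for n
      proof -
        have "norm (Q n z) * norm (z i) ^ n \<le> M * (3 / \<rho>) ^ n * norm (z i) ^ n"
          using Q [of n] z' by (intro mult_right_mono) (auto intro: less_imp_le)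
        also have "\<dots> = M * q ^ n" by (simp add: q_def power_mult_distrib power_divide)
        finally show ?thesis by (simp add: norm_mult norm_power)
      qed
      then show "\<forall>\<^sub>F n in sequentially. norm (Q n z * z i ^ n) \<le> M * q ^ n" by simp
      show "(\<lambda>n. M * q ^ n) \<longlonglongrightarrow> 0"
        by (intro tendsto_mult_right_zero LIMSEQ_power_zero) (use q in auto)
    qed
    from tendsto_diff [OF tendsto_const [of "H z"] this]
    have "(\<lambda>n. H z - Q n z * z i ^ n) \<longlonglongrightarrow> H z" by simp
    moreover have "(\<lambda>n. H z - Q n z * z i ^ n) = (\<lambda>n. \<Sum>m<n. a m z * z i ^ m)"
    proof
      fix n
      show "H z - Q n z * z i ^ n = (\<Sum>m<n. a m z * z i ^ m)" by (subst rem [of n]) simp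
    qed
    ultimately have sums: "(\<lambda>m. a m z * z i ^ m) sums H z" by (simp add: sums_def)
    have "summable (\<lambda>m. norm (a m z * z i ^ m))"
    proof (rule summable_comparison_test)
      have "norm (a m z * z i ^ m) \<le> M * q ^ m" for m
      proof -
        have "norm (a m z) * norm (z i) ^ m \<le> M * (3 / \<rho>) ^ m * norm (z i) ^ m"
          using a(2) [of z m] z' sub by (intro mult_right_mono) (auto intro: less_imp_le)
        also have "\<dots> = M * q ^ m" by (simp add: q_def power_mult_distrib power_divide)
        finally show ?thesis by (simp add: norm_mult norm_power)
      qed
      then show "\<exists>n0. \<forall>n\<ge>n0. norm (norm (a n z * z i ^ n)) \<le> M * q ^ n" by simp
      show "summable (\<lambda>n. M * q ^ n)" by (intro summable_mult summable_geometric) (use q in auto)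
    qed
    then have outer: "((\<lambda>m. a m z * z i ^ m) has_sum H z) UNIV"
      by (rule norm_summable_imp_has_sum [OF _ sums])
    have inner: "((\<lambda>k. (\<Prod>l\<in>insert i X. z l ^ (k(i := m)) l) * C (k(i := m))) has_sum a m z * z i ^ m) (X \<rightarrow>\<^sub>E UNIV)" for m
    proof -
      have "((\<lambda>k. (\<Prod>l\<in>X. (z(i := 0)) l ^ k l) * c m k) has_sum a m (z(i := 0))) (X \<rightarrow>\<^sub>E UNIV)"
        by (rule c) (use z z0 \<rho> in \<open>auto simp: polydisc_def\<close>)
      moreover have "(\<Prod>l\<in>X. (z(i := 0)) l ^ k l) = (\<Prod>l\<in>X. z l ^ k l)" for k
        by (rule prod.cong) (use Xi in auto)
      ultimately have "((\<lambda>k. (\<Prod>l\<in>X. z l ^ k l) * c m k) has_sum a m z) (X \<rightarrow>\<^sub>E UNIV)"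
        by (simp add: a_def)
      then have "((\<lambda>k. (\<Prod>l\<in>X. z l ^ k l) * c m k * z i ^ m) has_sum a m z * z i ^ m) (X \<rightarrow>\<^sub>E UNIV)"
        by (rule has_sum_cmult_left)
      moreover have "(\<Prod>l\<in>insert i X. z l ^ (k(i := m)) l) * C (k(i := m)) = (\<Prod>l\<in>X. z l ^ k l) * c m k * z i ^ m"
        if "k \<in> X \<rightarrow>\<^sub>E UNIV" for k
      proof -
        have "restrict (k(i := m)) X = k" using that Xi by (auto simp: restrict_def PiE_def extensional_def fun_eq_iff)
        moreover have "(\<Prod>l\<in>X. z l ^ (k(i := m)) l) = (\<Prod>l\<in>X. z l ^ k l)" by (rule updX)
        ultimately show ?thesis using Xi by (simp add: C_def del: fun_upd_apply) (simp add: mult_ac)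
      qed
      ultimately show ?thesis by (simp cong: has_sum_cong)
    qed
    \<comment> \<open>Unconditional summability over all multi-indices allows the iterated sum, over
      k inside and over m outside, to be read as a single sum.\<close>
    have summ: "(\<lambda>k. (\<Prod>l\<in>insert i X. z l ^ k l) * C k) summable_on (insert i X \<rightarrow>\<^sub>E UNIV)"
    proof (rule abs_summable_summable, rule summable_on_comparison_test)
      show "(\<lambda>k. M * (\<Prod>l\<in>insert i X. (3 * norm (z l) / \<rho>) ^ k l)) summable_on (insert i X \<rightarrow>\<^sub>E UNIV)"
        by (intro summable_on_cmult_right summable_on_geometric_PiE)
           (use z \<rho> Xi in \<open>auto simp: polydisc_def field_simps\<close>)
      fix k :: "nat \<Rightarrow> nat"
      have "norm ((\<Prod>l\<in>insert i X. z l ^ k l) * C k) \<le> (\<Prod>l\<in>insert i X. norm (z l) ^ k l) * (M * (\<Prod>l\<in>insert i X. (3 / \<rho>) ^ k l))"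
        unfolding norm_mult prod_norm [symmetric] norm_power
        by (intro mult_left_mono \<open>norm (C k) \<le> _\<close> prod_nonneg) auto
      also have "\<dots> = M * (\<Prod>l\<in>insert i X. (3 * norm (z l) / \<rho>) ^ k l)"
        by (simp add: prod.distrib [symmetric] power_mult_distrib power_divide mult_ac
              flip: prod.distrib del: prod.insert)
      finally show "norm ((\<Prod>l\<in>insert i X. z l ^ k l) * C k) \<le> M * (\<Prod>l\<in>insert i X. (3 * norm (z l) / \<rho>) ^ k l)" .
    qed simp
    let ?f = "\<lambda>k. (\<Prod>l\<in>insert i X. z l ^ k l) * C k"
    have "((\<lambda>p. ?f ((\<lambda>(m, k). k(i := m)) p)) has_sum H z) (UNIV \<times> (X \<rightarrow>\<^sub>E UNIV))"
    proof (rule has_sum_SigmaI [OF _ outer])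
      show "((\<lambda>y. ?f ((\<lambda>(m, k). k(i := m)) (m, y))) has_sum a m z * z i ^ m) (X \<rightarrow>\<^sub>E UNIV)" for m
        using inner [of m] by simp
      show "(\<lambda>p. ?f ((\<lambda>(m, k). k(i := m)) p)) summable_on UNIV \<times> (X \<rightarrow>\<^sub>E UNIV)"
        using summable_on_reindex_bij_betw [OF PiE_insert_bij [OF Xi(1)], of ?f] summ by blast
    qed
    then show ?thesis using has_sum_reindex_bij_betw [OF PiE_insert_bij [OF Xi(1)], of ?f] by blast
  qed
  ultimately show ?case by (intro exI [of _ C]) auto
qed

section \<open>Real functions with bounded holomorphic extensions\<close>

definition hol_ext_at :: "nat set \<Rightarrow> real \<Rightarrow> real \<Rightarrow> ((nat \<Rightarrow> real) \<Rightarrow> real) \<Rightarrow> bool" where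
  "hol_ext_at X \<rho> M u \<longleftrightarrow> (\<exists>H. sep_holomorphic X \<rho> H \<and> (\<forall>z\<in>polydisc X \<rho>. norm (H z) \<le> M) \<and>
     (\<forall>y. (\<forall>i\<in>X. \<bar>y i\<bar> < \<rho>) \<longrightarrow> H (\<lambda>i. of_real (y i)) = of_real (u y)))"

definition hol_ext :: "nat set \<Rightarrow> ((nat \<Rightarrow> real) \<Rightarrow> real) \<Rightarrow> bool" where
  "hol_ext X u \<longleftrightarrow> (\<exists>\<rho>>0. \<exists>M. hol_ext_at X \<rho> M u)"

text \<open>Stands for vanishing at the origin: shrinking the polydisc makes the extension as small
  as desired, so that it fits into the disc of holomorphy of an outer function.\<close>

definition small_ext :: "nat set \<Rightarrow> ((nat \<Rightarrow> real) \<Rightarrow> real) \<Rightarrow> bool" where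
  "small_ext X u \<longleftrightarrow> (\<forall>\<epsilon>>0. \<exists>\<rho>>0. hol_ext_at X \<rho> \<epsilon> u)"

lemma polydisc_mono: "\<rho>' \<le> \<rho> \<Longrightarrow> polydisc X \<rho>' \<subseteq> polydisc X \<rho>"
  by (force simp: polydisc_def)

lemma sep_holomorphic_mono: "sep_holomorphic X \<rho> H \<Longrightarrow> \<rho>' \<le> \<rho> \<Longrightarrow> sep_holomorphic X \<rho>' H"
  unfolding sep_holomorphic_def using polydisc_mono
  by (meson holomorphic_on_subset subset_ball subset_iff)

lemma hol_ext_at_mono: "hol_ext_at X \<rho> M u \<Longrightarrow> \<rho>' \<le> \<rho> \<Longrightarrow> M \<le> M' \<Longrightarrow> hol_ext_at X \<rho>' M' u"
proof -
  assume u: "hol_ext_at X \<rho> M u" and le: "\<rho>' \<le> \<rho>" "M \<le> M'"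
  obtain H where H: "sep_holomorphic X \<rho> H" "\<And>z. z \<in> polydisc X \<rho> \<Longrightarrow> norm (H z) \<le> M"
     "\<And>y. (\<And>i. i \<in> X \<Longrightarrow> \<bar>y i\<bar> < \<rho>) \<Longrightarrow> H (\<lambda>i. of_real (y i)) = of_real (u y)"
    using u unfolding hol_ext_at_def by blast
  show ?thesis unfolding hol_ext_at_def
  proof (intro exI [of _ H] conjI ballI allI impI)
    show "norm (H z) \<le> M'" if "z \<in> polydisc X \<rho>'" for z
      using H(2) [of z] that le polydisc_mono [OF le(1)] by force
    show "H (\<lambda>i. of_real (y i)) = of_real (u y)" if "\<forall>i\<in>X. \<bar>y i\<bar> < \<rho>'" for y
      by (rule H(3)) (use that le in force)
  qed (use H(1) le sep_holomorphic_mono in auto)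
qed

lemma polydisc_of_real: "\<forall>i\<in>X. \<bar>y i\<bar> < \<rho> \<Longrightarrow> (\<lambda>i. complex_of_real (y i)) \<in> polydisc X \<rho>"
  by (simp add: polydisc_def)

lemma hol_ext_at_real_bound:
  assumes "hol_ext_at X \<rho> M u" "\<forall>i\<in>X. \<bar>y i\<bar> < \<rho>"
  shows "\<bar>u y\<bar> \<le> M"
proof -
  obtain H :: "(nat \<Rightarrow> complex) \<Rightarrow> complex" where H: "\<And>z. z \<in> polydisc X \<rho> \<Longrightarrow> norm (H z) \<le> M"
     "\<And>y. (\<forall>i\<in>X. \<bar>y i\<bar> < \<rho>) \<Longrightarrow> H (\<lambda>i. of_real (y i)) = of_real (u y)"
    using assms(1) unfolding hol_ext_at_def by blast
  show ?thesis using H(1) [OF polydisc_of_real [OF assms(2)]] H(2) [OF assms(2)] by simp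
qed

lemma hol_ext_at_const: "\<bar>c\<bar> \<le> M \<Longrightarrow> hol_ext_at X \<rho> M (\<lambda>_. c)"
  unfolding hol_ext_at_def
  by (rule exI [of _ "\<lambda>_. of_real c"]) (auto simp: sep_holomorphic_def)

lemma hol_ext_at_coord:
  assumes "i \<in> X"
  shows "hol_ext_at X \<rho> \<rho> (\<lambda>y. y i)"
proof -
  have "(\<lambda>w. (z(l := w)) i) holomorphic_on S" for z :: "nat \<Rightarrow> complex" and l S
    by (cases "l = i") auto
  then show ?thesis
    unfolding hol_ext_at_def using assms
    by (intro exI [of _ "\<lambda>z. z i"]) (auto simp: sep_holomorphic_def polydisc_def less_imp_le simp del: fun_upd_apply)
qed

lemma hol_ext_at_add:
  assumes "hol_ext_at X \<rho> M u" "hol_ext_at X \<rho> L v"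
  shows "hol_ext_at X \<rho> (M + L) (\<lambda>y. u y + v y)"
proof -
  obtain H G where "sep_holomorphic X \<rho> H" "\<forall>z\<in>polydisc X \<rho>. norm (H z) \<le> M"
     "\<forall>y. (\<forall>i\<in>X. \<bar>y i\<bar> < \<rho>) \<longrightarrow> H (\<lambda>i. of_real (y i)) = of_real (u y)"
    and "sep_holomorphic X \<rho> G" "\<forall>z\<in>polydisc X \<rho>. norm (G z) \<le> L"
     "\<forall>y. (\<forall>i\<in>X. \<bar>y i\<bar> < \<rho>) \<longrightarrow> G (\<lambda>i. of_real (y i)) = of_real (v y)"
    using assms unfolding hol_ext_at_def by blast
  then show ?thesis
    unfolding hol_ext_at_def
    by (intro exI [of _ "\<lambda>z. H z + G z"])
       (auto simp: sep_holomorphic_def intro!: holomorphic_intros intro: norm_triangle_mono)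
qed

lemma hol_ext_at_mult:
  assumes "hol_ext_at X \<rho> M u" "hol_ext_at X \<rho> L v"
  shows "hol_ext_at X \<rho> (M * L) (\<lambda>y. u y * v y)"
proof -
  obtain H G where "sep_holomorphic X \<rho> H" "\<forall>z\<in>polydisc X \<rho>. norm (H z) \<le> M"
     "\<forall>y. (\<forall>i\<in>X. \<bar>y i\<bar> < \<rho>) \<longrightarrow> H (\<lambda>i. of_real (y i)) = of_real (u y)"
    and "sep_holomorphic X \<rho> G" "\<forall>z\<in>polydisc X \<rho>. norm (G z) \<le> L"
     "\<forall>y. (\<forall>i\<in>X. \<bar>y i\<bar> < \<rho>) \<longrightarrow> G (\<lambda>i. of_real (y i)) = of_real (v y)"
    using assms unfolding hol_ext_at_def by blast
  then show ?thesis
    unfolding hol_ext_at_def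
    by (intro exI [of _ "\<lambda>z. H z * G z"])
       (auto simp: sep_holomorphic_def norm_mult intro!: holomorphic_intros mult_mono'
          intro: order_trans [OF norm_ge_zero])
qed

lemma hol_ext_at_power: "hol_ext_at X \<rho> M u \<Longrightarrow> hol_ext_at X \<rho> (M ^ n) (\<lambda>y. u y ^ n)"
  by (induction n) (auto intro: hol_ext_at_const hol_ext_at_mult)

lemma hol_ext_at_prod:
  "finite S \<Longrightarrow> (\<And>s. s \<in> S \<Longrightarrow> hol_ext_at X \<rho> (M s) (u s)) \<Longrightarrow>
     hol_ext_at X \<rho> (\<Prod>s\<in>S. M s) (\<lambda>y. \<Prod>s\<in>S. u s y)"
  by (induction S rule: finite_induct) (auto intro: hol_ext_at_const hol_ext_at_mult)

lemma hol_ext_at_sum: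
  "finite S \<Longrightarrow> (\<And>s. s \<in> S \<Longrightarrow> hol_ext_at X \<rho> (M s) (u s)) \<Longrightarrow>
     hol_ext_at X \<rho> (\<Sum>s\<in>S. M s) (\<lambda>y. \<Sum>s\<in>S. u s y)"
  by (induction S rule: finite_induct) (auto intro: hol_ext_at_const hol_ext_at_add)

lemma hol_ext_at_cong:
  assumes "hol_ext_at X \<rho> M u" "\<And>y. \<forall>i\<in>X. \<bar>y i\<bar> < \<rho> \<Longrightarrow> u y = v y"
  shows "hol_ext_at X \<rho> M v"
  using assms unfolding hol_ext_at_def by metis

lemma small_ext_imp_hol_ext: "small_ext X u \<Longrightarrow> hol_ext X u"
  unfolding small_ext_def hol_ext_def by (meson zero_less_one)

lemma small_ext_uniform:
  assumes "finite S" "\<And>s. s \<in> S \<Longrightarrow> small_ext X (u s)" "\<And>s. s \<in> S \<Longrightarrow> \<epsilon> s > 0" "\<rho>0 > 0"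
  shows "\<exists>\<rho>>0. \<rho> \<le> \<rho>0 \<and> (\<forall>s\<in>S. hol_ext_at X \<rho> (\<epsilon> s) (u s))"
  using assms(1-3)
proof (induction S rule: finite_induct)
  case empty
  then show ?case using assms(4) by auto
next
  case (insert s S)
  then obtain \<rho> where \<rho>: "\<rho> > 0" "\<rho> \<le> \<rho>0" "\<forall>s\<in>S. hol_ext_at X \<rho> (\<epsilon> s) (u s)" by auto
  obtain \<rho>' where \<rho>': "\<rho>' > 0" "hol_ext_at X \<rho>' (\<epsilon> s) (u s)"
    using insert.prems unfolding small_ext_def by blast
  show ?case
    by (rule exI [of _ "min \<rho> \<rho>'"]) (use \<rho> \<rho>' in \<open>auto intro: hol_ext_at_mono\<close>)
qed

lemma hol_ext_const: "hol_ext X (\<lambda>_. c)"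
  unfolding hol_ext_def using hol_ext_at_const [OF order_refl] zero_less_one by blast

lemma small_ext_coord: "i \<in> X \<Longrightarrow> small_ext X (\<lambda>y. y i)"
  unfolding small_ext_def using hol_ext_at_coord by blast

lemma hol_ext_add: assumes "hol_ext X u" "hol_ext X v" shows "hol_ext X (\<lambda>y. u y + v y)"
proof -
  obtain \<rho> M \<rho>' M' where "\<rho> > 0" "hol_ext_at X \<rho> M u" "\<rho>' > 0" "hol_ext_at X \<rho>' M' v"
    using assms unfolding hol_ext_def by blast
  then have "hol_ext_at X (min \<rho> \<rho>') (M + M') (\<lambda>y. u y + v y)"
    by (intro hol_ext_at_add) (auto intro: hol_ext_at_mono)
  moreover have "min \<rho> \<rho>' > 0" using \<open>\<rho> > 0\<close> \<open>\<rho>' > 0\<close> by simp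
  ultimately show ?thesis unfolding hol_ext_def by blast
qed

lemma hol_ext_mult: assumes "hol_ext X u" "hol_ext X v" shows "hol_ext X (\<lambda>y. u y * v y)"
proof -
  obtain \<rho> M \<rho>' M' where "\<rho> > 0" "hol_ext_at X \<rho> M u" "\<rho>' > 0" "hol_ext_at X \<rho>' M' v"
    using assms unfolding hol_ext_def by blast
  then have "hol_ext_at X (min \<rho> \<rho>') (M * M') (\<lambda>y. u y * v y)"
    by (intro hol_ext_at_mult) (auto intro: hol_ext_at_mono)
  moreover have "min \<rho> \<rho>' > 0" using \<open>\<rho> > 0\<close> \<open>\<rho>' > 0\<close> by simp
  ultimately show ?thesis unfolding hol_ext_def by blast
qed

lemma hol_ext_sum: "finite S \<Longrightarrow> (\<And>s. s \<in> S \<Longrightarrow> hol_ext X (u s)) \<Longrightarrow> hol_ext X (\<lambda>y. \<Sum>s\<in>S. u s y)"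
  by (induction S rule: finite_induct) (auto intro: hol_ext_const hol_ext_add)

lemma hol_ext_prod: "finite S \<Longrightarrow> (\<And>s. s \<in> S \<Longrightarrow> hol_ext X (u s)) \<Longrightarrow> hol_ext X (\<lambda>y. \<Prod>s\<in>S. u s y)"
  by (induction S rule: finite_induct) (auto intro: hol_ext_const hol_ext_mult)

lemma hol_ext_cong:
  assumes "hol_ext X u" "r > 0" "\<And>y. \<forall>i\<in>X. \<bar>y i\<bar> < r \<Longrightarrow> u y = v y"
  shows "hol_ext X v"
proof -
  obtain \<rho> M where \<rho>: "\<rho> > 0" "hol_ext_at X \<rho> M u" using assms(1) by (auto simp: hol_ext_def)
  have "hol_ext_at X (min \<rho> r) M v"
    by (rule hol_ext_at_cong [OF hol_ext_at_mono [OF \<rho>(2)]]) (use assms(3) in auto)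
  moreover have "min \<rho> r > 0" using \<rho> assms by simp
  ultimately show ?thesis unfolding hol_ext_def by blast
qed

lemma small_ext_add: assumes "small_ext X u" "small_ext X v" shows "small_ext X (\<lambda>y. u y + v y)"
  unfolding small_ext_def
proof (intro allI impI)
  fix \<epsilon> :: real assume "\<epsilon> > 0"
  then obtain \<rho> \<rho>' where "\<rho> > 0" "hol_ext_at X \<rho> (\<epsilon> / 2) u" "\<rho>' > 0" "hol_ext_at X \<rho>' (\<epsilon> / 2) v"
    using assms unfolding small_ext_def by (meson half_gt_zero)
  then have "hol_ext_at X (min \<rho> \<rho>') (\<epsilon> / 2 + \<epsilon> / 2) (\<lambda>y. u y + v y)"
    by (intro hol_ext_at_add) (auto intro: hol_ext_at_mono)
  moreover have "min \<rho> \<rho>' > 0" using \<open>\<rho> > 0\<close> \<open>\<rho>' > 0\<close> by simp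
  ultimately show "\<exists>\<rho>>0. hol_ext_at X \<rho> \<epsilon> (\<lambda>y. u y + v y)" by (intro exI [of _ "min \<rho> \<rho>'"]) auto
qed

lemma small_ext_sum: "finite S \<Longrightarrow> (\<And>s. s \<in> S \<Longrightarrow> small_ext X (u s)) \<Longrightarrow> small_ext X (\<lambda>y. \<Sum>s\<in>S. u s y)"
proof (induction S rule: finite_induct)
  case empty
  have "hol_ext_at X 1 \<epsilon> (\<lambda>_. 0)" if "\<epsilon> > 0" for \<epsilon> using that by (intro hol_ext_at_const) auto
  then show ?case unfolding small_ext_def by (auto intro!: exI [of _ 1])
qed (auto intro: small_ext_add)

lemma small_ext_mult: assumes "hol_ext X u" "small_ext X v" shows "small_ext X (\<lambda>y. u y * v y)"
  unfolding small_ext_def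
proof (intro allI impI)
  fix \<epsilon> :: real assume \<epsilon>: "\<epsilon> > 0"
  obtain \<rho> M where \<rho>: "\<rho> > 0" "hol_ext_at X \<rho> M u" using assms(1) by (auto simp: hol_ext_def)
  have "\<epsilon> / (\<bar>M\<bar> + 1) > 0" using \<epsilon> by simp
  then obtain \<rho>' where \<rho>': "\<rho>' > 0" "hol_ext_at X \<rho>' (\<epsilon> / (\<bar>M\<bar> + 1)) v"
    using assms(2) unfolding small_ext_def by blast
  have "hol_ext_at X (min \<rho> \<rho>') ((\<bar>M\<bar> + 1) * (\<epsilon> / (\<bar>M\<bar> + 1))) (\<lambda>y. u y * v y)"
    by (intro hol_ext_at_mult hol_ext_at_mono [OF \<rho>(2)] hol_ext_at_mono [OF \<rho>'(2)]) auto
  moreover have "min \<rho> \<rho>' > 0" using \<rho> \<rho>' by simp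
  moreover have "(\<bar>M\<bar> + 1) * (\<epsilon> / (\<bar>M\<bar> + 1)) = \<epsilon>" by simp
  ultimately show "\<exists>\<rho>>0. hol_ext_at X \<rho> \<epsilon> (\<lambda>y. u y * v y)" by metis
qed

lemma hol_ext_at_compose:
  assumes u: "hol_ext_at X \<rho> \<epsilon> u" and \<epsilon>: "\<epsilon> < \<delta>" and hol: "\<phi> holomorphic_on ball 0 \<delta>"
    and bd: "\<And>w. norm w \<le> \<epsilon> \<Longrightarrow> norm (\<phi> w) \<le> M"
    and re: "\<And>t. \<bar>t\<bar> < \<delta> \<Longrightarrow> \<phi> (of_real t) = of_real (\<psi> t)"
  shows "hol_ext_at X \<rho> M (\<lambda>y. \<psi> (u y))"
proof -
  obtain H where H: "sep_holomorphic X \<rho> H" "\<And>z. z \<in> polydisc X \<rho> \<Longrightarrow> norm (H z) \<le> \<epsilon>"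
     "\<And>y. (\<forall>i\<in>X. \<bar>y i\<bar> < \<rho>) \<Longrightarrow> H (\<lambda>i. of_real (y i)) = of_real (u y)"
    using u unfolding hol_ext_at_def by blast
  show ?thesis
    unfolding hol_ext_at_def
  proof (intro exI [of _ "\<lambda>z. \<phi> (H z)"] conjI ballI allI impI)
    show "sep_holomorphic X \<rho> (\<lambda>z. \<phi> (H z))"
      unfolding sep_holomorphic_def
    proof (intro ballI)
      fix z i assume z: "z \<in> polydisc X \<rho>" "i \<in> X"
      show "(\<lambda>w. \<phi> (H (z(i := w)))) holomorphic_on ball 0 \<rho>"
        by (rule holomorphic_on_compose_gen [OF sep_holomorphicD [OF H(1) z] hol, unfolded o_def])
           (use H(2) [OF polydisc_upd [OF z(1)]] \<epsilon> in \<open>force intro: le_less_trans\<close>)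
    qed
    show "norm (\<phi> (H z)) \<le> M" if "z \<in> polydisc X \<rho>" for z by (rule bd [OF H(2) [OF that]])
    show "\<phi> (H (\<lambda>i. of_real (y i))) = of_real (\<psi> (u y))" if "\<forall>i\<in>X. \<bar>y i\<bar> < \<rho>" for y
      using hol_ext_at_real_bound [OF u that] re [of "u y"] \<epsilon> H(3) [OF that] by simp
  qed
qed

text \<open>Smallness brings the values of the extension into the disc where \<phi> is holomorphic;
  after subtraction of \<psi> 0 the composite is small again, by continuity of \<phi> at 0.\<close>

lemma small_ext_compose:
  assumes u: "small_ext X u" and \<delta>: "\<delta> > 0" and hol: "\<phi> holomorphic_on ball 0 \<delta>"
    and re: "\<And>t. \<bar>t\<bar> < \<delta> \<Longrightarrow> \<phi> (of_real t) = of_real (\<psi> t)"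
  shows "small_ext X (\<lambda>y. \<psi> (u y) - \<psi> 0)" "hol_ext X (\<lambda>y. \<psi> (u y))"
proof -
  show s: "small_ext X (\<lambda>y. \<psi> (u y) - \<psi> 0)"
    unfolding small_ext_def
  proof (intro allI impI)
    fix \<epsilon> :: real assume \<epsilon>: "\<epsilon> > 0"
    have "continuous_on (ball 0 \<delta>) \<phi>" by (rule holomorphic_on_imp_continuous_on [OF hol])
    then have "isCont \<phi> 0" using \<delta> by (simp add: continuous_on_eq_continuous_at)
    then obtain d where d: "d > 0" "\<And>w. dist w 0 < d \<Longrightarrow> dist (\<phi> w) (\<phi> 0) < \<epsilon>"
      using \<epsilon> unfolding continuous_at_eps_delta by blast
    define \<eta> where "\<eta> = min d \<delta> / 2"
    have \<eta>: "\<eta> > 0" "\<eta> < \<delta>" "\<eta> < d" using d \<delta> by (auto simp: \<eta>_def min_def)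
    obtain \<rho> where \<rho>: "\<rho> > 0" "hol_ext_at X \<rho> \<eta> u" using u \<eta> unfolding small_ext_def by blast
    have "hol_ext_at X \<rho> \<epsilon> (\<lambda>y. (\<lambda>t. \<psi> t - \<psi> 0) (u y))"
    proof (rule hol_ext_at_compose [OF \<rho>(2) \<eta>(2), of "\<lambda>w. \<phi> w - \<phi> 0"])
      show "norm (\<phi> w - \<phi> 0) \<le> \<epsilon>" if "norm w \<le> \<eta>" for w
        using d(2) [of w] that \<eta> by (simp add: dist_norm)
      show "\<phi> (of_real t) - \<phi> 0 = of_real (\<psi> t - \<psi> 0)" if "\<bar>t\<bar> < \<delta>" for t
        using re [OF that] re [of 0] \<delta> by simp
    qed (auto intro!: holomorphic_intros hol)
    then show "\<exists>\<rho>>0. hol_ext_at X \<rho> \<epsilon> (\<lambda>y. \<psi> (u y) - \<psi> 0)" using \<rho> by auto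
  qed
  show "hol_ext X (\<lambda>y. \<psi> (u y))"
    using hol_ext_add [OF small_ext_imp_hol_ext [OF s] hol_ext_const [of X "\<psi> 0"]] by simp
qed

section \<open>Infinite sums and power series of extensions\<close>

lemma holomorphic_on_ball_local:
  assumes "\<And>x. x \<in> ball a r \<Longrightarrow> \<exists>d>0. f holomorphic_on ball x d"
  shows "f holomorphic_on ball a r"
proof (rule holomorphic_onI)
  fix x assume "x \<in> ball a r"
  then obtain d where "d > 0" "f holomorphic_on ball x d" using assms by blast
  then have "f field_differentiable at x"
    by (auto intro!: holomorphic_on_imp_differentiable_at [of _ "ball x d"])
  then show "f field_differentiable at x within ball a r" by (rule field_differentiable_at_within)
qed

text \<open>Weierstrass M-test in one variable at a time, the others being frozen: separate
  holomorphy is a one-variable notion and passes to the uniform limit.\<close>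

lemma hol_ext_at_infsum:
  assumes q: "\<And>k. k \<in> K \<Longrightarrow> hol_ext_at X \<rho> (B k) (q k)" and B: "B summable_on K"
    and u: "\<And>y. \<forall>i\<in>X. \<bar>y i\<bar> < \<rho> \<Longrightarrow> ((\<lambda>k. q k y) has_sum u y) K"
  shows "hol_ext_at X \<rho> (infsum B K) u"
proof -
  have "\<forall>k\<in>K. \<exists>H. sep_holomorphic X \<rho> H \<and> (\<forall>z\<in>polydisc X \<rho>. norm (H z) \<le> B k) \<and>
     (\<forall>y. (\<forall>i\<in>X. \<bar>y i\<bar> < \<rho>) \<longrightarrow> H (\<lambda>i. of_real (y i)) = of_real (q k y))"
    using q unfolding hol_ext_at_def by blast
  from bchoice [OF this] obtain H where H: "\<And>k. k \<in> K \<Longrightarrow> sep_holomorphic X \<rho> (H k)"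
    "\<And>k z. k \<in> K \<Longrightarrow> z \<in> polydisc X \<rho> \<Longrightarrow> norm (H k z) \<le> B k"
    "\<And>k y. k \<in> K \<Longrightarrow> \<forall>i\<in>X. \<bar>y i\<bar> < \<rho> \<Longrightarrow> H k (\<lambda>i. of_real (y i)) = of_real (q k y)"
    by blast
  have summ: "(\<lambda>k. norm (H k z)) summable_on K" if "z \<in> polydisc X \<rho>" for z
    by (rule summable_on_comparison_test [OF B]) (use H(2) that in auto)
  show ?thesis
    unfolding hol_ext_at_def
  proof (intro exI [of _ "\<lambda>z. \<Sum>\<^sub>\<infinity>k\<in>K. H k z"] conjI ballI allI impI)
    show "norm (\<Sum>\<^sub>\<infinity>k\<in>K. H k z) \<le> infsum B K" if "z \<in> polydisc X \<rho>" for z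
      by (rule order_trans [OF norm_infsum_bound [OF summ [OF that]] infsum_mono [OF summ [OF that] B]])
         (use H(2) that in auto)
    show "(\<Sum>\<^sub>\<infinity>k\<in>K. H k (\<lambda>i. of_real (y i))) = of_real (u y)" if "\<forall>i\<in>X. \<bar>y i\<bar> < \<rho>" for y
    proof -
      have "((\<lambda>k. complex_of_real (q k y)) has_sum of_real (u y)) K"
        by (rule has_sum_bounded_linear [OF bounded_linear_of_real u [OF that]])
      then have "((\<lambda>k. H k (\<lambda>i. of_real (y i))) has_sum of_real (u y)) K"
        using H(3) that by (simp cong: has_sum_cong)
      then show ?thesis by (rule infsumI)
    qed
    show "sep_holomorphic X \<rho> (\<lambda>z. \<Sum>\<^sub>\<infinity>k\<in>K. H k z)"
      unfolding sep_holomorphic_def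
    proof (intro ballI)
      fix z i assume z: "z \<in> polydisc X \<rho>" "i \<in> X"
      have lim: "uniform_limit (ball 0 \<rho>) (\<lambda>F w. \<Sum>k\<in>F. H k (z(i := w))) (\<lambda>w. \<Sum>\<^sub>\<infinity>k\<in>K. H k (z(i := w)))
          (finite_subsets_at_top K)"
        by (rule Weierstrass_m_test_general [OF _ B]) (use H(2) polydisc_upd [OF z(1)] in auto)
      have fin: "\<forall>\<^sub>F F in finite_subsets_at_top K. (\<lambda>w. \<Sum>k\<in>F. H k (z(i := w))) holomorphic_on ball 0 \<rho>"
        by (rule eventually_finite_subsets_at_top_weakI)
           (auto intro!: holomorphic_intros sep_holomorphicD [OF H(1)] z)
      show "(\<lambda>w. \<Sum>\<^sub>\<infinity>k\<in>K. H k (z(i := w))) holomorphic_on ball 0 \<rho>"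
      proof (rule holomorphic_on_ball_local)
        fix x :: complex assume "x \<in> ball 0 \<rho>"
        then obtain d where d: "d > 0" "cball x d \<subseteq> ball 0 \<rho>" using iffD1 [OF open_contains_cball open_ball] by blast
        have "(\<lambda>w. \<Sum>\<^sub>\<infinity>k\<in>K. H k (z(i := w))) holomorphic_on ball x d"
        proof (rule holomorphic_uniform_limit)
          show "\<forall>\<^sub>F F in finite_subsets_at_top K. continuous_on (cball x d) (\<lambda>w. \<Sum>k\<in>F. H k (z(i := w)))
              \<and> (\<lambda>w. \<Sum>k\<in>F. H k (z(i := w))) holomorphic_on ball x d"
            using fin by eventually_elim
              (use d in \<open>auto intro: holomorphic_on_subset continuous_on_subset [OF holomorphic_on_imp_continuous_on]
                 dest: subset_trans [OF ball_subset_cball]\<close>)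
          show "uniform_limit (cball x d) (\<lambda>F w. \<Sum>k\<in>F. H k (z(i := w))) (\<lambda>w. \<Sum>\<^sub>\<infinity>k\<in>K. H k (z(i := w)))
              (finite_subsets_at_top K)"
            by (rule uniform_limit_on_subset [OF lim d(2)])
        qed auto
        then show "\<exists>d>0. (\<lambda>w. \<Sum>\<^sub>\<infinity>k\<in>K. H k (z(i := w))) holomorphic_on ball x d" using d by blast
      qed
    qed
  qed
qed

text \<open>The coefficient bound is part of the notion because it is what dominates the series once
  other functions are substituted for the variables.\<close>

definition has_power_series :: "nat set \<Rightarrow> real \<Rightarrow> ((nat \<Rightarrow> nat) \<Rightarrow> real) \<Rightarrow> ((nat \<Rightarrow> real) \<Rightarrow> real) \<Rightarrow> bool" where
  "has_power_series X r c u \<longleftrightarrow> (\<exists>M\<ge>0. \<forall>k. \<bar>c k\<bar> \<le> M * (\<Prod>i\<in>X. (1 / r) ^ k i)) \<and>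
     (\<forall>y. (\<forall>i\<in>X. \<bar>y i\<bar> < r) \<longrightarrow> ((\<lambda>k. (\<Prod>i\<in>X. y i ^ k i) * c k) has_sum u y) (X \<rightarrow>\<^sub>E UNIV))"

text \<open>Osgood's theorem with all parameters outside \<open>X\<close> set to 0, which
  \<open>local\<close> permits. The real parts of the coefficients suffice, because monomials and
  values are real at real points.\<close>

lemma hol_ext_imp_power_series:
  assumes X: "finite X" and u: "hol_ext X u" and local: "\<And>y. u y = u (\<lambda>i. if i \<in> X then y i else 0)"
  obtains r c where "r > 0" "has_power_series X r c u"
proof -
  obtain \<rho> M where \<rho>: "\<rho> > 0" and M: "hol_ext_at X \<rho> M u" using u by (auto simp: hol_ext_def)
  obtain H where H: "sep_holomorphic X \<rho> H" "\<And>z. z \<in> polydisc X \<rho> \<Longrightarrow> norm (H z) \<le> M"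
     "\<And>y. (\<forall>i\<in>X. \<bar>y i\<bar> < \<rho>) \<Longrightarrow> H (\<lambda>i. of_real (y i)) = of_real (u y)"
    using M unfolding hol_ext_at_def by blast
  have bd: "norm (H z) < \<bar>M\<bar> + 1" if "z \<in> polydisc X \<rho>" for z using H(2) [OF that] by linarith
  obtain c where c: "\<And>k. norm (c k) \<le> (\<bar>M\<bar> + 1) * (\<Prod>i\<in>X. (3 / \<rho>) ^ k i)"
    "\<And>z. z \<in> polydisc X (\<rho> / 3) \<Longrightarrow> \<forall>i. i \<notin> X \<longrightarrow> z i = 0 \<Longrightarrow>
       ((\<lambda>k. (\<Prod>i\<in>X. z i ^ k i) * c k) has_sum H z) (X \<rightarrow>\<^sub>E UNIV)"
    using osgood [OF X \<rho> H(1) bd, of "\<lambda>_. 0"] by blast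
  show thesis
  proof (rule that [of "\<rho> / 3" "\<lambda>k. Re (c k)"])
    show "has_power_series X (\<rho> / 3) (\<lambda>k. Re (c k)) u"
      unfolding has_power_series_def
    proof (intro conjI allI impI exI [of _ "\<bar>M\<bar> + 1"])
      show "\<bar>Re (c k)\<bar> \<le> (\<bar>M\<bar> + 1) * (\<Prod>i\<in>X. (1 / (\<rho> / 3)) ^ k i)" for k
        using abs_Re_le_cmod [of "c k"] c(1) [of k] by simp
      fix y :: "nat \<Rightarrow> real" assume y: "\<forall>i\<in>X. \<bar>y i\<bar> < \<rho> / 3"
      define y' where "y' = (\<lambda>i. if i \<in> X then y i else 0)"
      have y': "\<forall>i\<in>X. \<bar>y' i\<bar> < \<rho>" "u y' = u y" using y \<rho> local [of y] by (auto simp: y'_def)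
      have "((\<lambda>k. (\<Prod>i\<in>X. complex_of_real (y' i) ^ k i) * c k) has_sum H (\<lambda>i. of_real (y' i))) (X \<rightarrow>\<^sub>E UNIV)"
        by (rule c(2)) (use y in \<open>auto simp: y'_def polydisc_def\<close>)
      then have "((\<lambda>k. Re ((\<Prod>i\<in>X. complex_of_real (y' i) ^ k i) * c k)) has_sum u y) (X \<rightarrow>\<^sub>E UNIV)"
        unfolding H(3) [OF y'(1)] y'(2) using has_sum_Re by fastforce
      moreover have "Re ((\<Prod>i\<in>X. complex_of_real (y' i) ^ k i) * c k) = (\<Prod>i\<in>X. y i ^ k i) * Re (c k)" for k
      proof -
        have "(\<Prod>i\<in>X. complex_of_real (y' i) ^ k i) = of_real (\<Prod>i\<in>X. y i ^ k i)"
          by (simp add: y'_def)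
        then show ?thesis by (simp del: of_real_prod of_real_power)
      qed
      ultimately show "((\<lambda>k. (\<Prod>i\<in>X. y i ^ k i) * Re (c k)) has_sum u y) (X \<rightarrow>\<^sub>E UNIV)" by simp
    qed auto
  qed (use \<rho> in auto)
qed

text \<open>Averaging the series with its reflection in the variable i cancels the coefficients of
  wrong parity and leaves a series for the same function. The coefficients are replaced rather than
  shown to vanish.\<close>

lemma power_series_parity:
  assumes X: "finite X" and Z: "finite Z" "Z \<subseteq> X" and c: "has_power_series X r c u"
    and par: "\<And>i y. i \<in> Z \<Longrightarrow> \<forall>j\<in>X. \<bar>y j\<bar> < r \<Longrightarrow> u (y(i := - y i)) = (- 1) ^ \<kappa> i * u y"
  shows "\<exists>c'. has_power_series X r c' u \<and> (\<forall>k. \<forall>i\<in>Z. odd (k i + \<kappa> i) \<longrightarrow> c' k = 0)"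
  using Z par
proof (induction Z rule: finite_induct)
  case empty
  then show ?case using c by auto
next
  case (insert i Z)
  then obtain c' where c': "has_power_series X r c' u" "\<forall>k. \<forall>i\<in>Z. odd (k i + \<kappa> i) \<longrightarrow> c' k = 0"
    by auto
  obtain M where M: "M \<ge> 0" "\<And>k. \<bar>c' k\<bar> \<le> M * (\<Prod>i\<in>X. (1 / r) ^ k i)"
    and s: "\<And>y. (\<forall>i\<in>X. \<bar>y i\<bar> < r) \<Longrightarrow> ((\<lambda>k. (\<Prod>i\<in>X. y i ^ k i) * c' k) has_sum u y) (X \<rightarrow>\<^sub>E UNIV)"
    using c'(1) unfolding has_power_series_def by blast
  define d where "d k = (if odd (k i + \<kappa> i) then 0 else c' k)" for k
  have "has_power_series X r d u"
    unfolding has_power_series_def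
  proof (intro conjI allI impI exI [of _ M])
    show "\<bar>d k\<bar> \<le> M * (\<Prod>i\<in>X. (1 / r) ^ k i)" for k
      using M(2) [of k] by (auto simp: d_def)
    fix y :: "nat \<Rightarrow> real" assume y: "\<forall>j\<in>X. \<bar>y j\<bar> < r"
    define y' where "y' = y(i := - y i)"
    have iX: "i \<in> X" using insert.prems by auto
    have 1: "((\<lambda>k. (\<Prod>i\<in>X. y i ^ k i) * c' k) has_sum u y) (X \<rightarrow>\<^sub>E UNIV)" by (rule s [OF y])
    have 2: "((\<lambda>k. (- 1) ^ \<kappa> i * ((\<Prod>i\<in>X. y' i ^ k i) * c' k)) has_sum (- 1) ^ \<kappa> i * u y') (X \<rightarrow>\<^sub>E UNIV)"
      by (intro has_sum_cmult_right s) (use y in \<open>auto simp: y'_def\<close>)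
    have e: "u y' = (- 1) ^ \<kappa> i * u y" unfolding y'_def by (rule insert.prems(2) [OF _ y]) simp
    have "(- 1) ^ \<kappa> i * u y' = u y" by (cases "even (\<kappa> i)") (auto simp: e)
    with has_sum_cmult_right [OF has_sum_add [OF 1 2], of "1 / 2"]
    have "((\<lambda>k. 1 / 2 * ((\<Prod>i\<in>X. y i ^ k i) * c' k + (- 1) ^ \<kappa> i * ((\<Prod>i\<in>X. y' i ^ k i) * c' k))) has_sum u y) (X \<rightarrow>\<^sub>E UNIV)"
      by simp
    moreover have "1 / 2 * ((\<Prod>i\<in>X. y i ^ k i) * c' k + (- 1) ^ \<kappa> i * ((\<Prod>i\<in>X. y' i ^ k i) * c' k)) = (\<Prod>i\<in>X. y i ^ k i) * d k" for k
    proof -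
      have "(\<Prod>j\<in>X. y' j ^ k j) = (- y i) ^ k i * (\<Prod>j\<in>X - {i}. y j ^ k j)"
        by (subst prod.remove [OF X iX]) (auto simp: y'_def intro!: arg_cong2 [of _ _ _ _ "(*)"] prod.cong)
      moreover have "(\<Prod>j\<in>X. y j ^ k j) = y i ^ k i * (\<Prod>j\<in>X - {i}. y j ^ k j)"
        by (rule prod.remove [OF X iX])
      moreover have "(- y i) ^ k i = (- 1) ^ k i * y i ^ k i" by (rule power_minus)
      ultimately show ?thesis
        by (auto simp: d_def minus_one_power_iff)
    qed
    ultimately show "((\<lambda>k. (\<Prod>i\<in>X. y i ^ k i) * d k) has_sum u y) (X \<rightarrow>\<^sub>E UNIV)" by simp
  qed (use M in auto)
  moreover have "\<forall>k. \<forall>j\<in>insert i Z. odd (k j + \<kappa> j) \<longrightarrow> d k = 0" using c'(2) by (auto simp: d_def)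
  ultimately show ?case by blast
qed

text \<open>In the variables of \<open>Z\<close> the function \<open>u\<close> is even or odd, so that after division by \<open>\<beta> i\<close> in the
  odd case it depends on \<open>\<beta> i\<^sup>2\<close> only, which is analytic although \<open>\<beta> i\<close> itself is not.\<close>

lemma hol_ext_substitution:
  assumes X': "finite X'" and Z: "Z \<subseteq> X'" and u: "hol_ext X' u"
    and local: "\<And>y. u y = u (\<lambda>i. if i \<in> X' then y i else 0)"
    and par: "\<And>i y. i \<in> Z \<Longrightarrow> u (y(i := - y i)) = (- 1) ^ \<kappa> i * u y" and \<kappa>: "\<And>i. \<kappa> i \<le> 1"
    and g: "\<And>i. i \<in> X' - Z \<Longrightarrow> small_ext X (\<lambda>y. \<gamma> y i)"
    and s: "\<And>i. i \<in> Z \<Longrightarrow> small_ext X (\<lambda>y. (\<gamma> y i)\<^sup>2)"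
  obtains \<Phi> \<rho> where "hol_ext X \<Phi>" "\<rho> > 0"
    "\<And>y. \<forall>i\<in>X. \<bar>y i\<bar> < \<rho> \<Longrightarrow> u (\<gamma> y) = (\<Prod>i\<in>Z. \<gamma> y i ^ \<kappa> i) * \<Phi> y"
proof -
  obtain r c where r: "r > 0" and c: "has_power_series X' r c u"
    using hol_ext_imp_power_series [OF X' u local] by blast
  have Zfin: "finite Z" using Z X' by (rule finite_subset)
  obtain c' where c': "has_power_series X' r c' u" and par': "\<And>k i. i \<in> Z \<Longrightarrow> odd (k i + \<kappa> i) \<Longrightarrow> c' k = 0"
    using power_series_parity [OF X' Zfin Z c, of \<kappa>] par by blast
  obtain M where M: "M \<ge> 0" "\<And>k. \<bar>c' k\<bar> \<le> M * (\<Prod>i\<in>X'. (1 / r) ^ k i)"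
    and ser: "\<And>y. (\<forall>i\<in>X'. \<bar>y i\<bar> < r) \<Longrightarrow> ((\<lambda>k. (\<Prod>i\<in>X'. y i ^ k i) * c' k) has_sum u y) (X' \<rightarrow>\<^sub>E UNIV)"
    using c' unfolding has_power_series_def by blast
  \<comment> \<open>The series is rewritten in the functions \<open>h i\<close>, with \<gamma>
    squared for i in \<open>Z\<close>; \<epsilon> i is the matching bound and amounts to |\<gamma> y
    i| \<le> r/2.\<close>
  define h where "h i y = (if i \<in> Z then (\<gamma> y i)\<^sup>2 else \<gamma> y i)" for i y
  define \<epsilon> where "\<epsilon> i = (if i \<in> Z then (r / 2)\<^sup>2 else r / 2)" for i
  have "\<exists>\<rho>>0. \<rho> \<le> 1 \<and> (\<forall>i\<in>X'. hol_ext_at X \<rho> (\<epsilon> i) (h i))"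
  proof (rule small_ext_uniform [OF X'])
    show "small_ext X (h i)" if "i \<in> X'" for i using that g [of i] s [of i] by (cases "i \<in> Z") (auto simp: h_def [abs_def])
  qed (use r in \<open>auto simp: \<epsilon>_def\<close>)
  then obtain \<rho> where \<rho>: "\<rho> > 0" "\<And>i. i \<in> X' \<Longrightarrow> hol_ext_at X \<rho> (\<epsilon> i) (h i)" by blast
  \<comment> \<open>For i in \<open>Z\<close>, the exponent left after \<kappa> i factors are split
    off and the rest is paired into squares. Subtraction and division are exact whenever
    \<open>c' k\<close> is nonzero, by parity.\<close>
  define ex where "ex k i = (if i \<in> Z then (k i - \<kappa> i) div 2 else k i)" for k :: "nat \<Rightarrow> nat" and i
  define q where "q k y = c' k * (\<Prod>i\<in>X'. h i y ^ ex k i)" for k y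
  \<comment> \<open>Compensates, uniformly in k, for the factors r/2 that are lost with the
    split-off powers.\<close>
  define A where "A = (\<Prod>i\<in>X'. if i \<in> Z then (2 / r) ^ \<kappa> i else 1)"
  have q: "hol_ext_at X \<rho> (M * A * (\<Prod>i\<in>X'. (1 / 2) ^ k i)) (q k)" for k
  proof (cases "\<exists>i\<in>Z. odd (k i + \<kappa> i)")
    case True
    then have "c' k = 0" using par' by blast
    then show ?thesis
      using M r unfolding q_def [abs_def] A_def
      by (auto intro!: hol_ext_at_const mult_nonneg_nonneg prod_nonneg)
  next
    case False
    have 1: "hol_ext_at X \<rho> (\<bar>c' k\<bar> * (\<Prod>i\<in>X'. \<epsilon> i ^ ex k i)) (q k)"
      unfolding q_def [abs_def]
      by (intro hol_ext_at_mult hol_ext_at_const order_refl hol_ext_at_prod X' hol_ext_at_power \<rho>)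
    have 2: "\<epsilon> i ^ ex k i = (r / 2) ^ k i * (if i \<in> Z then (2 / r) ^ \<kappa> i else 1)" for i
    proof (cases "i \<in> Z")
      case True
      have ev: "even (k i + \<kappa> i)" using False True by blast
      have "\<kappa> i = 0 \<or> \<kappa> i = 1" using \<kappa> [of i] by auto
      then have le: "\<kappa> i \<le> k i" using ev by (cases "k i") auto
      then have "2 * ((k i - \<kappa> i) div 2) = k i - \<kappa> i" using ev by auto
      then have "\<epsilon> i ^ ex k i = (r / 2) ^ (k i - \<kappa> i)"
        using True by (simp add: \<epsilon>_def ex_def flip: power_mult)
      also have "\<dots> = (r / 2) ^ k i * (2 / r) ^ \<kappa> i"
        using le r by (simp add: power_diff power_divide field_simps)
      finally show ?thesis using True by simp
    qed (simp add: \<epsilon>_def ex_def)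
    have "\<bar>c' k\<bar> * (\<Prod>i\<in>X'. \<epsilon> i ^ ex k i) \<le> M * (\<Prod>i\<in>X'. (1 / r) ^ k i) * (\<Prod>i\<in>X'. \<epsilon> i ^ ex k i)"
      using r by (intro mult_right_mono M prod_nonneg) (auto simp: \<epsilon>_def)
    also have "\<dots> = M * A * (\<Prod>i\<in>X'. (1 / r) ^ k i * (r / 2) ^ k i)"
      by (simp add: 2 A_def prod.distrib mult_ac)
    also have "(\<Prod>i\<in>X'. (1 / r) ^ k i * (r / 2) ^ k i) = (\<Prod>i\<in>X'. (1 / 2) ^ k i)"
      using r by (intro prod.cong refl) (simp flip: power_mult_distrib)
    finally show ?thesis by (rule hol_ext_at_mono [OF 1 order_refl])
  qed
  have summ: "(\<lambda>k. M * A * (\<Prod>i\<in>X'. (1 / 2) ^ k i)) summable_on (X' \<rightarrow>\<^sub>E (UNIV :: nat set))"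
    by (intro summable_on_cmult_right summable_on_geometric_PiE X') auto
  define \<Phi> where "\<Phi> y = (\<Sum>\<^sub>\<infinity>k\<in>X' \<rightarrow>\<^sub>E UNIV. q k y)" for y
  have qs: "((\<lambda>k. q k y) has_sum \<Phi> y) (X' \<rightarrow>\<^sub>E UNIV)" if y: "\<forall>i\<in>X. \<bar>y i\<bar> < \<rho>" for y
    unfolding \<Phi>_def
  proof (rule has_sum_infsum, rule abs_summable_summable, rule summable_on_comparison_test [OF summ])
    show "norm (q k y) \<le> M * A * (\<Prod>i\<in>X'. (1 / 2) ^ k i)" for k
      using hol_ext_at_real_bound [OF q y] by simp
  qed simp
  have "hol_ext_at X \<rho> (infsum (\<lambda>k. M * A * (\<Prod>i\<in>X'. (1 / 2) ^ k i)) (X' \<rightarrow>\<^sub>E (UNIV :: nat set))) \<Phi>"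
    by (rule hol_ext_at_infsum [OF q summ qs])
  then have ext: "hol_ext X \<Phi>" using \<rho> unfolding hol_ext_def by blast
  show thesis
  proof (rule that [OF ext \<rho>(1)])
    fix y :: "nat \<Rightarrow> real" assume y: "\<forall>i\<in>X. \<bar>y i\<bar> < \<rho>"
    have small: "\<bar>\<gamma> y i\<bar> < r" if i: "i \<in> X'" for i
    proof -
      have "\<bar>h i y\<bar> \<le> \<epsilon> i" by (rule hol_ext_at_real_bound [OF \<rho>(2) [OF i] y])
      then have "\<bar>\<gamma> y i\<bar> \<le> r / 2"
        using r abs_le_square_iff [of "\<gamma> y i" "r / 2"] by (auto simp: h_def \<epsilon>_def split: if_splits)
      then show ?thesis using r by simp
    qed
    have "((\<lambda>k. (\<Prod>i\<in>Z. \<gamma> y i ^ \<kappa> i) * q k y) has_sum (\<Prod>i\<in>Z. \<gamma> y i ^ \<kappa> i) * \<Phi> y) (X' \<rightarrow>\<^sub>E UNIV)"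
      by (rule has_sum_cmult_right [OF qs [OF y]])
    moreover have "(\<Prod>i\<in>Z. \<gamma> y i ^ \<kappa> i) * q k y = (\<Prod>i\<in>X'. \<gamma> y i ^ k i) * c' k" for k
    proof (cases "c' k = 0")
      case False
      have eq: "h i y ^ ex k i * (if i \<in> Z then \<gamma> y i ^ \<kappa> i else 1) = \<gamma> y i ^ k i" for i
      proof (cases "i \<in> Z")
        case True
        have ev: "even (k i + \<kappa> i)" using False True par' by blast
        have "\<kappa> i = 0 \<or> \<kappa> i = 1" using \<kappa> [of i] by auto
        then have le: "\<kappa> i \<le> k i" using ev by (cases "k i") auto
        then have "\<kappa> i + 2 * ((k i - \<kappa> i) div 2) = k i" using ev by auto
        then show ?thesis using True by (simp add: h_def ex_def add.commute flip: power_mult power_add)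
      qed (simp add: h_def ex_def)
      have "(\<Prod>i\<in>Z. \<gamma> y i ^ \<kappa> i) = (\<Prod>i\<in>X'. if i \<in> Z then \<gamma> y i ^ \<kappa> i else 1)"
        using Z X' by (simp add: prod.If_cases Int_absorb1)
      then show ?thesis by (simp add: q_def mult_ac eq flip: prod.distrib)
    qed (simp add: q_def)
    ultimately have "((\<lambda>k. (\<Prod>i\<in>X'. \<gamma> y i ^ k i) * c' k) has_sum (\<Prod>i\<in>Z. \<gamma> y i ^ \<kappa> i) * \<Phi> y) (X' \<rightarrow>\<^sub>E UNIV)"
      by simp
    then show "u (\<gamma> y) = (\<Prod>i\<in>Z. \<gamma> y i ^ \<kappa> i) * \<Phi> y"
      using ser [of "\<gamma> y"] small by (auto intro: has_sum_unique)
  qed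
qed

section \<open>Ordered products of imaginary units\<close>

lemma sum_Pow_insert:
  fixes g :: "'i set \<Rightarrow> 'b::comm_monoid_add"
  assumes "finite A" "a \<notin> A"
  shows "(\<Sum>K\<in>Pow (insert a A). g K) = (\<Sum>K\<in>Pow A. g K + g (insert a K))"
proof -
  have "inj_on (insert a) (Pow A)" using assms(2) by (auto simp: inj_on_def)
  moreover have "Pow A \<inter> insert a ` Pow A = {}" using assms(2) by auto
  ultimately show ?thesis
    using assms by (simp add: Pow_insert sum.union_disjoint sum.reindex sum.distrib)
qed

lemma sorted_list_of_set_insert_max:
  fixes m :: "'i::linorder"
  assumes "finite K" "\<And>k. k \<in> K \<Longrightarrow> k < m"
  shows "sorted_list_of_set (insert m K) = sorted_list_of_set K @ [m]"
proof -
  have "m \<notin> K" using assms(2) by blast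
  then have "sorted_list_of_set (insert m K) = insort m (sorted_list_of_set K)"
    using assms(1) by simp
  also have "\<dots> = sorted_list_of_set K @ [m]"
    by (rule sorted_insort_is_snoc) (use assms in \<open>auto simp: less_imp_le\<close>)
  finally show ?thesis .
qed

lemma ordered_prod_insert_max:
  assumes "finite K" "\<And>k. k \<in> K \<Longrightarrow> k < m"
  shows "ordered_prod J (insert m K) = ordered_prod J K * J m"
  by (simp add: ordered_prod_def sorted_list_of_set_insert_max [OF assms])

lemma ordered_prod_empty [simp]: "ordered_prod J {} = 1"
  by (simp add: ordered_prod_def)

text \<open>For units with square -1 the inverse of J k is - J k. Reversing the order gives an
  inverse of the ordered product that obeys a recursion, unlike the description in
  \<open>mult_inverse\<close>.\<close>

definition ordered_inv :: "(nat \<Rightarrow> 'a::ring_1) \<Rightarrow> nat set \<Rightarrow> 'a" where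
  "ordered_inv J K = prod_list (map (\<lambda>k. - J k) (rev (sorted_list_of_set K)))"

lemma ordered_inv_insert_max:
  assumes "finite K" "\<And>k. k \<in> K \<Longrightarrow> k < m"
  shows "ordered_inv J (insert m K) = - J m * ordered_inv J K"
  by (simp add: ordered_inv_def sorted_list_of_set_insert_max [OF assms])

lemma ordered_inv_empty [simp]: "ordered_inv J {} = 1"
  by (simp add: ordered_inv_def)

lemma ordered_prod_inverse:
  fixes J :: "nat \<Rightarrow> 'a::ring_1"
  assumes "finite K" "\<And>k. k \<in> K \<Longrightarrow> J k * J k = -1"
  shows "ordered_prod J K * ordered_inv J K = 1 \<and> ordered_inv J K * ordered_prod J K = 1"
  using assms
proof (induction K rule: finite_linorder_max_induct)
  case empty
  show ?case by simp
next
  case (insert m K)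
  have "ordered_prod J (insert m K) * ordered_inv J (insert m K) =
      ordered_prod J K * (- (J m * J m)) * ordered_inv J K"
    using insert.hyps by (simp add: ordered_prod_insert_max ordered_inv_insert_max mult.assoc)
  moreover have "ordered_inv J (insert m K) * ordered_prod J (insert m K) =
      - (J m * (ordered_inv J K * ordered_prod J K) * J m)"
    using insert.hyps by (simp add: ordered_prod_insert_max ordered_inv_insert_max mult.assoc)
  ultimately show ?case using insert by simp
qed

lemma mult_inverse_ordered_prod:
  fixes J :: "nat \<Rightarrow> 'a::ring_1"
  assumes K: "finite K" "\<And>k. k \<in> K \<Longrightarrow> J k * J k = -1"
  shows "mult_inverse (ordered_prod J K) = ordered_inv J K"
proof -
  have inv: "ordered_prod J K * ordered_inv J K = 1 \<and> ordered_inv J K * ordered_prod J K = 1"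
    using K by (rule ordered_prod_inverse)
  show ?thesis
    unfolding mult_inverse_def
  proof (rule the_equality)
    show "ordered_prod J K * ordered_inv J K = 1 \<and> ordered_inv J K * ordered_prod J K = 1" by (rule inv)
    fix y assume "ordered_prod J K * y = 1 \<and> y * ordered_prod J K = 1"
    then have "ordered_inv J K * (ordered_prod J K * y) = ordered_inv J K" by simp
    then show "y = ordered_inv J K" using inv by (simp add: mult.assoc [symmetric])
  qed
qed

lemma ordered_inv_commute:
  fixes J :: "nat \<Rightarrow> 'a::ring_1"
  assumes "finite K" "\<And>k. k \<in> K \<Longrightarrow> J k * x = x * J k"
  shows "ordered_inv J K * x = x * ordered_inv J K"
  using assms
proof (induction K rule: finite_linorder_max_induct)
  case (insert m K)
  then have "ordered_inv J K * x = x * ordered_inv J K" "J m * x = x * J m" by auto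
  then show ?case
    using insert.hyps by (simp add: ordered_inv_insert_max mult.assoc) (simp add: mult.assoc [symmetric])
qed simp

section \<open>Sign changes and the exchange of units\<close>

lemma reflect_empty [simp]: "reflect {} \<beta> = \<beta>"
  by (simp add: reflect_def)

lemma reflect_insert: "h \<notin> H \<Longrightarrow> reflect {h} (reflect H \<beta>) = reflect (insert h H) \<beta>"
  "h \<notin> H \<Longrightarrow> reflect H (reflect {h} \<beta>) = reflect (insert h H) \<beta>"
  "h \<notin> H \<Longrightarrow> reflect (insert h H) (reflect {h} \<beta>) = reflect H \<beta>"
  by (auto simp: reflect_def)

lemma torus_comb_reflect: "torus_comb \<tau> (reflect H \<beta>) I = torus_comb \<tau> \<beta> (\<lambda>h. if h \<in> H then - I h else I h)"
  unfolding torus_comb_def reflect_def by (rule sum.cong) auto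

text \<open>Exchanging the units one at a time: \<open>step\<close> is the representation formula in one variable.\<close>

lemma representation_formula_aux:
  fixes f :: "'a::real_algebra_1 \<Rightarrow> 'a" and I J :: "nat \<Rightarrow> 'a"
  assumes step: "\<And>\<beta> J h. (\<alpha>, \<beta>) \<in> D \<Longrightarrow> J \<in> T \<Longrightarrow> h \<in> {1..\<tau>} \<Longrightarrow>
      f (\<alpha> + torus_comb \<tau> \<beta> J) =
        (1 / 2) *\<^sub>R ((1 - J h * I h) * f (\<alpha> + torus_comb \<tau> \<beta> (J(h := I h)))
          + (1 + J h * I h) * f (\<alpha> + torus_comb \<tau> (reflect {h} \<beta>) (J(h := I h))))"
    and T: "\<And>J h. J \<in> T \<Longrightarrow> h \<in> {1..\<tau>} \<Longrightarrow> J(h := I h) \<in> T"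
    and D: "\<And>\<beta> h. (\<alpha>, \<beta>) \<in> D \<Longrightarrow> h \<in> {1..\<tau>} \<Longrightarrow> (\<alpha>, reflect {h} \<beta>) \<in> D"
    and anti: "\<And>h k. h \<in> {1..\<tau>} \<Longrightarrow> k \<in> {1..\<tau>} \<Longrightarrow> h \<noteq> k \<Longrightarrow> I k * I h = - (I h * I k) \<and> I k * J h = - (J h * I k)"
    and \<beta>: "(\<alpha>, \<beta>) \<in> D" and J: "J \<in> T" and m: "m \<le> \<tau>"
  defines "Jm \<equiv> \<lambda>m h. if h \<in> {1..m} then I h else J h"
  shows "f (\<alpha> + torus_comb \<tau> \<beta> J) = (\<Sum>K\<in>Pow {1..m}. \<Sum>H\<in>Pow {1..m}.
     ((1 / 2 ^ m) * (- 1) ^ card (K \<inter> H)) *\<^sub>R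
        (ordered_prod J K * ordered_inv I K * f (\<alpha> + torus_comb \<tau> (reflect H \<beta>) (Jm m)))) \<and> Jm m \<in> T
     \<and> (\<forall>H\<subseteq>{1..m}. (\<alpha>, reflect H \<beta>) \<in> D)"
  using m
proof (induction m)
  case 0
  have "Jm 0 = J" by (auto simp: Jm_def fun_eq_iff)
  then show ?case using \<beta> J by simp
next
  case (Suc m)
  let ?h = "Suc m"
  have h: "?h \<in> {1..\<tau>}" using Suc.prems by simp
  have IH: "f (\<alpha> + torus_comb \<tau> \<beta> J) = (\<Sum>K\<in>Pow {1..m}. \<Sum>H\<in>Pow {1..m}.
     ((1 / 2 ^ m) * (- 1) ^ card (K \<inter> H)) *\<^sub>R
        (ordered_prod J K * ordered_inv I K * f (\<alpha> + torus_comb \<tau> (reflect H \<beta>) (Jm m))))"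
    and JT: "Jm m \<in> T" and DH: "\<And>H. H \<subseteq> {1..m} \<Longrightarrow> (\<alpha>, reflect H \<beta>) \<in> D"
    using Suc by auto
  have eqI: "{1..Suc m} = insert ?h {1..m}" by auto
  have upd: "(Jm m)(?h := I ?h) = Jm (Suc m)" by (auto simp: Jm_def fun_eq_iff)
  have Jh: "Jm m ?h = J ?h" by (simp add: Jm_def)
  have JT': "Jm (Suc m) \<in> T" using T [OF JT h] by (simp add: upd)
  have DH': "(\<alpha>, reflect H \<beta>) \<in> D" if "H \<subseteq> {1..Suc m}" for H
  proof (cases "?h \<in> H")
    case True
    have "(\<alpha>, reflect {?h} (reflect (H - {?h}) \<beta>)) \<in> D"
      by (rule D [OF DH h]) (use that in auto)
    then show ?thesis using True by (simp add: reflect_insert insert_absorb)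
  next
    case False
    have "H \<subseteq> {1..m}" using that False by (auto simp: le_Suc_eq)
    then show ?thesis by (rule DH)
  qed
  define x where "x = J ?h * I ?h"
  define F where "F H = f (\<alpha> + torus_comb \<tau> (reflect H \<beta>) (Jm (Suc m)))" for H
  define P where "P K = ordered_prod J K * ordered_inv I K" for K
  have st: "f (\<alpha> + torus_comb \<tau> (reflect H \<beta>) (Jm m)) = (1 / 2) *\<^sub>R ((1 - x) * F H + (1 + x) * F (insert ?h H))"
    if "H \<subseteq> {1..m}" for H
  proof -
    have "?h \<notin> H" using that by auto
    then show ?thesis using step [OF DH [OF that] JT h] by (simp add: upd Jh x_def F_def reflect_insert)
  qed
  \<comment> \<open>The new factors J_h and -I_h land in the middle, just before
    \<open>ordered_inv I K\<close>. Every I_k anticommutes with both J_h and I_h, so it commutes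
    with their product x, which can be moved to the right end.\<close>
  have Pins: "P (insert ?h K) = - (P K * x)" if "K \<subseteq> {1..m}" for K
  proof -
    have fin: "finite K" and lt: "\<And>k. k \<in> K \<Longrightarrow> k < ?h" using that finite_subset by (auto simp: less_Suc_eq_le)
    have "ordered_inv I K * x = x * ordered_inv I K"
    proof (rule ordered_inv_commute [OF fin])
      fix k assume "k \<in> K"
      then have k: "k \<in> {1..\<tau>}" "k \<noteq> ?h" using that Suc.prems by auto
      have a: "I k * I ?h = - (I ?h * I k)" "I k * J ?h = - (J ?h * I k)" using anti [OF h k(1)] k(2) by auto
      have "I k * x = (I k * J ?h) * I ?h" by (simp add: x_def mult.assoc)
      also have "\<dots> = - (J ?h * (I k * I ?h))" by (simp add: a(2) mult.assoc)
      also have "\<dots> = x * I k" by (simp add: a(1) x_def mult.assoc)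
      finally show "I k * x = x * I k" .
    qed
    moreover have "P (insert ?h K) = - (ordered_prod J K * (x * ordered_inv I K))"
      using fin lt by (simp add: P_def ordered_prod_insert_max ordered_inv_insert_max x_def mult.assoc)
    ultimately show ?thesis by (simp add: P_def mult.assoc)
  qed
  have "f (\<alpha> + torus_comb \<tau> \<beta> J) = (\<Sum>K\<in>Pow {1..m}. \<Sum>H\<in>Pow {1..m}.
     ((1 / 2 ^ m) * (- 1) ^ card (K \<inter> H)) *\<^sub>R
        (P K * ((1 / 2) *\<^sub>R ((1 - x) * F H + (1 + x) * F (insert ?h H)))))"
    unfolding IH by (intro sum.cong refl) (simp add: st P_def)
  \<comment> \<open>(1 - x) F + (1 + x) F' = (F + F') - x (F - F'), and - P K x is P of the enlarged
    set. The two brackets become the terms without and with the new index in K, the two values those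
    without and with it in H.\<close>
  also have "\<dots> = (\<Sum>K\<in>Pow {1..m}. \<Sum>H\<in>Pow {1..m}.
     ((1 / 2 ^ Suc m) * (- 1) ^ card (K \<inter> H)) *\<^sub>R
        (P K * (F H + F (insert ?h H)) + P (insert ?h K) * (F H - F (insert ?h H))))"
    by (intro sum.cong refl) (simp add: Pins algebra_simps)
  also have "\<dots> = (\<Sum>K\<in>Pow {1..Suc m}. \<Sum>H\<in>Pow {1..Suc m}.
     ((1 / 2 ^ Suc m) * (- 1) ^ card (K \<inter> H)) *\<^sub>R (P K * F H))"
    unfolding eqI
  proof (subst sum_Pow_insert, simp, simp, rule sum.cong [OF refl], subst (1 2) sum_Pow_insert, simp, simp,
      subst sum.distrib [symmetric], rule sum.cong [OF refl])
    fix K H assume KH: "K \<in> Pow {1..m}" "H \<in> Pow {1..m}"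
    then have "?h \<notin> K" "?h \<notin> H" "finite (K \<inter> H)" by (auto intro: finite_subset)
    then have "K \<inter> insert ?h H = K \<inter> H" "insert ?h K \<inter> H = K \<inter> H"
      "card (insert ?h K \<inter> insert ?h H) = Suc (card (K \<inter> H))"
      by simp_all
    then show "((1 / 2 ^ Suc m) * (- 1) ^ card (K \<inter> H)) *\<^sub>R
        (P K * (F H + F (insert ?h H)) + P (insert ?h K) * (F H - F (insert ?h H))) =
      ((1 / 2 ^ Suc m) * (- 1) ^ card (K \<inter> H)) *\<^sub>R (P K * F H) +
      ((1 / 2 ^ Suc m) * (- 1) ^ card (K \<inter> insert ?h H)) *\<^sub>R (P K * F (insert ?h H)) +
      (((1 / 2 ^ Suc m) * (- 1) ^ card (insert ?h K \<inter> H)) *\<^sub>R (P (insert ?h K) * F H) +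
       ((1 / 2 ^ Suc m) * (- 1) ^ card (insert ?h K \<inter> insert ?h H)) *\<^sub>R (P (insert ?h K) * F (insert ?h H)))"
      by (simp add: algebra_simps)
  qed
  finally show ?case using JT' DH' by (simp add: P_def F_def)
qed

text \<open>The factor that multiplies J_K in the representation formula with reference tuple I,
  hence the candidate for the stem component of index K.\<close>

definition stem_comp :: "nat \<Rightarrow> (nat \<Rightarrow> 'a::real_algebra_1) \<Rightarrow> ('a \<Rightarrow> 'a) \<Rightarrow> nat set \<Rightarrow> 'a \<times> (nat \<Rightarrow> real) \<Rightarrow> 'a" where
  "stem_comp \<tau> I f K = (\<lambda>(\<alpha>, \<beta>). (1 / 2 ^ \<tau>) *\<^sub>R (\<Sum>H\<in>Pow {1..\<tau>}.
     (- 1) ^ card (K \<inter> H) *\<^sub>R (ordered_inv I K * f (\<alpha> + torus_comb \<tau> (reflect H \<beta>) I))))"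

text \<open>Reflecting \<beta> in h permutes the summands by adding h to H or removing it; under
  this the sign (-1)^|K \<inter> H| changes exactly when h lies in K.\<close>

lemma stem_comp_reflect:
  assumes h: "h \<in> {1..\<tau>}"
  shows "stem_comp \<tau> I f K (\<alpha>, reflect {h} \<beta>) = (if h \<in> K then - stem_comp \<tau> I f K (\<alpha>, \<beta>) else stem_comp \<tau> I f K (\<alpha>, \<beta>))"
proof -
  define A where "A = {1..\<tau>} - {h}"
  have A: "{1..\<tau>} = insert h A" "finite A" "h \<notin> A" using h by (auto simp: A_def)
  define G where "G H \<beta> = f (\<alpha> + torus_comb \<tau> (reflect H \<beta>) I)" for H \<beta>
  have card: "(- 1 :: real) ^ card (K \<inter> insert h H) = (if h \<in> K then - ((- 1) ^ card (K \<inter> H)) else (- 1) ^ card (K \<inter> H))"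
    if "H \<subseteq> A" for H
  proof -
    have "finite (K \<inter> H)" "h \<notin> H" using that A by (auto intro: finite_subset)
    then show ?thesis by (simp add: Int_insert_right)
  qed
  have "(\<Sum>H\<in>Pow {1..\<tau>}. (- 1) ^ card (K \<inter> H) *\<^sub>R (ordered_inv I K * G H (reflect {h} \<beta>))) =
    (\<Sum>H\<in>Pow A. (- 1) ^ card (K \<inter> H) *\<^sub>R (ordered_inv I K * G (insert h H) \<beta>)
      + (- 1) ^ card (K \<inter> insert h H) *\<^sub>R (ordered_inv I K * G H \<beta>))"
    unfolding A(1)
  proof (subst sum_Pow_insert [OF A(2,3)], intro sum.cong refl)
    fix H assume "H \<in> Pow A"
    then have "h \<notin> H" using A by auto
    then show "(- 1) ^ card (K \<inter> H) *\<^sub>R (ordered_inv I K * G H (reflect {h} \<beta>))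
        + (- 1) ^ card (K \<inter> insert h H) *\<^sub>R (ordered_inv I K * G (insert h H) (reflect {h} \<beta>)) =
      (- 1) ^ card (K \<inter> H) *\<^sub>R (ordered_inv I K * G (insert h H) \<beta>)
        + (- 1) ^ card (K \<inter> insert h H) *\<^sub>R (ordered_inv I K * G H \<beta>)"
      by (simp add: G_def reflect_insert(2,3))
  qed
  also have "\<dots> = (if h \<in> K then - 1 else 1) *\<^sub>R (\<Sum>H\<in>Pow A. (- 1) ^ card (K \<inter> H) *\<^sub>R (ordered_inv I K * G H \<beta>)
      + (- 1) ^ card (K \<inter> insert h H) *\<^sub>R (ordered_inv I K * G (insert h H) \<beta>))"
    unfolding scaleR_right.sum by (intro sum.cong refl) (auto simp: card)
  also have "\<dots> = (if h \<in> K then - 1 else 1) *\<^sub>R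
     (\<Sum>H\<in>Pow {1..\<tau>}. (- 1) ^ card (K \<inter> H) *\<^sub>R (ordered_inv I K * G H \<beta>))"
    unfolding A(1) using A(2,3) by (subst sum_Pow_insert) auto
  finally show ?thesis by (simp add: stem_comp_def G_def)
qed

section \<open>Slices of the domain\<close>

locale T_setting =
  fixes cj :: "'a::{real_algebra_1,euclidean_space} \<Rightarrow> 'a" and V :: "'a set" and v :: "nat \<Rightarrow> 'a"
    and n d \<tau> :: nat and t :: "nat \<Rightarrow> nat" and D :: "('a \<times> (nat \<Rightarrow> real)) set" and f :: "'a \<Rightarrow> 'a"
  assumes hyper: "hypercomplex_basis cj V v n"
    and nd: "n \<le> d"
    and ob: "ordered_basis UNIV v d"
    and steps: "list_of_steps n \<tau> t"
    and Dopen: "openin (prod_topology (top_of_set (span_range v 0 (t 0)))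
                  (product_topology (\<lambda>_. euclideanreal) {1..\<tau>})) D"
    and Drefl: "\<forall>h\<in>{1..\<tau>}. \<forall>(\<alpha>, \<beta>)\<in>D. (\<alpha>, reflect {h} \<beta>) \<in> D"
    and dom: "T_slice_domain V v d \<tau> t (T_symmetrize v d \<tau> t D)"
    and reg: "T_regular v d \<tau> t (T_symmetrize v d \<tau> t D) f"
begin

abbreviation "\<Omega> \<equiv> T_symmetrize v d \<tau> t D"
abbreviation "TT \<equiv> torus v d \<tau> t"

lemma v0: "v 0 = 1" and n1: "1 \<le> n"
  using hyper by (auto simp: hypercomplex_basis_def)

lemma vsq: "s \<in> {1..n} \<Longrightarrow> v s * v s = -1"
proof -
  assume "s \<in> {1..n}"
  then have "v s \<in> imag_units cj" using hyper by (auto simp: hypercomplex_basis_def)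
  then have "cj (v s) = - v s" "v s * cj (v s) = 1"
    by (auto simp: imag_units_def star_trace_def star_norm_def add_eq_0_iff)
  then show ?thesis by (metis add.inverse_inverse mult_minus_right)
qed

lemma vanti: "s \<in> {1..n} \<Longrightarrow> u \<in> {1..n} \<Longrightarrow> s \<noteq> u \<Longrightarrow> v s * v u = - (v u * v s)"
  using hyper unfolding hypercomplex_basis_def by blast

section \<open>Coordinates, blocks and spheres\<close>

definition coord :: "nat \<Rightarrow> 'a \<Rightarrow> real" where
  "coord i x = representation (v ` {0..d}) x (v i)"

lemma basis_facts: "inj_on v {0..d}" "independent (v ` {0..d})" "span (v ` {0..d}) = UNIV"
  using ob by (auto simp: ordered_basis_def)

lemma linear_coord: "linear (coord i)"
  unfolding coord_def
  by (rule linearI) (simp_all add: representation_add representation_scale basis_facts)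

lemma coord_v: "i \<le> d \<Longrightarrow> j \<le> d \<Longrightarrow> coord i (v j) = (if i = j then 1 else 0)"
  using basis_facts(1) unfolding coord_def
  by (auto simp: representation_basis [OF basis_facts(2)] inj_on_def)

lemma coord_sum:
  assumes "S \<subseteq> {0..d}" "i \<le> d"
  shows "coord i (\<Sum>j\<in>S. a j *\<^sub>R v j) = (if i \<in> S then a i else 0)"
proof -
  have fin: "finite S" using assms(1) by (rule finite_subset) simp
  have "coord i (\<Sum>j\<in>S. a j *\<^sub>R v j) = (\<Sum>j\<in>S. a j * coord i (v j))"
    by (simp add: linear_sum [OF linear_coord] linear_cmul [OF linear_coord])
  also have "\<dots> = (\<Sum>j\<in>S. if j = i then a j else 0)"
    using assms by (intro sum.cong refl) (auto simp: coord_v subset_iff)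
  finally show ?thesis using fin by simp
qed

lemma coord_add: "coord i (x + y) = coord i x + coord i y" and coord_scale: "coord i (r *\<^sub>R x) = r * coord i x"
  and coord_0 [simp]: "coord i 0 = 0" and coord_minus: "coord i (- x) = - coord i x"
  and coord_sum': "coord i (sum F S) = (\<Sum>s\<in>S. coord i (F s))"
  using linear_coord [of i] by (auto simp: linear_add linear_cmul linear_0 linear_neg linear_sum)

lemma mem_span_iff:
  assumes "S \<subseteq> {0..d}"
  shows "x \<in> span (v ` S) \<longleftrightarrow> x = (\<Sum>i\<in>S. coord i x *\<^sub>R v i)"
proof
  have fin: "finite S" using assms(1) by (rule finite_subset) simp
  have "span (v ` S) \<subseteq> {x. x = (\<Sum>i\<in>S. coord i x *\<^sub>R v i)}"
  proof (rule span_minimal)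
    show "v ` S \<subseteq> {x. x = (\<Sum>i\<in>S. coord i x *\<^sub>R v i)}"
    proof clarsimp
      fix j assume j: "j \<in> S"
      have "(\<Sum>i\<in>S. coord i (v j) *\<^sub>R v i) = (\<Sum>i\<in>S. if i = j then v i else 0)"
        using assms j by (intro sum.cong refl) (auto simp: coord_v subset_iff)
      then show "v j = (\<Sum>i\<in>S. coord i (v j) *\<^sub>R v i)" using fin j by simp
    qed
    show "subspace {x. x = (\<Sum>i\<in>S. coord i x *\<^sub>R v i)}"
    proof (rule subspaceI)
      fix c x assume "x \<in> {x. x = (\<Sum>i\<in>S. coord i x *\<^sub>R v i)}"
      then have eq: "x = (\<Sum>i\<in>S. coord i x *\<^sub>R v i)" by simp
      have "(\<Sum>i\<in>S. coord i (c *\<^sub>R x) *\<^sub>R v i) = c *\<^sub>R (\<Sum>i\<in>S. coord i x *\<^sub>R v i)"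
        by (simp add: coord_scale scaleR_right.sum)
      also have "\<dots> = c *\<^sub>R x" by (simp only: eq [symmetric])
      finally show "c *\<^sub>R x \<in> {x. x = (\<Sum>i\<in>S. coord i x *\<^sub>R v i)}" by simp
    qed (auto simp: coord_add scaleR_add_left sum.distrib)
  qed
  then show "x \<in> span (v ` S) \<Longrightarrow> x = (\<Sum>i\<in>S. coord i x *\<^sub>R v i)" by blast
  assume "x = (\<Sum>i\<in>S. coord i x *\<^sub>R v i)"
  moreover have "(\<Sum>i\<in>S. coord i x *\<^sub>R v i) \<in> span (v ` S)"
    by (intro span_sum span_mul span_base) auto
  ultimately show "x \<in> span (v ` S)" by simp
qed

lemma t_strict: "h < k \<Longrightarrow> k \<le> \<tau> \<Longrightarrow> t h < t k"
proof (induction k)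
  case (Suc k)
  have "t k < t (Suc k)" using steps Suc.prems by (auto simp: list_of_steps_def)
  then show ?case using Suc by (cases "h = k") (auto simp: less_Suc_eq)
qed simp

lemma t_mono: "h \<le> k \<Longrightarrow> k \<le> \<tau> \<Longrightarrow> t h \<le> t k"
  using t_strict [of h k] by (cases "h = k") auto

lemma t_tau: "t \<tau> = n" using steps by (auto simp: list_of_steps_def)

lemma t_ge: "h \<le> \<tau> \<Longrightarrow> t 0 + h \<le> t h"
proof (induction h)
  case (Suc h)
  then show ?case using t_strict [of h "Suc h"] by simp
qed simp

definition blk :: "nat \<Rightarrow> nat set" where
  "blk h = {t (h - 1) + 1..t h}"

lemma finite_blk [simp]: "finite (blk h)" by (simp add: blk_def)

lemma t0_le: "t 0 \<le> n" using t_mono [of 0 \<tau>] t_tau by simp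

lemma blk_sub: "h \<in> {1..\<tau>} \<Longrightarrow> blk h \<subseteq> {t 0 + 1..n}"
  using t_mono [of 0 "h - 1"] t_mono [of h \<tau>] t_tau by (auto simp: blk_def)

lemma blk_sub1: "h \<in> {1..\<tau>} \<Longrightarrow> blk h \<subseteq> {1..n}"
  using blk_sub by fastforce

lemma blk_subd: "h \<in> {1..\<tau>} \<Longrightarrow> blk h \<subseteq> {0..d}"
  using blk_sub nd by fastforce

lemma blk_disjoint: "h \<in> {1..\<tau>} \<Longrightarrow> k \<in> {1..\<tau>} \<Longrightarrow> h \<noteq> k \<Longrightarrow> blk h \<inter> blk k = {}"
proof (induction h k rule: linorder_wlog)
  case (le h k)
  then have "t h \<le> t (k - 1)" by (intro t_mono) auto
  then show ?case by (auto simp: blk_def)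
qed (auto simp: Int_commute)

lemma blk_cover: "{t 0 + 1..t m} = (\<Union>h\<in>{1..m}. blk h)" if "m \<le> \<tau>" for m
  using that
proof (induction m)
  case (Suc m)
  have "t 0 \<le> t m" "t m < t (Suc m)" using t_mono [of 0 m] t_strict [of m "Suc m"] Suc.prems by auto
  then have "{t 0 + 1..t (Suc m)} = {t 0 + 1..t m} \<union> blk (Suc m)" by (auto simp: blk_def)
  also have "{t 0 + 1..t m} = (\<Union>h\<in>{1..m}. blk h)" using Suc by simp
  finally show ?case by (simp add: atLeastAtMostSuc_conv Un_commute)
qed simp

definition sph :: "nat \<Rightarrow> 'a set" where
  "sph h = unit_sphere v d (t (h - 1) + 1) (t h)"

lemma torus_iff:
  "J \<in> TT \<longleftrightarrow> J \<in> extensional {1..\<tau>} \<and> (\<forall>h\<in>{1..\<tau>}. J h \<in> sph h)"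
  by (auto simp: torus_def PiE_def Pi_def sph_def)

lemma sphere_iff:
  assumes "h \<in> {1..\<tau>}"
  shows "x \<in> sph h \<longleftrightarrow>
    x = (\<Sum>i\<in>blk h. coord i x *\<^sub>R v i) \<and> (\<Sum>i\<in>blk h. (coord i x)\<^sup>2) = 1"
proof -
  have *: "basis_norm v d x = sqrt (\<Sum>i\<in>blk h. (coord i x)\<^sup>2)" if x: "x = (\<Sum>i\<in>blk h. coord i x *\<^sub>R v i)"
  proof -
    have "coord i x = 0" if "i \<in> {0..d} - blk h" for i
      by (subst x, subst coord_sum) (use that blk_subd [OF assms] in auto)
    then have "(\<Sum>i\<in>{0..d}. (coord i x)\<^sup>2) = (\<Sum>i\<in>blk h. (coord i x)\<^sup>2)"
      by (intro sum.mono_neutral_right) (use blk_subd [OF assms] in auto)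
    then show ?thesis by (simp add: basis_norm_def basis_inner_def coord_def power2_eq_square)
  qed
  show ?thesis
    unfolding sph_def unit_sphere_def span_range_def
    using * mem_span_iff [OF blk_subd [OF assms], of x] by (auto simp: blk_def)
qed

lemma sum_anticommute:
  assumes "S \<subseteq> {1..n}" "S' \<subseteq> {1..n}" "S \<inter> S' = {}"
  shows "(\<Sum>i\<in>S. a i *\<^sub>R v i) * (\<Sum>j\<in>S'. c j *\<^sub>R v j) = - ((\<Sum>j\<in>S'. c j *\<^sub>R v j) * (\<Sum>i\<in>S. a i *\<^sub>R v i))"
proof -
  have "(\<Sum>i\<in>S. a i *\<^sub>R v i) * (\<Sum>j\<in>S'. c j *\<^sub>R v j) = (\<Sum>i\<in>S. \<Sum>j\<in>S'. - ((c j *\<^sub>R v j) * (a i *\<^sub>R v i)))"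
    unfolding sum_product
  proof (intro sum.cong refl)
    fix i j assume "i \<in> S" "j \<in> S'"
    then have "v i * v j = - (v j * v i)" using assms by (intro vanti) auto
    then show "a i *\<^sub>R v i * c j *\<^sub>R v j = - (c j *\<^sub>R v j * a i *\<^sub>R v i)" by (simp add: mult.commute)
  qed
  also have "\<dots> = - ((\<Sum>j\<in>S'. c j *\<^sub>R v j) * (\<Sum>i\<in>S. a i *\<^sub>R v i))"
    unfolding sum_product by (subst sum.swap) (simp add: sum_negf)
  finally show ?thesis .
qed

text \<open>Adding the product to itself with the summation indices exchanged cancels the
  off-diagonal terms by anticommutativity.\<close>

lemma sum_square:
  assumes "S \<subseteq> {1..n}"
  shows "(\<Sum>i\<in>S. a i *\<^sub>R v i) * (\<Sum>i\<in>S. a i *\<^sub>R v i) = - ((\<Sum>i\<in>S. (a i)\<^sup>2) *\<^sub>R 1)"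
proof -
  have fin: "finite S" using assms by (rule finite_subset) simp
  let ?P = "(\<Sum>i\<in>S. a i *\<^sub>R v i) * (\<Sum>i\<in>S. a i *\<^sub>R v i)"
  have 1: "?P = (\<Sum>i\<in>S. \<Sum>j\<in>S. (a i * a j) *\<^sub>R (v i * v j))"
    unfolding sum_product by (simp add: mult.commute)
  have 2: "?P = (\<Sum>i\<in>S. \<Sum>j\<in>S. (a i * a j) *\<^sub>R (v j * v i))"
    unfolding 1 by (subst sum.swap) (simp add: mult.commute)
  have "?P + ?P = (\<Sum>i\<in>S. \<Sum>j\<in>S. (a i * a j) *\<^sub>R (v i * v j)) + (\<Sum>i\<in>S. \<Sum>j\<in>S. (a i * a j) *\<^sub>R (v j * v i))"
    by (rule arg_cong2 [where f = "(+)", OF 1 2])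
  also have "\<dots> = (\<Sum>i\<in>S. \<Sum>j\<in>S. (a i * a j) *\<^sub>R (v i * v j + v j * v i))"
    by (simp add: sum.distrib scaleR_add_right)
  also have "\<dots> = (\<Sum>i\<in>S. \<Sum>j\<in>S. if i = j then - ((2 * (a i)\<^sup>2) *\<^sub>R 1) else 0)"
  proof (intro sum.cong refl)
    fix i j assume ij: "i \<in> S" "j \<in> S"
    show "(a i * a j) *\<^sub>R (v i * v j + v j * v i) = (if i = j then - ((2 * (a i)\<^sup>2) *\<^sub>R 1) else 0)"
    proof (cases "i = j")
      case True
      have "v i * v i + v i * v i = - (2 *\<^sub>R 1)"
        using vsq [of i] ij assms by (auto simp: subset_iff scaleR_2)
      then show ?thesis using True by (simp add: power2_eq_square mult_ac)
    next
      case False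
      then show ?thesis using vanti [of i j] ij assms by (auto simp: subset_iff)
    qed
  qed
  also have "\<dots> = - ((2 * (\<Sum>i\<in>S. (a i)\<^sup>2)) *\<^sub>R 1)"
    using fin by (simp add: sum_negf sum_distrib_left scaleR_left.sum)
  finally have "2 *\<^sub>R ?P = 2 *\<^sub>R (- ((\<Sum>i\<in>S. (a i)\<^sup>2) *\<^sub>R 1))" by (simp add: scaleR_2 scaleR_left_distrib)
  then show ?thesis by (simp only: scaleR_cancel_left) simp
qed

lemma torusD:
  assumes "J \<in> TT" "h \<in> {1..\<tau>}"
  shows "J h = (\<Sum>i\<in>blk h. coord i (J h) *\<^sub>R v i)" "(\<Sum>i\<in>blk h. (coord i (J h))\<^sup>2) = 1"
  using assms sphere_iff by (auto simp: torus_iff)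

lemma torus_sq: "J \<in> TT \<Longrightarrow> h \<in> {1..\<tau>} \<Longrightarrow> J h * J h = -1"
  using sum_square [OF blk_sub1, of h "\<lambda>i. coord i (J h)"] torusD [of J h] by simp

lemma torus_anti:
  assumes "I \<in> TT" "J \<in> TT" "h \<in> {1..\<tau>}" "k \<in> {1..\<tau>}" "h \<noteq> k"
  shows "I h * J k = - (J k * I h)"
  using sum_anticommute [OF blk_sub1 blk_sub1 blk_disjoint, of h k "\<lambda>i. coord i (I h)" "\<lambda>i. coord i (J k)"]
    torusD(1) [OF assms(1,3)] torusD(1) [OF assms(2,4)] assms by simp

lemma torus_anti_v:
  assumes "J \<in> TT" "h \<in> {1..\<tau>}" "s \<in> {1..t 0}"
  shows "v s * J h = - (J h * v s)"
proof -
  have "{s} \<inter> blk h = {}" "{s} \<subseteq> {1..n}" using blk_sub [OF assms(2)] assms(3) t0_le by fastforce+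
  then show ?thesis
    using sum_anticommute [of "{s}" "blk h" "\<lambda>_. 1" "\<lambda>i. coord i (J h)"] blk_sub1 [OF assms(2)]
      torusD(1) [OF assms(1,2)] by simp
qed

lemma torus_upd: "J \<in> TT \<Longrightarrow> h \<in> {1..\<tau>} \<Longrightarrow> x \<in> sph h \<Longrightarrow> J(h := x) \<in> TT"
  by (auto simp: torus_iff extensional_def)

lemma sphere_minus: "h \<in> {1..\<tau>} \<Longrightarrow> x \<in> sph h \<Longrightarrow> - x \<in> sph h"
  by (auto simp: sphere_iff coord_minus sum_negf)

lemma torus_component: "J \<in> TT \<Longrightarrow> h \<in> {1..\<tau>} \<Longrightarrow> J h \<in> sph h"
  by (simp add: torus_iff)

text \<open>Strictly increasing steps make every block nonempty, so each sphere contains a basis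
  vector.\<close>

lemma torus_nonempty: "TT \<noteq> {}"
proof -
  have "v (t h) \<in> sph h" if h: "h \<in> {1..\<tau>}" for h
  proof -
    have "t (h - 1) < t h" by (rule t_strict) (use h in auto)
    then have mem: "t h \<in> blk h" by (auto simp: blk_def)
    then have le: "t h \<le> d" using blk_subd [OF h] by auto
    have c: "coord i (v (t h)) = (if i = t h then 1 else 0)" if "i \<in> blk h" for i
      using that le blk_subd [OF h] by (subst coord_v) auto
    have "(\<Sum>i\<in>blk h. coord i (v (t h)) *\<^sub>R v i) = (\<Sum>i\<in>blk h. if i = t h then v i else 0)"
      by (intro sum.cong refl) (simp add: c)
    moreover have "(\<Sum>i\<in>blk h. (coord i (v (t h)))\<^sup>2) = (\<Sum>i\<in>blk h. if i = t h then 1 else 0)"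
      by (intro sum.cong refl) (simp add: c)
    ultimately show ?thesis using mem by (simp add: sphere_iff [OF h])
  qed
  then have "(\<lambda>h\<in>{1..\<tau>}. v (t h)) \<in> TT" by (simp add: torus_iff)
  then show ?thesis by blast
qed

lemma D_reflect: "(\<alpha>, \<beta>) \<in> D \<Longrightarrow> h \<in> {1..\<tau>} \<Longrightarrow> (\<alpha>, reflect {h} \<beta>) \<in> D"
  using Drefl by blast

lemma D_reflect_set: "(\<alpha>, \<beta>) \<in> D \<Longrightarrow> H \<subseteq> {1..\<tau>} \<Longrightarrow> (\<alpha>, reflect H \<beta>) \<in> D"
proof -
  assume a: "(\<alpha>, \<beta>) \<in> D" and H: "H \<subseteq> {1..\<tau>}"
  have "finite H" using H by (rule finite_subset) simp
  then show ?thesis using H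
  proof (induction H rule: finite_induct)
    case (insert h H)
    then show ?case using D_reflect [of \<alpha> "reflect H \<beta>" h] by (simp add: reflect_insert)
  qed (simp add: a)
qed

lemma D_sub: assumes "(\<alpha>, \<beta>) \<in> D" shows "\<alpha> = (\<Sum>i\<in>{0..t 0}. coord i \<alpha> *\<^sub>R v i)" "\<beta> \<in> extensional {1..\<tau>}"
proof -
  have "D \<subseteq> span_range v 0 (t 0) \<times> ({1..\<tau>} \<rightarrow>\<^sub>E UNIV)"
    using openin_subset [OF Dopen] by (simp add: topspace_product_topology)
  then have "\<alpha> \<in> span (v ` {0..t 0})" "\<beta> \<in> {1..\<tau>} \<rightarrow>\<^sub>E UNIV" using assms by (auto simp: span_range_def)
  then show "\<alpha> = (\<Sum>i\<in>{0..t 0}. coord i \<alpha> *\<^sub>R v i)" "\<beta> \<in> extensional {1..\<tau>}"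
    using mem_span_iff [of "{0..t 0}" \<alpha>] t0_le nd by (auto simp: PiE_def)
qed

lemma coord_torus_comb:
  assumes "J \<in> TT" "i \<le> d"
  shows "coord i (torus_comb \<tau> \<beta> J) = (\<Sum>h\<in>{1..\<tau>}. if i \<in> blk h then \<beta> h * coord i (J h) else 0)"
  unfolding torus_comb_def coord_sum' coord_scale
proof (intro sum.cong refl)
  fix h assume h: "h \<in> {1..\<tau>}"
  have "coord i (J h) = (if i \<in> blk h then coord i (J h) else 0)"
    by (subst torusD(1) [OF assms(1) h], subst coord_sum [OF blk_subd [OF h] assms(2)]) simp
  then show "\<beta> h * coord i (J h) = (if i \<in> blk h then \<beta> h * coord i (J h) else 0)" by (simp split: if_splits)
qed

lemma coord_torus_comb_blk:
  assumes "J \<in> TT" "h \<in> {1..\<tau>}" "i \<in> blk h"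
  shows "coord i (torus_comb \<tau> \<beta> J) = \<beta> h * coord i (J h)"
proof -
  have "coord i (torus_comb \<tau> \<beta> J) = (\<Sum>k\<in>{1..\<tau>}. if k = h then \<beta> h * coord i (J h) else 0)"
    unfolding coord_torus_comb [OF assms(1) subsetD [OF blk_subd [OF assms(2)] assms(3), unfolded atLeastAtMost_iff, THEN conjunct2]]
    using blk_disjoint [OF assms(2)] assms(3) by (intro sum.cong refl) auto
  then show ?thesis using assms(2) by simp
qed

lemma coord_torus_comb_mirror: "J \<in> TT \<Longrightarrow> i \<le> t 0 \<Longrightarrow> coord i (torus_comb \<tau> \<beta> J) = 0"
  using t0_le nd blk_sub by (subst coord_torus_comb) (fastforce intro!: sum.neutral)+

lemma coord_mirror: "i \<le> d \<Longrightarrow> coord i (\<Sum>j\<in>{0..t 0}. a j *\<^sub>R v j) = (if i \<le> t 0 then a i else 0)"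
  using t0_le nd by (subst coord_sum) auto

text \<open>The form \<alpha> + \<beta> J determines \<alpha>, through the coordinates up to
  \<open>t 0\<close>, and each \<beta>_h up to sign, as J_h has length 1 in its own block. The signs
  are absorbed by the reflection invariance of \<open>D\<close>.\<close>

lemma slice_memD:
  assumes J: "J \<in> TT" and mem: "(\<Sum>i\<in>{0..t 0}. a i *\<^sub>R v i) + torus_comb \<tau> \<beta> J \<in> \<Omega>"
  shows "(\<Sum>i\<in>{0..t 0}. a i *\<^sub>R v i, restrict \<beta> {1..\<tau>}) \<in> D"
proof -
  let ?\<alpha> = "\<Sum>i\<in>{0..t 0}. a i *\<^sub>R v i"
  obtain \<alpha>' \<beta>' J' where D: "(\<alpha>', \<beta>') \<in> D" and J': "J' \<in> TT"
    and eq: "?\<alpha> + torus_comb \<tau> \<beta> J = \<alpha>' + torus_comb \<tau> \<beta>' J'"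
    using mem by (auto simp: T_symmetrize_def)
  note \<alpha>' = D_sub(1) [OF D]
  have c: "coord i (?\<alpha> + torus_comb \<tau> \<beta> J) = coord i (\<alpha>' + torus_comb \<tau> \<beta>' J')" for i by (simp only: eq)
  have "a i = coord i \<alpha>'" if "i \<le> t 0" for i
    using c [of i] coord_mirror [of i a] that J J' t0_le nd by (simp add: coord_add coord_torus_comb_mirror)
  then have \<alpha>: "?\<alpha> = \<alpha>'" by (subst \<alpha>') (auto intro!: sum.cong)
  then have comb: "coord i (torus_comb \<tau> \<beta> J) = coord i (torus_comb \<tau> \<beta>' J')" for i
    using c [of i] by (simp add: coord_add)
  have sq: "(\<beta> h)\<^sup>2 = (\<beta>' h)\<^sup>2" if h: "h \<in> {1..\<tau>}" for h
  proof -
    have "(\<beta> h)\<^sup>2 * (\<Sum>i\<in>blk h. (coord i (J h))\<^sup>2) = (\<beta>' h)\<^sup>2 * (\<Sum>i\<in>blk h. (coord i (J' h))\<^sup>2)"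
      unfolding sum_distrib_left power_mult_distrib [symmetric]
      using comb by (intro sum.cong refl) (metis coord_torus_comb_blk J J' h)
    then show ?thesis using torusD(2) [OF J h] torusD(2) [OF J' h] by simp
  qed
  define H where "H = {h\<in>{1..\<tau>}. \<beta> h \<noteq> \<beta>' h}"
  have "restrict \<beta> {1..\<tau>} = reflect H \<beta>'"
    using sq D_sub(2) [OF D] by (auto simp: fun_eq_iff H_def reflect_def extensional_def power2_eq_iff)
  moreover have "H \<subseteq> {1..\<tau>}" by (auto simp: H_def)
  ultimately show ?thesis using D_reflect_set [OF D, of H] \<alpha> by simp
qed

end

context T_setting begin

section \<open>Common parameter set of the slices\<close>

definition N :: nat where "N = t 0 + \<tau> + 1"

text \<open>An enumeration of the orthonormal basis of the type, unrelated to v. With it the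
  coordinates are inner products, the same for every slice; \<open>Lam J\<close> carries them to the
  slice of J.\<close>

definition bb :: "nat \<Rightarrow> 'a" where
  "bb = (SOME b. bij_betw b {..<DIM('a)} Basis)"

lemma bb_bij: "bij_betw bb {..<DIM('a)} Basis"
proof -
  have "\<exists>b. bij_betw b {..<DIM('a)} (Basis :: 'a set)"
    using ex_bij_betw_nat_finite [OF finite_Basis] by (simp add: atLeast0LessThan)
  then show ?thesis unfolding bb_def by (rule someI_ex)
qed

lemma N_le: "N \<le> DIM('a)"
proof -
  have "card (v ` {0..d}) = dim (UNIV :: 'a set)"
    using basis_facts(2,3) by (metis dim_span dim_eq_card_independent)
  then have "d + 1 = DIM('a)" by (simp add: card_image [OF basis_facts(1)])
  moreover have "t 0 + \<tau> \<le> n" using t_ge [of \<tau>] t_tau by simp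
  ultimately show ?thesis using nd by (simp add: N_def)
qed

lemma bb_inj: "inj_on bb {..<N}" and bb_Basis: "bb ` {..<N} \<subseteq> Basis"
  using bb_bij N_le by (auto simp: bij_betw_def intro: inj_on_subset)

lemma bb_inner: "i < N \<Longrightarrow> j < N \<Longrightarrow> bb i \<bullet> bb j = (if i = j then 1 else 0)"
proof -
  assume "i < N" "j < N"
  then have "bb i \<in> Basis" "bb j \<in> Basis" "bb i = bb j \<longleftrightarrow> i = j"
    using bb_Basis inj_on_eq_iff [OF bb_inj] by auto
  then show ?thesis by (simp add: inner_Basis)
qed

lemma less_N_cases:
  assumes "i < N"
  obtains "i \<le> t 0" | h where "h \<in> {1..\<tau>}" "i = t 0 + h"
proof (cases "i \<le> t 0")
  case False
  then have "i - t 0 \<in> {1..\<tau>}" "i = t 0 + (i - t 0)" using assms by (auto simp: N_def)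
  then show ?thesis using that(2) by blast
qed (use that in blast)

lemma sum_N: "(\<Sum>i<N. F i) = (\<Sum>i\<in>{0..t 0}. F i) + (\<Sum>h\<in>{1..\<tau>}. F (t 0 + h))"
  for F :: "nat \<Rightarrow> 'z::comm_monoid_add"
proof -
  have "{..<N} = {0..t 0} \<union> (\<lambda>h. t 0 + h) ` {1..\<tau>}"
    by (auto elim!: less_N_cases) (auto simp: N_def)
  then have "(\<Sum>i<N. F i) = (\<Sum>i\<in>{0..t 0}. F i) + (\<Sum>i\<in>(\<lambda>h. t 0 + h) ` {1..\<tau>}. F i)"
    by (simp only:) (rule sum.union_disjoint, auto)
  moreover have "inj_on (\<lambda>h. t 0 + h) {1..\<tau>}" by (simp add: inj_on_def)
  ultimately show ?thesis by (simp only: sum.reindex o_def)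
qed

text \<open>All slices are parametrized by one open set \<open>U\<close> of the algebra. Only the first \<open>N\<close> coordinates of
  a point of \<open>U\<close> matter; the others are there because there is no type of dimension \<open>N\<close>.\<close>

definition pt :: "'a \<Rightarrow> 'a \<times> (nat \<Rightarrow> real)" where
  "pt x = (\<Sum>i\<in>{0..t 0}. (x \<bullet> bb i) *\<^sub>R v i, \<lambda>h\<in>{1..\<tau>}. x \<bullet> bb (t 0 + h))"

definition U :: "'a set" where "U = {x. pt x \<in> D}"

definition unpt :: "'a \<Rightarrow> (nat \<Rightarrow> real) \<Rightarrow> 'a" where
  "unpt \<alpha> \<beta> = (\<Sum>i\<in>{0..t 0}. coord i \<alpha> *\<^sub>R bb i) + (\<Sum>h\<in>{1..\<tau>}. \<beta> h *\<^sub>R bb (t 0 + h))"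

lemma unpt_inner:
  shows "i \<le> t 0 \<Longrightarrow> unpt \<alpha> \<beta> \<bullet> bb i = coord i \<alpha>" "h \<in> {1..\<tau>} \<Longrightarrow> unpt \<alpha> \<beta> \<bullet> bb (t 0 + h) = \<beta> h"
  by (auto simp: unpt_def inner_add_left inner_sum_left bb_inner N_def if_distrib [of "(*) _"] cong: if_cong)

lemma pt_unpt: "(\<alpha>, \<beta>) \<in> D \<Longrightarrow> pt (unpt \<alpha> \<beta>) = (\<alpha>, \<beta>)"
proof -
  assume D: "(\<alpha>, \<beta>) \<in> D"
  have "(\<Sum>i\<in>{0..t 0}. (unpt \<alpha> \<beta> \<bullet> bb i) *\<^sub>R v i) = (\<Sum>i\<in>{0..t 0}. coord i \<alpha> *\<^sub>R v i)"
    by (intro sum.cong refl) (simp add: unpt_inner)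
  also have "\<dots> = \<alpha>" using D_sub(1) [OF D] by simp
  finally show ?thesis
    using D_sub(2) [OF D] by (auto simp: pt_def unpt_inner fun_eq_iff extensional_def)
qed

lemma open_U: "open U"
proof -
  have "continuous_map euclidean (prod_topology (top_of_set (span_range v 0 (t 0)))
                  (product_topology (\<lambda>_. euclideanreal) {1..\<tau>})) pt"
    unfolding continuous_map_pairwise o_def pt_def
  proof (intro conjI)
    show "continuous_map euclidean (top_of_set (span_range v 0 (t 0))) (\<lambda>x. fst (\<Sum>i\<in>{0..t 0}. (x \<bullet> bb i) *\<^sub>R v i, \<lambda>h\<in>{1..\<tau>}. x \<bullet> bb (t 0 + h)))"
    proof -
      have "(\<Sum>i\<in>{0..t 0}. (x \<bullet> bb i) *\<^sub>R v i) \<in> span (v ` {0..t 0})" for x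
        by (intro span_sum span_mul span_base) auto
      then show ?thesis
        by (auto simp: continuous_map_in_subtopology span_range_def intro!: continuous_intros)
    qed
    show "continuous_map euclidean (product_topology (\<lambda>_. euclideanreal) {1..\<tau>}) (\<lambda>x. snd (\<Sum>i\<in>{0..t 0}. (x \<bullet> bb i) *\<^sub>R v i, \<lambda>h\<in>{1..\<tau>}. x \<bullet> bb (t 0 + h)))"
      by (auto simp: continuous_map_componentwise intro!: continuous_intros)
  qed
  from openin_continuous_map_preimage [OF this Dopen] show ?thesis
    by (simp add: U_def)
qed

definition e :: "(nat \<Rightarrow> 'a) \<Rightarrow> nat \<Rightarrow> 'a" where
  "e J i = (if i \<le> t 0 then v i else J (i - t 0))"

definition eb :: "(nat \<Rightarrow> 'a) \<Rightarrow> nat \<Rightarrow> 'a" where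
  "eb J i = (if i = 0 then 1 else - e J i)"

lemma e_0 [simp]: "e J 0 = 1" and e_t0 [simp]: "h \<in> {1..\<tau>} \<Longrightarrow> e J (t 0 + h) = J h"
  by (auto simp: e_def v0)

lemma e_sq: "J \<in> TT \<Longrightarrow> 0 < i \<Longrightarrow> i < N \<Longrightarrow> e J i * e J i = -1"
  by (erule less_N_cases) (use t0_le in \<open>auto simp: e_def vsq torus_sq\<close>)

lemma e_anti:
  assumes "J \<in> TT" "0 < i" "i < N" "0 < j" "j < N" "i \<noteq> j"
  shows "e J i * e J j = - (e J j * e J i)"
  using assms(3)
proof (cases rule: less_N_cases)
  case 1
  note i = 1
  from assms(5) show ?thesis
  proof (cases rule: less_N_cases)
    case 1
    then show ?thesis using i assms t0_le by (auto simp: e_def intro!: vanti)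
  next
    case (2 h)
    then show ?thesis using i assms torus_anti_v [of J h i] by (simp add: e_def)
  qed
next
  case (2 k)
  note i = 2
  from assms(5) show ?thesis
  proof (cases rule: less_N_cases)
    case 1
    then show ?thesis using i assms torus_anti_v [of J k j] by (simp add: e_def)
  next
    case (2 h)
    then show ?thesis using i assms torus_anti [of J J k h] by (simp add: e_def)
  qed
qed

lemma cr_system_e: "J \<in> TT \<Longrightarrow> cr_system N bb (e J) (eb J)"
proof
  fix i j assume J: "J \<in> TT" and i: "i < N" and j: "j < N"
  consider "i = 0" "j = 0" | "i = 0" "j > 0" | "i > 0" "j = 0" | "i > 0" "j > 0" "i = j" | "i > 0" "j > 0" "i \<noteq> j"
    by linarith
  then show "eb J i * e J j + eb J j * e J i = (if i = j then 2 else 0)"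
  proof cases
    case 4
    then show ?thesis using e_sq [OF J, of i] i by (simp add: eb_def)
  next
    case 5
    then show ?thesis using e_anti [OF J, of i j] i j by (simp add: eb_def)
  qed (simp_all add: eb_def)
qed (use bb_inj bb_Basis in auto)

text \<open>Basis vectors beyond the first N are sent to 0, so \<open>f\<close> composed with
  \<open>Lam J\<close> depends on N coordinates only, and the equation of the slice becomes one with
  the constant units \<open>e J\<close>.\<close>

definition Lam :: "(nat \<Rightarrow> 'a) \<Rightarrow> 'a \<Rightarrow> 'a" where
  "Lam J x = (\<Sum>i<N. (x \<bullet> bb i) *\<^sub>R e J i)"

lemma Lam_eq: "Lam J x = fst (pt x) + torus_comb \<tau> (snd (pt x)) J"
  by (auto simp: Lam_def sum_N pt_def torus_comb_def e_def intro!: arg_cong2 [of _ _ _ _ "(+)"] sum.cong)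

lemma bounded_linear_Lam: "bounded_linear (Lam J)"
  unfolding Lam_def by (rule linear_conv_bounded_linear [THEN iffD1])
    (auto intro!: linearI simp: inner_add_left scaleR_add_left sum.distrib scaleR_right.sum)

lemma Lam_bb: "i < N \<Longrightarrow> Lam J (bb i) = e J i"
proof -
  assume i: "i < N"
  have "Lam J (bb i) = (\<Sum>j<N. if j = i then e J i else 0)"
    unfolding Lam_def by (intro sum.cong refl) (use i in \<open>auto simp: bb_inner\<close>)
  then show ?thesis using i by simp
qed

lemma Lam_other: "u \<in> Basis - bb ` {..<N} \<Longrightarrow> Lam J u = 0"
  unfolding Lam_def
proof (intro sum.neutral ballI)
  fix i assume "u \<in> Basis - bb ` {..<N}" "i \<in> {..<N}"
  then have "u \<in> Basis" "bb i \<in> Basis" "u \<noteq> bb i" using bb_Basis by auto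
  then show "(u \<bullet> bb i) *\<^sub>R e J i = 0" by (simp add: inner_Basis)
qed

lemma e_in_slice_space: "i < N \<Longrightarrow> e J i \<in> slice_space v \<tau> t J"
  unfolding slice_space_def
  by (erule less_N_cases) (auto simp: e_def intro!: span_base)

lemma Lam_slice:
  assumes "J \<in> TT" "x \<in> U"
  shows "Lam J x \<in> slice v \<tau> t \<Omega> J"
proof -
  have "Lam J x \<in> \<Omega>"
    using assms unfolding Lam_eq T_symmetrize_def U_def by (auto simp: split_beta) (metis prod.collapse)
  moreover have "Lam J x \<in> slice_space v \<tau> t J"
    unfolding Lam_def by (intro subspace_sum subspace_scale e_in_slice_space) (auto simp: slice_space_def)
  ultimately show ?thesis by (simp add: slice_def)
qed

lemma slice_space_mem:
  assumes "y \<in> slice_space v \<tau> t J"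
  obtains a \<beta> where "y = (\<Sum>i\<in>{0..t 0}. a i *\<^sub>R v i) + torus_comb \<tau> \<beta> J"
proof -
  have "slice_space v \<tau> t J \<subseteq> range (Lam J)"
    unfolding slice_space_def
  proof (rule span_minimal)
    show "v ` {0..t 0} \<union> J ` {1..\<tau>} \<subseteq> range (Lam J)"
    proof (intro Un_least image_subsetI)
      fix i assume "i \<in> {0..t 0}"
      then have "Lam J (bb i) = v i" by (subst Lam_bb) (auto simp: N_def e_def)
      then show "v i \<in> range (Lam J)" by (metis rangeI)
    next
      fix h assume h: "h \<in> {1..\<tau>}"
      then have "Lam J (bb (t 0 + h)) = J h" by (subst Lam_bb) (auto simp: N_def e_def)
      then show "J h \<in> range (Lam J)" by (metis rangeI)
    qed
    show "subspace (range (Lam J))"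
      by (rule linear_subspace_image [OF bounded_linear.linear [OF bounded_linear_Lam] subspace_UNIV])
  qed
  then obtain x where "y = Lam J x" using assms by blast
  then show thesis using that unfolding Lam_eq by (auto simp: pt_def)
qed

text \<open>Recovers the first N coordinates from a point of the slice: the coefficient of J_h is
  the scalar product with J_h over its block, where J_h has length 1.\<close>

definition sec :: "(nat \<Rightarrow> 'a) \<Rightarrow> 'a \<Rightarrow> 'a" where
  "sec J y = unpt y (\<lambda>h. \<Sum>i\<in>blk h. coord i (J h) * coord i y)"

lemma sec_inner:
  assumes "J \<in> TT"
  shows "i \<le> t 0 \<Longrightarrow> sec J ((\<Sum>i\<in>{0..t 0}. a i *\<^sub>R v i) + torus_comb \<tau> \<beta> J) \<bullet> bb i = a i"
    "h \<in> {1..\<tau>} \<Longrightarrow> sec J ((\<Sum>i\<in>{0..t 0}. a i *\<^sub>R v i) + torus_comb \<tau> \<beta> J) \<bullet> bb (t 0 + h) = \<beta> h"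
proof -
  assume i: "i \<le> t 0"
  then show "sec J ((\<Sum>i\<in>{0..t 0}. a i *\<^sub>R v i) + torus_comb \<tau> \<beta> J) \<bullet> bb i = a i"
    using coord_mirror [of i a] t0_le nd assms
    by (simp add: sec_def unpt_inner coord_add coord_torus_comb_mirror)
next
  assume h: "h \<in> {1..\<tau>}"
  have "sec J ((\<Sum>i\<in>{0..t 0}. a i *\<^sub>R v i) + torus_comb \<tau> \<beta> J) \<bullet> bb (t 0 + h) =
    (\<Sum>i\<in>blk h. coord i (J h) * (\<beta> h * coord i (J h)))"
    unfolding sec_def unpt_inner(2) [OF h]
  proof (intro sum.cong refl)
    fix i assume i: "i \<in> blk h"
    then have "\<not> i \<le> t 0" "i \<le> d" using blk_sub [OF h] nd by auto
    then show "coord i (J h) * coord i ((\<Sum>i\<in>{0..t 0}. a i *\<^sub>R v i) + torus_comb \<tau> \<beta> J) =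
        coord i (J h) * (\<beta> h * coord i (J h))"
      using coord_torus_comb_blk [OF assms h i] by (simp add: coord_add coord_mirror)
  qed
  also have "\<dots> = \<beta> h * (\<Sum>i\<in>blk h. (coord i (J h))\<^sup>2)"
    by (simp add: sum_distrib_left power2_eq_square mult_ac)
  finally show "sec J ((\<Sum>i\<in>{0..t 0}. a i *\<^sub>R v i) + torus_comb \<tau> \<beta> J) \<bullet> bb (t 0 + h) = \<beta> h"
    using torusD(2) [OF assms h] by simp
qed

lemma pt_cong: "(\<And>i. i < N \<Longrightarrow> x \<bullet> bb i = y \<bullet> bb i) \<Longrightarrow> pt x = pt y"
  by (auto simp: pt_def N_def fun_eq_iff intro!: sum.cong)

text \<open>U is the image of a slice times the space of idle coordinates under (y, k) ->
  \<open>sec J y + k\<close>, and the slice is connected because the domain is a T-slice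
  domain.\<close>

lemma connected_U: "connected U"
proof -
  obtain J where J: "J \<in> TT" using torus_nonempty by blast
  have lin: "linear (sec J)"
    unfolding sec_def unpt_def
    by (rule linearI)
       (auto simp: coord_add coord_scale algebra_simps sum.distrib scaleR_sum_right sum_distrib_left)
  let ?K = "{k. \<forall>i<N. k \<bullet> bb i = 0}"
  have c1: "U = (\<lambda>(y, k). sec J y + k) ` (slice v \<tau> t \<Omega> J \<times> ?K)"
  proof (intro equalityI subsetI)
    fix x assume x: "x \<in> U"
    have L: "Lam J x = (\<Sum>i\<in>{0..t 0}. (x \<bullet> bb i) *\<^sub>R v i) + torus_comb \<tau> (\<lambda>h\<in>{1..\<tau>}. x \<bullet> bb (t 0 + h)) J"
      by (simp add: Lam_eq pt_def)
    have "sec J (Lam J x) \<bullet> bb i = x \<bullet> bb i" if "i < N" for i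
      using that unfolding L by (cases rule: less_N_cases) (simp_all only: sec_inner [OF J], simp_all)
    then have "x - sec J (Lam J x) \<in> ?K" by (simp add: inner_diff_left)
    then show "x \<in> (\<lambda>(y, k). sec J y + k) ` (slice v \<tau> t \<Omega> J \<times> ?K)"
      using Lam_slice [OF J x] by (intro image_eqI [of _ _ "(Lam J x, x - sec J (Lam J x))"]) auto
  next
    fix x assume "x \<in> (\<lambda>(y, k). sec J y + k) ` (slice v \<tau> t \<Omega> J \<times> ?K)"
    then obtain y k where x: "x = sec J y + k" and y: "y \<in> slice v \<tau> t \<Omega> J" and k: "k \<in> ?K" by auto
    have "pt x = pt (sec J y)" by (rule pt_cong) (use k in \<open>auto simp: x inner_add_left\<close>)
    obtain a \<beta> where y': "y = (\<Sum>i\<in>{0..t 0}. a i *\<^sub>R v i) + torus_comb \<tau> \<beta> J"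
      using y slice_space_mem unfolding slice_def by blast
    have "(\<Sum>i\<in>{0..t 0}. a i *\<^sub>R v i, restrict \<beta> {1..\<tau>}) \<in> D"
      by (rule slice_memD [OF J]) (use y y' in \<open>auto simp: slice_def\<close>)
    also have "(\<Sum>i\<in>{0..t 0}. a i *\<^sub>R v i, restrict \<beta> {1..\<tau>}) = pt (sec J y)"
      unfolding y' pt_def using sec_inner [OF J, of _ a \<beta>]
      by (auto simp: fun_eq_iff intro!: sum.cong)
    finally show "x \<in> U" using \<open>pt x = _\<close> by (simp add: U_def)
  qed
  have c2: "connected (slice v \<tau> t \<Omega> J \<times> ?K)"
  proof (rule connected_Times)
    show "connected (slice v \<tau> t \<Omega> J)" using dom J by (auto simp: T_slice_domain_def)
    have "convex ?K" by (auto simp: convex_def inner_add_left)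
    then show "connected ?K" by (rule convex_connected)
  qed
  have c3: "continuous_on (slice v \<tau> t \<Omega> J \<times> ?K) (\<lambda>(y, k). sec J y + k)"
    unfolding split_def
    by (intro continuous_intros bounded_linear.continuous_on [OF linear_conv_bounded_linear [THEN iffD1, OF lin]])
  show ?thesis unfolding c1 by (rule connected_continuous_image [OF c3 c2])
qed

end

section \<open>The representation formula\<close>

context cr_system begin

text \<open>The Taylor series is grouped by total degree: the part of degree m is a polynomial, so
  it extends, with bound S 2^-m on the polydisc, and the parts are added by
  \<open>hol_ext_at_infsum\<close>.\<close>

lemma hol_ext_monogenic:
  assumes f: "monogenic_on U f" and p: "p \<in> U" and c: "c \<in> Basis"
  shows "hol_ext {..<N} (\<lambda>y. f (p + (\<Sum>i<N. y i *\<^sub>R b i)) \<bullet> c)"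
proof -
  obtain \<rho> S K where \<rho>: "\<rho> > 0" "S \<ge> 0" "K \<ge> 0" "real N * \<rho> * K \<le> 1 / 2" "cball p \<rho> \<subseteq> U"
    and S: "\<And>w. set w \<subseteq> {..<N} \<Longrightarrow> norm (pds w f p) \<le> S * K ^ length w * fact (length w)"
    and T: "\<And>h c. norm h \<le> \<rho> \<Longrightarrow> c \<in> Basis \<Longrightarrow>
       (\<lambda>m. (\<Sum>w\<in>words m. (\<Prod>i\<leftarrow>w. h \<bullet> b i) * (pds w f p \<bullet> c)) / fact m) sums (f (p + h) \<bullet> c)"
    by (rule taylor [OF f p], rule that, assumption+)
  \<comment> \<open>The cube of half-width r in N coordinates must lie in the ball of radius \<rho>;
    N + 1 avoids a zero denominator.\<close>
  define r where "r = \<rho> / (real N + 1)"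
  have r: "r > 0" "r \<le> \<rho>" "real N * r \<le> \<rho>" using \<rho>(1) by (auto simp: r_def field_simps)
  define q where "q m y = (\<Sum>w\<in>words m. (\<Prod>i\<leftarrow>w. y i) * (pds w f p \<bullet> c)) / fact m" for m :: nat and y :: "nat \<Rightarrow> real"
  have mono: "hol_ext_at {..<N} r (r ^ length w) (\<lambda>y. \<Prod>i\<leftarrow>w. y i)" if "set w \<subseteq> {..<N}" for w
    using that by (induction w) (auto intro: hol_ext_at_const hol_ext_at_mult hol_ext_at_coord)
  have q: "hol_ext_at {..<N} r (S * (1 / 2) ^ m) (q m)" for m
  proof -
    have 1: "hol_ext_at {..<N} r (\<bar>1 / fact m\<bar> * (\<Sum>w\<in>words m. r ^ m * (S * K ^ m * fact m)))
        (\<lambda>y. 1 / fact m * (\<Sum>w\<in>words m. (\<Prod>i\<leftarrow>w. y i) * (pds w f p \<bullet> c)))"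
    proof (intro hol_ext_at_mult hol_ext_at_const order_refl hol_ext_at_sum finite_words)
      fix w assume "w \<in> words m"
      then have w: "set w \<subseteq> {..<N}" "length w = m" by (auto simp: words_def)
      show "hol_ext_at {..<N} r (r ^ m) (\<lambda>y. \<Prod>i\<leftarrow>w. y i)" using mono [OF w(1)] w(2) by simp
      show "\<bar>pds w f p \<bullet> c\<bar> \<le> S * K ^ m * fact m"
        using order_trans [OF Basis_le_norm [OF c] S [OF w(1)]] by (simp add: w(2))
    qed
    have 2: "\<bar>1 / fact m\<bar> * (\<Sum>w\<in>words m. r ^ m * (S * K ^ m * fact m)) = S * (real N * r * K) ^ m"
      by (simp add: card_words power_mult_distrib)
    have 3: "S * (real N * r * K) ^ m \<le> S * (1 / 2) ^ m"
    proof (intro mult_left_mono power_mono \<rho>)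
      have "real N * r * K \<le> real N * \<rho> * K" using r \<rho> by (intro mult_right_mono mult_left_mono) auto
      then show "real N * r * K \<le> 1 / 2" using \<rho> by linarith
    qed (use r \<rho> in auto)
    have 4: "q m = (\<lambda>y. 1 / fact m * (\<Sum>w\<in>words m. (\<Prod>i\<leftarrow>w. y i) * (pds w f p \<bullet> c)))"
      by (simp add: q_def [abs_def])
    show ?thesis unfolding 4 by (rule hol_ext_at_mono [OF 1 order_refl]) (unfold 2, rule 3)
  qed
  have summ: "(\<lambda>m. S * (1 / 2) ^ m) summable_on (UNIV :: nat set)"
  proof (rule norm_summable_imp_summable_on)
    have "norm (S * (1 / 2) ^ m) = S * (1 / 2) ^ m" for m :: nat
      unfolding real_norm_def by (rule abs_of_nonneg) (use \<rho>(2) in simp)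
    moreover have "summable (\<lambda>m. S * (1 / 2) ^ m)" by (intro summable_mult summable_geometric) simp
    ultimately show "summable (\<lambda>m. norm (S * (1 / 2) ^ m))" by (simp only:)
  qed
  have "hol_ext_at {..<N} r (infsum (\<lambda>m. S * (1 / 2) ^ m) UNIV) (\<lambda>y. f (p + (\<Sum>i<N. y i *\<^sub>R b i)) \<bullet> c)"
  proof (rule hol_ext_at_infsum [OF q summ])
    fix y :: "nat \<Rightarrow> real" assume y: "\<forall>i\<in>{..<N}. \<bar>y i\<bar> < r"
    define h where "h = (\<Sum>i<N. y i *\<^sub>R b i)"
    have "norm h \<le> (\<Sum>i<N. r)" unfolding h_def
      by (rule sum_norm_le) (use y in \<open>auto simp: norm_Basis less_imp_le\<close>)
    then have h: "norm h \<le> \<rho>" using r by simp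
    have hb: "h \<bullet> b i = y i" if "i < N" for i
    proof -
      have "h \<bullet> b i = (\<Sum>j<N. if j = i then y i else 0)"
        unfolding h_def inner_sum_left
        by (intro sum.cong refl) (use that inj_on_eq_iff [OF inj] in \<open>auto simp: inner_Basis\<close>)
      then show ?thesis using that by simp
    qed
    have "(\<Prod>i\<leftarrow>w. h \<bullet> b i) = (\<Prod>i\<leftarrow>w. y i)" if "w \<in> words m" for w m
      using that hb by (intro arg_cong [where f = prod_list] map_cong) (auto simp: words_def)
    then have "(\<lambda>m. q m y) sums (f (p + h) \<bullet> c)"
      using T [OF h c] by (simp add: q_def)
    moreover have "summable (\<lambda>m. norm (q m y))"
    proof (rule summable_comparison_test)
      show "\<exists>n0. \<forall>m\<ge>n0. norm (norm (q m y)) \<le> S * (1 / 2) ^ m"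
        using hol_ext_at_real_bound [OF q y] by auto
      show "summable (\<lambda>m. S * (1 / 2) ^ m)" by (intro summable_mult summable_geometric) simp
    qed
    ultimately show "((\<lambda>m. q m y) has_sum f (p + (\<Sum>i<N. y i *\<^sub>R b i)) \<bullet> c) UNIV"
      unfolding h_def [symmetric] by (intro norm_summable_imp_has_sum)
  qed
  then show ?thesis using r unfolding hol_ext_def by blast
qed

end

context T_setting begin

text \<open>Chain rule along the linear map \<open>Lam J\<close>. The derivative of \<open>f\<close>
  within the slice is controlled only on \<open>slice_space\<close>, which is enough because
  \<open>Lam J\<close> takes its values there.\<close>

lemma monogenic_g:
  assumes J: "J \<in> TT"
  shows "cr_system.monogenic_on N bb (e J) U (\<lambda>x. f (Lam J x))"
proof -
  interpret cs: cr_system N bb "e J" "eb J" by (rule cr_system_e [OF J])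
  define W where "W = slice_space v \<tau> t J"
  define Y where "Y = slice v \<tau> t \<Omega> J"
  have "J_monogenic v \<tau> t J Y f" using reg J by (auto simp: T_regular_def Y_def)
  then obtain f' where f': "\<And>x. x \<in> Y \<Longrightarrow> (f has_derivative f' x) (at x within Y)"
    and cont: "\<And>w. w \<in> W \<Longrightarrow> continuous_on Y (\<lambda>x. f' x w)"
    and CR: "\<And>x. x \<in> Y \<Longrightarrow> CR_operator v \<tau> t J f x = 0"
    by (auto simp: J_monogenic_def C1_on_subspace_def W_def)
  have LY: "Lam J x \<in> Y" if "x \<in> U" for x using Lam_slice [OF J that] by (simp add: Y_def)
  have LW: "Lam J u \<in> W" for u
    unfolding Lam_def W_def by (intro subspace_sum subspace_scale e_in_slice_space) (auto simp: slice_space_def)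
  have der: "((\<lambda>x. f (Lam J x)) has_derivative (\<lambda>u. f' (Lam J x) (Lam J u))) (at x)" if x: "x \<in> U" for x
  proof -
    have "(Lam J has_derivative Lam J) (at x within U)"
      by (rule bounded_linear_imp_has_derivative [OF bounded_linear_Lam])
    moreover have "(f has_derivative f' (Lam J x)) (at (Lam J x) within Lam J ` U)"
      by (rule has_derivative_subset [OF f' [OF LY [OF x]]]) (use LY in auto)
    ultimately have "((\<lambda>x. f (Lam J x)) has_derivative (\<lambda>u. f' (Lam J x) (Lam J u))) (at x within U)"
      by (rule has_derivative_in_compose)
    then show ?thesis by (simp add: at_within_open [OF x open_U])
  qed
  define G where "G x = Blinfun (\<lambda>u. f' (Lam J x) (Lam J u))" for x
  have G: "blinfun_apply (G x) = (\<lambda>u. f' (Lam J x) (Lam J u))" if "x \<in> U" for x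
    unfolding G_def by (rule bounded_linear_Blinfun_apply [OF has_derivative_bounded_linear [OF der [OF that]]])
  have "cs.monogenic_deriv U (\<lambda>x. f (Lam J x)) G"
    unfolding cs.monogenic_deriv_def
  proof (intro conjI ballI)
    show "open U" by (rule open_U)
    show "((\<lambda>x. f (Lam J x)) has_derivative blinfun_apply (G x)) (at x)" if "x \<in> U" for x
      using der [OF that] G [OF that] by simp
    show "continuous_on U G"
    proof (rule continuous_on_blinfun_componentwise)
      fix i :: 'a assume "i \<in> Basis"
      have "continuous_on U (\<lambda>x. f' (Lam J x) (Lam J i))"
        by (rule continuous_on_compose2 [OF cont [OF LW] linear_continuous_on [OF bounded_linear_Lam]])
           (use LY in auto)
      then show "continuous_on U (\<lambda>x. blinfun_apply (G x) i)"
        by (rule continuous_on_eq) (simp add: G)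
    qed
    fix x assume x: "x \<in> U"
    \<comment> \<open>\<open>Lam J\<close> maps the line through x in direction \<open>bb i\<close>
      to the line through \<open>Lam J x\<close> in direction \<open>e J i\<close>, so the two
      notions of partial derivative agree.\<close>
    have cd: "coord_deriv f (e J i) (Lam J x) = G x (bb i)" if i: "i < N" for i
    proof -
      have "((\<lambda>r. f (Lam J (x + r *\<^sub>R bb i))) has_derivative (\<lambda>k. f' (Lam J (x + 0 *\<^sub>R bb i)) (Lam J (k *\<^sub>R bb i)))) (at 0)"
        by (rule has_derivative_compose [where f = "\<lambda>r. x + r *\<^sub>R bb i" and g = "\<lambda>x. f (Lam J x)"])
           (auto intro!: derivative_eq_intros der x simp: x)
      moreover have "Lam J (x + r *\<^sub>R bb i) = Lam J x + r *\<^sub>R e J i" for r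
        using bounded_linear.linear [OF bounded_linear_Lam, of J] Lam_bb [OF i]
        by (simp add: linear_add linear_cmul)
      moreover have "f' (Lam J x) (Lam J (k *\<^sub>R bb i)) = k *\<^sub>R G x (bb i)" for k
        using blinfun.scaleR_right [of "G x" k "bb i"] by (simp add: G [OF x])
      ultimately have "((\<lambda>r. f (Lam J x + r *\<^sub>R e J i)) has_vector_derivative G x (bb i)) (at 0)"
        by (simp add: has_vector_derivative_def)
      then show ?thesis unfolding coord_deriv_def by (rule vector_derivative_at)
    qed
    have "(\<Sum>i<N. e J i * coord_deriv f (e J i) (Lam J x)) = CR_operator v \<tau> t J f (Lam J x)"
      unfolding sum_N CR_operator_def by (intro arg_cong2 [of _ _ _ _ "(+)"] sum.cong refl) (auto simp: e_def)
    then show "(\<Sum>i<N. e J i * G x (bb i)) = 0" using CR [OF LY [OF x]] by (simp add: cd)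
    fix u assume "u \<in> Basis - bb ` {..<N}"
    then have "Lam J u = Lam J 0"
      using Lam_other linear_0 [OF bounded_linear.linear [OF bounded_linear_Lam]] by simp
    then have "G x u = G x 0" by (simp add: G [OF x])
    then show "G x u = 0" by simp
  qed
  then show ?thesis by (auto simp: cs.monogenic_on_def)
qed

lemma Lam_unpt: "(\<alpha>, \<beta>) \<in> D \<Longrightarrow> unpt \<alpha> \<beta> \<in> U" "(\<alpha>, \<beta>) \<in> D \<Longrightarrow> Lam J (unpt \<alpha> \<beta>) = \<alpha> + torus_comb \<tau> \<beta> J"
  by (simp_all add: U_def pt_unpt Lam_eq)

lemma Lam_upd: "h \<in> {1..\<tau>} \<Longrightarrow> x \<bullet> bb (t 0 + h) = 0 \<Longrightarrow> Lam (J(h := j)) x = Lam J x"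
  unfolding Lam_def
proof (intro sum.cong refl)
  fix i assume a: "h \<in> {1..\<tau>}" "x \<bullet> bb (t 0 + h) = 0" "i \<in> {..<N}"
  show "(x \<bullet> bb i) *\<^sub>R e (J(h := j)) i = (x \<bullet> bb i) *\<^sub>R e J i"
    by (cases "i = t 0 + h") (use a in \<open>auto simp: e_def\<close>)
qed

text \<open>The right-hand side is \<open>J\<close>-monogenic and agrees with \<open>f\<close> where the coordinate \<open>h\<close> vanishes. A
  monogenic function is determined by its values on a hyperplane, but not on the mirror, which is
  why the units are exchanged one at a time.\<close>

lemma one_step:
  assumes D: "(\<alpha>, \<beta>) \<in> D" and J: "J \<in> TT" and h: "h \<in> {1..\<tau>}" and j: "j \<in> sph h"
  shows "f (\<alpha> + torus_comb \<tau> \<beta> J) =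
    (1 / 2) *\<^sub>R ((1 - J h * j) * f (\<alpha> + torus_comb \<tau> \<beta> (J(h := j)))
      + (1 + J h * j) * f (\<alpha> + torus_comb \<tau> (reflect {h} \<beta>) (J(h := j))))"
proof -
  define J1 where "J1 = J(h := j)"
  define J2 where "J2 = J(h := - j)"
  have J1: "J1 \<in> TT" and J2: "J2 \<in> TT"
    using torus_upd [OF J h j] torus_upd [OF J h sphere_minus [OF h j]] by (auto simp: J1_def J2_def)
  interpret cs: cr_system N bb "e J" "eb J" by (rule cr_system_e [OF J])
  interpret cs1: cr_system N bb "e J1" "eb J1" by (rule cr_system_e [OF J1])
  interpret cs2: cr_system N bb "e J2" "eb J2" by (rule cr_system_e [OF J2])
  obtain G where G: "cs.monogenic_deriv U (\<lambda>x. f (Lam J x)) G"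
    using monogenic_g [OF J] by (auto simp: cs.monogenic_on_def)
  obtain G1 where G1: "cs1.monogenic_deriv U (\<lambda>x. f (Lam J1 x)) G1"
    using monogenic_g [OF J1] by (auto simp: cs1.monogenic_on_def)
  obtain G2 where G2: "cs2.monogenic_deriv U (\<lambda>x. f (Lam J2 x)) G2"
    using monogenic_g [OF J2] by (auto simp: cs2.monogenic_on_def)
  note d = cs.monogenic_derivD [OF G]
  note d1 = cs1.monogenic_derivD [OF G1]
  note d2 = cs2.monogenic_derivD [OF G2]
  define u where "u = J h"
  \<comment> \<open>Weights with c1 + c2 = 1, u c1 = c1 j and u c2 = - c2 j: they intertwine the
    unit u of the slice J with the units j and -j of the slices J1 and J2.\<close>
  define c1 where "c1 = (1 / 2) *\<^sub>R (1 - u * j)"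
  define c2 where "c2 = (1 / 2) *\<^sub>R (1 + u * j)"
  have uu: "u * u = -1" using torus_sq [OF J h] by (simp add: u_def)
  have jj: "j * j = -1" using torus_sq [OF J1 h] by (simp add: J1_def)
  have c12: "c1 + c2 = 1" by (simp add: c1_def c2_def algebra_simps flip: scaleR_add_left)
  define L where "L c = Blinfun (\<lambda>x::'a. c * x)" for c
  have L: "blinfun_apply (L c) x = c * x" for c x
    by (simp add: L_def bounded_linear_Blinfun_apply [OF bounded_linear_left_mult])
  define i0 where "i0 = t 0 + h"
  have i0: "i0 < N" "i0 \<noteq> 0" using h by (auto simp: i0_def N_def)
  define \<Delta> where "\<Delta> x = f (Lam J x) - (c1 * f (Lam J1 x) + c2 * f (Lam J2 x))" for x
  have e12: "e J1 i = e J i" "e J2 i = e J i" if "i \<noteq> i0" for i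
    using that by (auto simp: e_def J1_def J2_def i0_def)
  have ei0: "e J i0 = u" "e J1 i0 = j" "e J2 i0 = - j"
    using h by (auto simp: i0_def u_def J1_def J2_def e_def)
  \<comment> \<open>Both u and j anticommute with the other imaginary units, hence their product
    commutes with them; the weights therefore pass through every term of the operator except that of
    index \<open>i0\<close>.\<close>
  have comm: "e J i * (u * j) = (u * j) * e J i" if "i < N" "i \<noteq> i0" for i
  proof (cases "i = 0")
    case False
    have a: "e J i * u = - (u * e J i)"
      using e_anti [OF J _ that(1) _ i0(1) that(2)] False i0 by (simp add: ei0)
    have b: "e J i * j = - (j * e J i)"
      using e_anti [OF J1 _ that(1) _ i0(1) that(2)] False i0 e12(1) [OF that(2)] by (simp add: ei0)
    have "e J i * (u * j) = (e J i * u) * j" by (simp add: mult.assoc)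
    also have "\<dots> = - (u * (e J i * j))" by (simp add: a mult.assoc)
    also have "\<dots> = (u * j) * e J i" by (simp add: b mult.assoc)
    finally show ?thesis .
  qed simp
  have comm1: "e J i * c1 = c1 * e J i" "e J i * c2 = c2 * e J i" if "i < N" "i \<noteq> i0" for i
    using comm [OF that] by (simp_all add: c1_def c2_def algebra_simps)
  have "cs.monogenic_deriv U \<Delta> (\<lambda>x. G x - ((L c1 o\<^sub>L G1 x) + (L c2 o\<^sub>L G2 x)))"
    unfolding cs.monogenic_deriv_def
  proof (intro conjI ballI)
    show "open U" by (rule open_U)
    show "continuous_on U (\<lambda>x. G x - ((L c1 o\<^sub>L G1 x) + (L c2 o\<^sub>L G2 x)))"
      by (intro continuous_intros d d1 d2)
    fix x assume x: "x \<in> U"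
    have "(\<Delta> has_derivative (\<lambda>k. G x k - (c1 * G1 x k + c2 * G2 x k))) (at x)"
      unfolding \<Delta>_def
      by (intro has_derivative_diff has_derivative_add bounded_linear.has_derivative [OF bounded_linear_left_mult] d d1 d2 x)
    then show "(\<Delta> has_derivative blinfun_apply (G x - ((L c1 o\<^sub>L G1 x) + (L c2 o\<^sub>L G2 x)))) (at x)"
      by (simp add: blinfun.diff_left [abs_def] blinfun.add_left L)
    \<comment> \<open>The equation on the slice J1, solved for the terms whose units J and J1
      share.\<close>
    have s1: "(\<Sum>i\<in>{..<N} - {i0}. e J i * G1 x (bb i)) = - (j * G1 x (bb i0))"
    proof -
      have "0 = j * G1 x (bb i0) + (\<Sum>i\<in>{..<N} - {i0}. e J1 i * G1 x (bb i))"
        using d1(4) [OF x] i0 by (subst (asm) sum.remove [of _ i0]) (auto simp: ei0)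
      also have "(\<Sum>i\<in>{..<N} - {i0}. e J1 i * G1 x (bb i)) = (\<Sum>i\<in>{..<N} - {i0}. e J i * G1 x (bb i))"
        by (intro sum.cong refl) (simp add: e12)
      finally show ?thesis by (simp add: eq_neg_iff_add_eq_0 add.commute)
    qed
    have s2: "(\<Sum>i\<in>{..<N} - {i0}. e J i * G2 x (bb i)) = j * G2 x (bb i0)"
    proof -
      have "0 = - (j * G2 x (bb i0)) + (\<Sum>i\<in>{..<N} - {i0}. e J2 i * G2 x (bb i))"
        using d2(4) [OF x] i0 by (subst (asm) sum.remove [of _ i0]) (auto simp: ei0)
      also have "(\<Sum>i\<in>{..<N} - {i0}. e J2 i * G2 x (bb i)) = (\<Sum>i\<in>{..<N} - {i0}. e J i * G2 x (bb i))"
        by (intro sum.cong refl) (simp add: e12)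
      finally show ?thesis by simp
    qed
    have "(\<Sum>i<N. e J i * (c1 * G1 x (bb i) + c2 * G2 x (bb i))) =
       u * (c1 * G1 x (bb i0) + c2 * G2 x (bb i0)) +
       (\<Sum>i\<in>{..<N} - {i0}. e J i * (c1 * G1 x (bb i) + c2 * G2 x (bb i)))"
      using i0 by (subst sum.remove [of _ i0]) (auto simp: ei0)
    also have "(\<Sum>i\<in>{..<N} - {i0}. e J i * (c1 * G1 x (bb i) + c2 * G2 x (bb i))) =
       (\<Sum>i\<in>{..<N} - {i0}. c1 * (e J i * G1 x (bb i)) + c2 * (e J i * G2 x (bb i)))"
    proof (intro sum.cong refl)
      fix i assume "i \<in> {..<N} - {i0}"
      then have i: "i < N" "i \<noteq> i0" by auto
      show "e J i * (c1 * G1 x (bb i) + c2 * G2 x (bb i)) = c1 * (e J i * G1 x (bb i)) + c2 * (e J i * G2 x (bb i))"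
        using comm1 [OF i] by (simp add: distrib_left flip: mult.assoc)
    qed
    also have "\<dots> = c1 * - (j * G1 x (bb i0)) + c2 * (j * G2 x (bb i0))"
      by (simp add: sum.distrib s1 s2 flip: sum_distrib_left)
    also have "u * (c1 * G1 x (bb i0) + c2 * G2 x (bb i0)) + \<dots> =
      (u * c1 - c1 * j) * G1 x (bb i0) + (u * c2 + c2 * j) * G2 x (bb i0)"
      by (simp add: algebra_simps)
    also have "\<dots> = 0"
    proof -
      have "u * c1 - c1 * j = (1 / 2) *\<^sub>R (u - (u * u) * j - j + u * (j * j))"
        by (simp add: c1_def algebra_simps)
      then have "u * c1 - c1 * j = 0" by (simp add: uu jj)
      moreover have "u * c2 + c2 * j = (1 / 2) *\<^sub>R (u + (u * u) * j + j + u * (j * j))"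
        by (simp add: c2_def algebra_simps)
      then have "u * c2 + c2 * j = 0" by (simp add: uu jj)
      ultimately show ?thesis by simp
    qed
    finally have "(\<Sum>i<N. e J i * (c1 * G1 x (bb i) + c2 * G2 x (bb i))) = 0" .
    then show "(\<Sum>i<N. e J i * (G x - ((L c1 o\<^sub>L G1 x) + (L c2 o\<^sub>L G2 x))) (bb i)) = 0"
      using d(4) [OF x] by (simp add: blinfun.diff_left blinfun.add_left L right_diff_distrib sum_subtractf)
    fix w assume w: "w \<in> Basis - bb ` {..<N}"
    show "(G x - ((L c1 o\<^sub>L G1 x) + (L c2 o\<^sub>L G2 x))) w = 0"
      using d(5) [OF x w] d1(5) [OF x w] d2(5) [OF x w] by (simp add: blinfun.diff_left blinfun.add_left L)
  qed
  then have mono: "cs.monogenic_on U \<Delta>" by (auto simp: cs.monogenic_on_def)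
  \<comment> \<open>A point of the domain on the mirror gives a parameter with \<beta> = 0, so the
    hyperplane meets U.\<close>
  obtain \<alpha>0 where \<alpha>0: "\<alpha>0 \<in> \<Omega>" "\<alpha>0 \<in> mirror v t" using dom by (auto simp: T_slice_domain_def)
  have \<alpha>0': "\<alpha>0 = (\<Sum>i\<in>{0..t 0}. coord i \<alpha>0 *\<^sub>R v i)"
    using \<alpha>0(2) mem_span_iff [of "{0..t 0}" \<alpha>0] t0_le nd by (auto simp: mirror_def span_range_def)
  have "(\<Sum>i\<in>{0..t 0}. coord i \<alpha>0 *\<^sub>R v i) + torus_comb \<tau> (\<lambda>_. 0) J \<in> \<Omega>"
    using \<alpha>0 \<alpha>0' by (simp add: torus_comb_def)
  from slice_memD [OF J this] have D0: "(\<alpha>0, restrict (\<lambda>_. 0) {1..\<tau>}) \<in> D" using \<alpha>0' by simp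
  have "\<Delta> (unpt \<alpha> \<beta>) = 0"
  proof (rule cs.identity_hyperplane [OF mono i0(1) connected_U])
    show "\<Delta> x = 0" if "x \<in> U" "x \<bullet> bb i0 = 0" for x
    proof -
      have "Lam J1 x = Lam J x" "Lam J2 x = Lam J x"
        using that Lam_upd [OF h] unfolding J1_def J2_def i0_def by auto
      then show ?thesis by (simp add: \<Delta>_def c12 flip: distrib_right)
    qed
    show "unpt \<alpha>0 (restrict (\<lambda>_. 0) {1..\<tau>}) \<in> U" by (rule Lam_unpt [OF D0])
    show "unpt \<alpha>0 (restrict (\<lambda>_. 0) {1..\<tau>}) \<bullet> bb i0 = 0"
      unfolding i0_def using h by (simp add: unpt_inner)
    show "unpt \<alpha> \<beta> \<in> U" by (rule Lam_unpt [OF D])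
  qed
  \<comment> \<open>The unit -j with coefficient \<beta>_h is the unit j with coefficient
    -\<beta>_h.\<close>
  moreover have "torus_comb \<tau> \<beta> J2 = torus_comb \<tau> (reflect {h} \<beta>) J1"
    unfolding torus_comb_reflect by (rule arg_cong [of _ _ "torus_comb \<tau> \<beta>"]) (auto simp: J1_def J2_def fun_eq_iff)
  ultimately have "f (\<alpha> + torus_comb \<tau> \<beta> J) =
      c1 * f (\<alpha> + torus_comb \<tau> \<beta> J1) + c2 * f (\<alpha> + torus_comb \<tau> (reflect {h} \<beta>) J1)"
    by (simp add: \<Delta>_def Lam_unpt [OF D])
  then show ?thesis
    by (simp only: c1_def c2_def u_def J1_def mult_scaleR_left scaleR_add_right [of "1 / 2" "_ * _"])
qed

lemma torus_comb_cong: "(\<And>h. h \<in> {1..\<tau>} \<Longrightarrow> \<beta> h *\<^sub>R J h = \<beta>' h *\<^sub>R J' h) \<Longrightarrow> torus_comb \<tau> \<beta> J = torus_comb \<tau> \<beta>' J'"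
  unfolding torus_comb_def by (rule sum.cong) auto

lemma representation_formula:
  assumes D: "(\<alpha>, \<beta>) \<in> D" and I: "I \<in> TT" and J: "J \<in> TT"
  shows "f (\<alpha> + torus_comb \<tau> \<beta> J) = (\<Sum>K\<in>Pow {1..\<tau>}. \<Sum>H\<in>Pow {1..\<tau>}.
     ((1 / 2 ^ \<tau>) * (- 1) ^ card (K \<inter> H)) *\<^sub>R
        (ordered_prod J K * ordered_inv I K * f (\<alpha> + torus_comb \<tau> (reflect H \<beta>) I)))"
proof -
  have "f (\<alpha> + torus_comb \<tau> \<beta> J) = (\<Sum>K\<in>Pow {1..\<tau>}. \<Sum>H\<in>Pow {1..\<tau>}.
     ((1 / 2 ^ \<tau>) * (- 1) ^ card (K \<inter> H)) *\<^sub>R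
        (ordered_prod J K * ordered_inv I K * f (\<alpha> + torus_comb \<tau> (reflect H \<beta>) (\<lambda>h. if h \<in> {1..\<tau>} then I h else J h))))"
  proof (rule conjunct1, rule representation_formula_aux [where D = D and T = TT])
    fix \<beta> J h assume a: "(\<alpha>, \<beta>) \<in> D" "J \<in> TT" "h \<in> {1..\<tau>}"
    show "f (\<alpha> + torus_comb \<tau> \<beta> J) =
        (1 / 2) *\<^sub>R ((1 - J h * I h) * f (\<alpha> + torus_comb \<tau> \<beta> (J(h := I h)))
          + (1 + J h * I h) * f (\<alpha> + torus_comb \<tau> (reflect {h} \<beta>) (J(h := I h))))"
      by (rule one_step [OF a torus_component [OF I a(3)]])
  next
    fix J h assume a: "J \<in> TT" "h \<in> {1..\<tau>}"
    show "J(h := I h) \<in> TT" by (rule torus_upd [OF a torus_component [OF I a(2)]])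
  next
    fix h k assume a: "h \<in> {1..\<tau>}" "k \<in> {1..\<tau>}" "h \<noteq> k"
    show "I k * I h = - (I h * I k) \<and> I k * J h = - (J h * I k)"
      using torus_anti [OF I I a(2,1)] torus_anti [OF I J a(2,1)] a(3) by auto
  qed (use D J D_reflect in auto)
  moreover have "torus_comb \<tau> \<beta>' (\<lambda>h. if h \<in> {1..\<tau>} then I h else J h) = torus_comb \<tau> \<beta>' I" for \<beta>'
    by (rule torus_comb_cong) simp
  ultimately show ?thesis by simp
qed

lemma mult_inverse_torus: "I \<in> TT \<Longrightarrow> K \<subseteq> {1..\<tau>} \<Longrightarrow> mult_inverse (ordered_prod I K) = ordered_inv I K"
proof (rule mult_inverse_ordered_prod)
  assume a: "I \<in> TT" "K \<subseteq> {1..\<tau>}"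
  show "finite K" using a(2) by (rule finite_subset) simp
  show "I k * I k = - 1" if "k \<in> K" for k by (rule torus_sq [OF a(1) subsetD [OF a(2) that]])
qed

lemma stem_expansion:
  assumes D: "(\<alpha>, \<beta>) \<in> D" and I: "I \<in> TT" and J: "J \<in> TT"
  shows "f (\<alpha> + torus_comb \<tau> \<beta> J) = (\<Sum>K\<in>Pow {1..\<tau>}. ordered_prod J K * stem_comp \<tau> I f K (\<alpha>, \<beta>))"
  unfolding representation_formula [OF D I J] stem_comp_def
  by (intro sum.cong refl) (simp add: sum_distrib_left scaleR_right.sum mult.assoc)

text \<open>Any I in the torus serves as reference: the parity comes from
  \<open>stem_comp_reflect\<close>, and \<open>stem_expansion\<close> with this single I covers all
  J.\<close>

lemma strongly_regular: "strongly_T_regular v d \<tau> t D f"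
proof -
  obtain I where I: "I \<in> TT" using torus_nonempty by blast
  have "T_stem_function \<tau> D (stem_comp \<tau> I f)"
    unfolding T_stem_function_def using stem_comp_reflect [of _ \<tau> I f] by blast
  moreover have "induced_by_stem v d \<tau> t D (stem_comp \<tau> I f) f"
    unfolding induced_by_stem_def using stem_expansion [OF _ I] by blast
  ultimately show ?thesis
    using reg unfolding strongly_T_regular_def T_function_def by blast
qed

lemma representation_formulas:
  assumes D: "(\<alpha>, \<beta>) \<in> D" and I: "I \<in> TT" and J: "J \<in> TT"
  shows "f (\<alpha> + torus_comb \<tau> \<beta> J) =
         (1 / 2 ^ \<tau>) *\<^sub>R (\<Sum>K\<in>Pow {1..\<tau>}. \<Sum>H\<in>Pow {1..\<tau>}.
           (-1) ^ card (K \<inter> H) *\<^sub>R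
             (ordered_prod J K * mult_inverse (ordered_prod I K)
               * f (\<alpha> + torus_comb \<tau> (reflect H \<beta>) I)))" (is "_ = ?A")
    and "f (\<alpha> + torus_comb \<tau> \<beta> J) =
         (\<Sum>H\<in>Pow {1..\<tau>}. gamma_coeff \<tau> I J H * f (\<alpha> + torus_comb \<tau> (reflect H \<beta>) I))" (is "_ = ?B")
proof -
  show A: "f (\<alpha> + torus_comb \<tau> \<beta> J) = ?A"
    unfolding representation_formula [OF D I J] scaleR_right.sum
    by (intro sum.cong refl) (simp add: mult_inverse_torus [OF I])
  have "?B = (\<Sum>H\<in>Pow {1..\<tau>}. \<Sum>K\<in>Pow {1..\<tau>}. (1 / 2 ^ \<tau>) *\<^sub>R ((-1) ^ card (K \<inter> H) *\<^sub>R
             (ordered_prod J K * mult_inverse (ordered_prod I K)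
               * f (\<alpha> + torus_comb \<tau> (reflect H \<beta>) I))))"
    by (simp add: gamma_coeff_def scaleR_right.sum sum_distrib_right)
  also have "\<dots> = ?A" unfolding scaleR_right.sum by (rule sum.swap)
  finally show "f (\<alpha> + torus_comb \<tau> \<beta> J) = ?B" using A by simp
qed

end

section \<open>Real analyticity\<close>

definition vec_ext :: "nat set \<Rightarrow> ((nat \<Rightarrow> real) \<Rightarrow> 'a::euclidean_space) \<Rightarrow> bool" where
  "vec_ext X w \<longleftrightarrow> (\<forall>c\<in>Basis. hol_ext X (\<lambda>y. w y \<bullet> c))"

lemma vec_ext_const: "vec_ext X (\<lambda>_. c)"
  by (simp add: vec_ext_def hol_ext_const)

lemma vec_ext_sum: "finite S \<Longrightarrow> (\<And>s. s \<in> S \<Longrightarrow> vec_ext X (w s)) \<Longrightarrow> vec_ext X (\<lambda>y. \<Sum>s\<in>S. w s y)"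
  by (simp add: vec_ext_def inner_sum_left hol_ext_sum)

lemma vec_ext_scaleR: "hol_ext X u \<Longrightarrow> vec_ext X w \<Longrightarrow> vec_ext X (\<lambda>y. u y *\<^sub>R w y)"
  by (simp add: vec_ext_def hol_ext_mult)

lemma vec_ext_mult_left:
  fixes a :: "'a::{real_algebra_1,euclidean_space}"
  assumes "vec_ext X w"
  shows "vec_ext X (\<lambda>y. a * w y)"
  unfolding vec_ext_def
proof
  fix c :: 'a assume "c \<in> Basis"
  have "(a * w y) \<bullet> c = (\<Sum>b\<in>Basis. (w y \<bullet> b) * ((a * b) \<bullet> c))" for y
  proof -
    have "a * w y = a * (\<Sum>b\<in>Basis. (w y \<bullet> b) *\<^sub>R b)" by (simp add: euclidean_representation)
    also have "\<dots> = (\<Sum>b\<in>Basis. (w y \<bullet> b) *\<^sub>R (a * b))" by (simp add: sum_distrib_left)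
    finally show ?thesis by (simp add: inner_sum_left)
  qed
  moreover have "hol_ext X (\<lambda>y. \<Sum>b\<in>Basis. (w y \<bullet> b) * ((a * b) \<bullet> c))"
    using assms by (intro hol_ext_sum hol_ext_mult hol_ext_const) (auto simp: vec_ext_def)
  ultimately show "hol_ext X (\<lambda>y. (a * w y) \<bullet> c)" by simp
qed

text \<open>The noncommutative product is expanded from the left, one factor at a time, so that only
  scalar functions and left multiplication by the constants v_i occur.\<close>

lemma vec_ext_prod_list:
  fixes v :: "nat \<Rightarrow> 'a::{real_algebra_1,euclidean_space}"
  assumes "vec_ext X w" "\<And>h. h \<in> set hs \<Longrightarrow> finite (B h)" "\<And>h i. h \<in> set hs \<Longrightarrow> i \<in> B h \<Longrightarrow> hol_ext X (\<lambda>y. u i y)"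
  shows "vec_ext X (\<lambda>y. prod_list (map (\<lambda>h. \<Sum>i\<in>B h. u i y *\<^sub>R v i) hs) * w y)"
  using assms(2,3)
proof (induction hs)
  case (Cons h hs)
  have "vec_ext X (\<lambda>y. \<Sum>i\<in>B h. u i y *\<^sub>R (v i * (prod_list (map (\<lambda>h. \<Sum>i\<in>B h. u i y *\<^sub>R v i) hs) * w y)))"
    by (intro vec_ext_sum vec_ext_scaleR vec_ext_mult_left Cons.IH) (use Cons.prems in auto)
  then show ?case by (simp add: mult.assoc sum_distrib_right)
qed (simp add: assms(1))

lemma vec_ext_imp_power_series:
  fixes w :: "(nat \<Rightarrow> real) \<Rightarrow> 'a::euclidean_space"
  assumes X: "finite X" and w: "vec_ext X w" and local: "\<And>y. w y = w (\<lambda>i. if i \<in> X then y i else 0)"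
  shows "\<exists>r>0. \<exists>c. \<forall>y. (\<forall>i\<in>X. \<bar>y i\<bar> < r) \<longrightarrow> ((\<lambda>k. (\<Prod>i\<in>X. y i ^ k i) *\<^sub>R c k) has_sum w y) (X \<rightarrow>\<^sub>E UNIV)"
proof -
  have "\<forall>b\<in>Basis. \<exists>p. fst p > 0 \<and> has_power_series X (fst p) (snd p) (\<lambda>y. w y \<bullet> b)"
  proof
    fix b :: 'a assume b: "b \<in> Basis"
    obtain r c where "r > 0" "has_power_series X r c (\<lambda>y. w y \<bullet> b)"
      by (rule hol_ext_imp_power_series [OF X, of "\<lambda>y. w y \<bullet> b"]) (use w b local in \<open>auto simp: vec_ext_def\<close>)
    then show "\<exists>p. fst p > 0 \<and> has_power_series X (fst p) (snd p) (\<lambda>y. w y \<bullet> b)"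
      by (intro exI [of _ "(r, c)"]) simp
  qed
  from bchoice [OF this] obtain p where p: "\<And>b. b \<in> Basis \<Longrightarrow> fst (p b) > 0"
    "\<And>b. b \<in> Basis \<Longrightarrow> has_power_series X (fst (p b)) (snd (p b)) (\<lambda>y. w y \<bullet> b)" by blast
  define r where "r = Min ((\<lambda>b. fst (p b)) ` (Basis :: 'a set))"
  have r: "r > 0" unfolding r_def by (subst Min_gr_iff) (use p in auto)
  have rle: "r \<le> fst (p b)" if "b \<in> Basis" for b unfolding r_def using that by (intro Min_le) auto
  define c where "c k = (\<Sum>b\<in>Basis. snd (p b) k *\<^sub>R b)" for k
  show ?thesis
  proof (intro exI [of _ r] exI [of _ c] conjI allI impI r)
    fix y :: "nat \<Rightarrow> real" assume y: "\<forall>i\<in>X. \<bar>y i\<bar> < r"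
    have s: "((\<lambda>k. ((\<Prod>i\<in>X. y i ^ k i) * snd (p b) k) *\<^sub>R b) has_sum (w y \<bullet> b) *\<^sub>R b) (X \<rightarrow>\<^sub>E UNIV)"
      if b: "b \<in> Basis" for b
    proof -
      have "((\<lambda>k. (\<Prod>i\<in>X. y i ^ k i) * snd (p b) k) has_sum (w y \<bullet> b)) (X \<rightarrow>\<^sub>E UNIV)"
        using p(2) [OF b] y rle [OF b] unfolding has_power_series_def by force
      then show ?thesis by (rule has_sum_bounded_linear [OF bounded_linear_scaleR_left])
    qed
    have "((\<lambda>k. \<Sum>b\<in>S. ((\<Prod>i\<in>X. y i ^ k i) * snd (p b) k) *\<^sub>R b) has_sum (\<Sum>b\<in>S. (w y \<bullet> b) *\<^sub>R b)) (X \<rightarrow>\<^sub>E UNIV)"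
      if "finite S" "S \<subseteq> Basis" for S
      using that by (induction S rule: finite_induct) (auto intro!: has_sum_add s)
    from this [of Basis] show "((\<lambda>k. (\<Prod>i\<in>X. y i ^ k i) *\<^sub>R c k) has_sum w y) (X \<rightarrow>\<^sub>E UNIV)"
      by (simp add: c_def scaleR_right.sum euclidean_representation)
  qed
qed

lemma ordered_prod_scaleR:
  fixes J :: "nat \<Rightarrow> 'a::real_algebra_1"
  assumes "finite K"
  shows "ordered_prod (\<lambda>h. s h *\<^sub>R J h) K = (\<Prod>h\<in>K. s h) *\<^sub>R ordered_prod J K"
  using assms
proof (induction K rule: finite_linorder_max_induct)
  case empty
  show ?case by simp
next
  case (insert m K)
  have "m \<notin> K" using insert.hyps by blast
  then show ?case
    using insert.hyps insert.IH by (simp add: ordered_prod_insert_max mult.commute)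
qed

lemma ordered_prod_cong: "finite K \<Longrightarrow> (\<And>h. h \<in> K \<Longrightarrow> I h = J h) \<Longrightarrow> ordered_prod I K = ordered_prod J K"
  unfolding ordered_prod_def by (intro arg_cong [of _ _ prod_list] map_cong) auto

text \<open>The disc of radius a^2 about a^2 lies in the open right half-plane, where
  \<open>csqrt\<close> is holomorphic without zeros. It will extend a block norm with value a > 0 at
  the centre, and its reciprocal.\<close>

lemma csqrt_ball:
  assumes a: "a > 0"
  shows "(\<lambda>w. csqrt (of_real (a\<^sup>2) + w)) holomorphic_on ball 0 (a\<^sup>2)"
    "w \<in> ball 0 (a\<^sup>2) \<Longrightarrow> csqrt (of_real (a\<^sup>2) + w) \<noteq> 0"
    "\<bar>t\<bar> < a\<^sup>2 \<Longrightarrow> csqrt (of_real (a\<^sup>2) + of_real t) = of_real (sqrt (a\<^sup>2 + t))"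
proof -
  have pos: "Re (of_real (a\<^sup>2) + w) > 0" if "w \<in> ball 0 (a\<^sup>2)" for w
    using that abs_Re_le_cmod [of w] by (simp add: abs_le_iff)
  then show "(\<lambda>w. csqrt (of_real (a\<^sup>2) + w)) holomorphic_on ball 0 (a\<^sup>2)"
    by (intro holomorphic_on_csqrt' holomorphic_intros) (force simp: complex_nonpos_Reals_iff)
  show "csqrt (of_real (a\<^sup>2) + w) \<noteq> 0" if "w \<in> ball 0 (a\<^sup>2)" using pos [OF that] by (metis csqrt_eq_0 less_irrefl zero_complex.sel(1))
  show "csqrt (of_real (a\<^sup>2) + of_real t) = of_real (sqrt (a\<^sup>2 + t))" if "\<bar>t\<bar> < a\<^sup>2"
    using that by (subst of_real_add [symmetric], subst of_real_sqrt) auto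
qed

context T_setting begin

text \<open>Each reflection of \<beta> is traded for a sign change of I, which stays in the torus;
  the summands are then monogenic functions of different slices at one and the same parameter
  point.\<close>

lemma stem_comp_ext:
  assumes D: "(\<alpha>0, \<beta>0) \<in> D" and I: "I \<in> TT"
  shows "vec_ext {..<N} (\<lambda>y. stem_comp \<tau> I f K
    (\<alpha>0 + (\<Sum>i\<in>{0..t 0}. y i *\<^sub>R v i), \<lambda>h. \<beta>0 h + y (t 0 + h)))"
proof -
  define x0 where "x0 = unpt \<alpha>0 \<beta>0"
  have flip: "(\<lambda>h. if h \<in> H then - I h else I h) \<in> TT" if "H \<subseteq> {1..\<tau>}" for H
    using I that sphere_minus by (auto simp: torus_iff extensional_def)
  have Lam: "Lam J (x0 + (\<Sum>i<N. y i *\<^sub>R bb i)) =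
      \<alpha>0 + (\<Sum>i\<in>{0..t 0}. y i *\<^sub>R v i) + torus_comb \<tau> (\<lambda>h. \<beta>0 h + y (t 0 + h)) J" for J y
  proof -
    have lin: "linear (Lam J)" by (rule bounded_linear.linear [OF bounded_linear_Lam])
    have "Lam J (x0 + (\<Sum>i<N. y i *\<^sub>R bb i)) = Lam J x0 + (\<Sum>i<N. y i *\<^sub>R e J i)"
      by (simp add: linear_add [OF lin] linear_sum [OF lin] linear_cmul [OF lin] Lam_bb)
    also have "\<dots> = \<alpha>0 + torus_comb \<tau> \<beta>0 J + ((\<Sum>i\<in>{0..t 0}. y i *\<^sub>R v i) + (\<Sum>h\<in>{1..\<tau>}. y (t 0 + h) *\<^sub>R J h))"
      unfolding sum_N x0_def Lam_unpt [OF D] by (simp add: e_def)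
    finally show ?thesis by (simp add: torus_comb_def scaleR_add_left sum.distrib)
  qed
  have ext: "vec_ext {..<N} (\<lambda>y. f (Lam J (x0 + (\<Sum>i<N. y i *\<^sub>R bb i))))" if J: "J \<in> TT" for J
  proof -
    interpret cs: cr_system N bb "e J" "eb J" by (rule cr_system_e [OF J])
    show ?thesis unfolding vec_ext_def x0_def
      by (intro ballI cs.hol_ext_monogenic [OF monogenic_g [OF J] Lam_unpt(1) [OF D]])
  qed
  have "vec_ext {..<N} (\<lambda>y. (1 / 2 ^ \<tau>) *\<^sub>R (\<Sum>H\<in>Pow {1..\<tau>}. (- 1) ^ card (K \<inter> H) *\<^sub>R
      (ordered_inv I K * f (Lam (\<lambda>h. if h \<in> H then - I h else I h) (x0 + (\<Sum>i<N. y i *\<^sub>R bb i))))))"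
    by (intro vec_ext_scaleR hol_ext_const vec_ext_sum vec_ext_mult_left ext flip) auto
  then show ?thesis by (simp add: Lam stem_comp_def torus_comb_reflect)
qed

text \<open>With \<beta>0 nonnegative, \<beta>0_h is the norm of the h-th block at p itself, the
  branch that \<open>sqrt\<close> follows nearby.\<close>

lemma nonneg_representative:
  assumes "p \<in> \<Omega>"
  obtains \<alpha>0 \<beta>0 J0 where "(\<alpha>0, \<beta>0) \<in> D" "J0 \<in> TT" "p = \<alpha>0 + torus_comb \<tau> \<beta>0 J0"
    "\<And>h. h \<in> {1..\<tau>} \<Longrightarrow> 0 \<le> \<beta>0 h"
proof -
  obtain \<alpha>0 \<beta> J where D: "(\<alpha>0, \<beta>) \<in> D" and J: "J \<in> TT" and p: "p = \<alpha>0 + torus_comb \<tau> \<beta> J"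
    using assms by (auto simp: T_symmetrize_def)
  define H where "H = {h\<in>{1..\<tau>}. \<beta> h < 0}"
  define J0 where "J0 = (\<lambda>h. if h \<in> H then - J h else J h)"
  have "H \<subseteq> {1..\<tau>}" by (auto simp: H_def)
  show thesis
  proof (rule that)
    show "(\<alpha>0, reflect H \<beta>) \<in> D" by (rule D_reflect_set [OF D]) fact
    show "J0 \<in> TT" using J sphere_minus \<open>H \<subseteq> _\<close> by (auto simp: J0_def torus_iff extensional_def)
    show "p = \<alpha>0 + torus_comb \<tau> (reflect H \<beta>) J0"
      unfolding torus_comb_reflect p J0_def by (intro arg_cong2 [of _ _ _ _ "(+)"] refl torus_comb_cong) auto
    show "0 \<le> reflect H \<beta> h" if "h \<in> {1..\<tau>}" for h using that by (auto simp: reflect_def H_def)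
  qed
qed

lemma stem_comp_cong:
  "(\<And>h. h \<in> {1..\<tau>} \<Longrightarrow> \<beta> h = \<beta>' h) \<Longrightarrow> stem_comp \<tau> I f K (\<alpha>, \<beta>) = stem_comp \<tau> I f K (\<alpha>, \<beta>')"
proof -
  assume a: "\<And>h. h \<in> {1..\<tau>} \<Longrightarrow> \<beta> h = \<beta>' h"
  have "torus_comb \<tau> (reflect H \<beta>) I = torus_comb \<tau> (reflect H \<beta>') I" for H
    by (rule torus_comb_cong) (use a in \<open>auto simp: reflect_def\<close>)
  then show ?thesis by (simp add: stem_comp_def)
qed

text \<open>In the expansion by stem components J_h is the h-th block of coordinates divided by its
  norm. If \<beta>0_h > 0, this norm and its reciprocal are analytic near p. If \<beta>0_h = 0 and h
  is in K, the component of index K is odd in \<beta>_h and carries a factor equal to the norm,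
  which cancels the denominator.\<close>

lemma real_analytic: "real_analytic_on v n \<Omega> f"
  unfolding real_analytic_on_def
proof
  fix p assume p\<Omega>: "p \<in> \<Omega>"
  obtain \<alpha>0 \<beta>0 I where D: "(\<alpha>0, \<beta>0) \<in> D" and I: "I \<in> TT" and p: "p = \<alpha>0 + torus_comb \<tau> \<beta>0 I"
    and \<beta>0: "\<And>h. h \<in> {1..\<tau>} \<Longrightarrow> 0 \<le> \<beta>0 h"
    by (rule nonneg_representative [OF p\<Omega>], rule that, assumption+)
  let ?X = "{0..n}"
  define Y where "Y y = p + (\<Sum>i\<in>?X. y i *\<^sub>R v i)" for y :: "nat \<Rightarrow> real"
  have coordY: "coord i (Y y) = coord i p + y i" if "i \<le> n" for i y
    using that nd by (simp add: Y_def coord_add coord_sum)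
  obtain r0 where r0: "r0 > 0" "\<And>y. \<forall>i\<in>?X. \<bar>y i\<bar> < r0 \<Longrightarrow> Y y \<in> \<Omega>"
  proof -
    have "openin (top_of_set V) \<Omega>" using dom by (auto simp: T_slice_domain_def domain_in_def)
    then obtain \<epsilon> where \<epsilon>: "\<epsilon> > 0" "ball p \<epsilon> \<inter> V \<subseteq> \<Omega>" and "\<Omega> \<subseteq> V"
      using p\<Omega> unfolding openin_contains_ball by blast
    have V: "V = span (v ` ?X)" using hyper by (auto simp: hypercomplex_basis_def ordered_basis_def)
    define C where "C = (\<Sum>i\<in>?X. norm (v i)) + 1"
    have C: "C > 0" by (simp add: C_def add_nonneg_pos sum_nonneg)
    show thesis
    proof (rule that [of "\<epsilon> / C"])
      fix y :: "nat \<Rightarrow> real" assume y: "\<forall>i\<in>?X. \<bar>y i\<bar> < \<epsilon> / C"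
      have "norm (\<Sum>i\<in>?X. y i *\<^sub>R v i) \<le> (\<Sum>i\<in>?X. \<epsilon> / C * norm (v i))"
        by (rule sum_norm_le, unfold norm_scaleR real_norm_def, rule mult_right_mono)
          (use y in \<open>auto intro: less_imp_le\<close>)
      also have "\<dots> = \<epsilon> / C * (C - 1)" by (simp add: C_def sum_distrib_left)
      also have "\<dots> < \<epsilon>" using \<epsilon> C by (simp add: field_simps)
      finally have "Y y \<in> ball p \<epsilon>" by (simp add: Y_def dist_norm)
      moreover have "Y y \<in> V"
      proof -
        have "p \<in> span (v ` ?X)" using p\<Omega> \<open>\<Omega> \<subseteq> V\<close> V by auto
        then show ?thesis unfolding V Y_def by (intro span_add span_sum span_mul) (auto intro: span_base)
      qed
      ultimately show "Y y \<in> \<Omega>" using \<epsilon> by blast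
    qed (use \<epsilon> C in simp)
  qed
  \<comment> \<open>Squared norm of the h-th block at the point \<open>Y y\<close>; at y = 0 it is
    the square of \<beta>0_h.\<close>
  define s where "s h y = (\<Sum>i\<in>blk h. (coord i p + y i)\<^sup>2)" for h and y :: "nat \<Rightarrow> real"
  define Z0 where "Z0 = {h\<in>{1..\<tau>}. \<beta>0 h = 0}"
  have cp: "coord i p = \<beta>0 h * coord i (I h)" if "h \<in> {1..\<tau>}" "i \<in> blk h" for h i
  proof -
    have "\<not> i \<le> t 0" "i \<le> d" using blk_sub [OF that(1)] that(2) nd by auto
    then have "coord i \<alpha>0 = 0" by (subst D_sub(1) [OF D]) (simp add: coord_mirror)
    then show ?thesis by (simp add: p coord_add coord_torus_comb_blk [OF I that])
  qed
  have scp: "(\<Sum>i\<in>blk h. (coord i p)\<^sup>2) = (\<beta>0 h)\<^sup>2" if h: "h \<in> {1..\<tau>}" for h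
  proof -
    have "(\<Sum>i\<in>blk h. (coord i p)\<^sup>2) = (\<Sum>i\<in>blk h. (\<beta>0 h)\<^sup>2 * (coord i (I h))\<^sup>2)"
      by (intro sum.cong refl) (simp add: cp [OF h] power_mult_distrib)
    then show ?thesis using torusD(2) [OF I h] by (simp flip: sum_distrib_left)
  qed
  have s_small: "small_ext ?X (\<lambda>y. s h y - (\<beta>0 h)\<^sup>2)" if h: "h \<in> {1..\<tau>}" for h
  proof -
    have "small_ext ?X (\<lambda>y. \<Sum>i\<in>blk h. (2 * coord i p + y i) * y i)"
      using blk_sub1 [OF h]
      by (intro small_ext_sum small_ext_mult hol_ext_add hol_ext_const small_ext_imp_hol_ext small_ext_coord) auto
    moreover have "(\<Sum>i\<in>blk h. (2 * coord i p + y i) * y i) = s h y - (\<beta>0 h)\<^sup>2" for y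
      unfolding scp [OF h, symmetric] s_def sum_subtractf [symmetric]
      by (intro sum.cong refl) (simp add: power2_eq_square algebra_simps)
    ultimately show ?thesis by simp
  qed
  have s_nonneg: "0 \<le> s h y" for h y by (simp add: s_def sum_nonneg)
  have sqrt_small: "small_ext ?X (\<lambda>y. sqrt (s h y) - \<beta>0 h)" and inv_ext: "hol_ext ?X (\<lambda>y. 1 / sqrt (s h y))"
    if h: "h \<in> {1..\<tau>} - Z0" for h
  proof -
    have b: "\<beta>0 h > 0" using h \<beta>0 [of h] by (auto simp: Z0_def)
    note s = s_small [of h]
    have "small_ext ?X (\<lambda>y. sqrt ((\<beta>0 h)\<^sup>2 + (s h y - (\<beta>0 h)\<^sup>2)) - sqrt ((\<beta>0 h)\<^sup>2 + 0))"
      by (rule small_ext_compose(1) [OF s _ csqrt_ball(1) [OF b] csqrt_ball(3) [OF b]]) (use h b in auto)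
    then show "small_ext ?X (\<lambda>y. sqrt (s h y) - \<beta>0 h)" using b by simp
    have "hol_ext ?X (\<lambda>y. (\<lambda>t. 1 / sqrt ((\<beta>0 h)\<^sup>2 + t)) (s h y - (\<beta>0 h)\<^sup>2))"
    proof (rule small_ext_compose(2) [OF s])
      show "(\<lambda>w. 1 / csqrt (of_real ((\<beta>0 h)\<^sup>2) + w)) holomorphic_on ball 0 ((\<beta>0 h)\<^sup>2)"
        using csqrt_ball(2) [OF b] by (intro holomorphic_intros csqrt_ball(1) b) auto
      show "1 / csqrt (of_real ((\<beta>0 h)\<^sup>2) + of_real t) = of_real (1 / sqrt ((\<beta>0 h)\<^sup>2 + t))" if "\<bar>t\<bar> < (\<beta>0 h)\<^sup>2" for t
        unfolding csqrt_ball(3) [OF b that] by simp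
    qed (use h b in auto)
    then show "hol_ext ?X (\<lambda>y. 1 / sqrt (s h y))" by simp
  qed
  \<comment> \<open>Displacement of the slice parameters caused by y: mirror coordinates are copied,
    and \<beta>_h moves from \<beta>0_h to sqrt (s h y). For h in \<open>Z0\<close> this is the root
    itself, which is not analytic while its square is.\<close>
  define \<gamma> where "\<gamma> y i = (if i \<le> t 0 then y i else if i < N then sqrt (s (i - t 0) y) - \<beta>0 (i - t 0) else 0)" for y i
  have \<gamma>h: "\<beta>0 h + \<gamma> y (t 0 + h) = sqrt (s h y)" if "h \<in> {1..\<tau>}" for y h
    using that by (auto simp: \<gamma>_def N_def)
  define A where "A y = (\<alpha>0 + (\<Sum>i\<in>{0..t 0}. y i *\<^sub>R v i), \<lambda>h. \<beta>0 h + y (t 0 + h))" for y :: "nat \<Rightarrow> real"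
  define Z where "Z = (\<lambda>h. t 0 + h) ` Z0"
  define \<kappa> where "\<kappa> K i = (if t 0 < i \<and> i - t 0 \<in> K then 1 else 0 :: nat)" for K i
  have \<Phi>: "\<exists>\<Phi> \<rho>. hol_ext ?X \<Phi> \<and> \<rho> > 0 \<and> (\<forall>y. (\<forall>i\<in>?X. \<bar>y i\<bar> < \<rho>) \<longrightarrow>
      stem_comp \<tau> I f K (A (\<gamma> y)) \<bullet> c = (\<Prod>h\<in>Z0 \<inter> K. sqrt (s h y)) * \<Phi> y)" if c: "c \<in> Basis" for K c
  proof -
    obtain \<Phi> \<rho> where P: "hol_ext ?X \<Phi>" "\<rho> > 0"
      "\<And>y. \<forall>i\<in>?X. \<bar>y i\<bar> < \<rho> \<Longrightarrow> (\<lambda>y. stem_comp \<tau> I f K (A y) \<bullet> c) (\<gamma> y) = (\<Prod>i\<in>Z. \<gamma> y i ^ \<kappa> K i) * \<Phi> y"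
    proof (rule hol_ext_substitution [of "{..<N}" Z "\<lambda>y. stem_comp \<tau> I f K (A y) \<bullet> c" "\<kappa> K" ?X \<gamma>])
      show "Z \<subseteq> {..<N}" by (auto simp: Z_def Z0_def N_def)
      show "hol_ext {..<N} (\<lambda>y. stem_comp \<tau> I f K (A y) \<bullet> c)"
        using stem_comp_ext [OF D I, of K] c unfolding vec_ext_def A_def by blast
      show "stem_comp \<tau> I f K (A y) \<bullet> c = stem_comp \<tau> I f K (A (\<lambda>i. if i \<in> {..<N} then y i else 0)) \<bullet> c" for y
      proof -
        have "(\<Sum>i\<in>{0..t 0}. y i *\<^sub>R v i) = (\<Sum>i\<in>{0..t 0}. (if i \<in> {..<N} then y i else 0) *\<^sub>R v i)"
          by (intro sum.cong refl) (auto simp: N_def)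
        then show ?thesis unfolding A_def
          by (intro arg_cong [of _ _ "\<lambda>x. x \<bullet> c"]) (simp only:, rule stem_comp_cong, auto simp: N_def)
      qed
      show "stem_comp \<tau> I f K (A (y(i := - y i))) \<bullet> c = (- 1) ^ \<kappa> K i * (stem_comp \<tau> I f K (A y) \<bullet> c)" if "i \<in> Z" for i y
      proof -
        obtain h where h: "h \<in> {1..\<tau>}" "\<beta>0 h = 0" "i = t 0 + h" using \<open>i \<in> Z\<close> by (auto simp: Z_def Z0_def)
        have "A (y(i := - y i)) = (fst (A y), reflect {h} (snd (A y)))"
          unfolding A_def using h by (auto simp: reflect_def fun_eq_iff intro!: sum.cong)
        then show ?thesis
          using stem_comp_reflect [OF h(1), of I f K "fst (A y)" "snd (A y)"] h by (auto simp: \<kappa>_def)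
      qed
      show "\<kappa> K i \<le> 1" for i by (simp add: \<kappa>_def)
      show "small_ext ?X (\<lambda>y. \<gamma> y i)" if i: "i \<in> {..<N} - Z" for i
      proof -
        have "i < N" using i by simp
        then show ?thesis
        proof (cases rule: less_N_cases)
          case 1
          then show ?thesis using t0_le by (simp add: \<gamma>_def small_ext_coord)
        next
          case (2 h)
          then have "h \<in> {1..\<tau>} - Z0" using i by (auto simp: Z_def)
          then show ?thesis using sqrt_small [of h] 2 by (auto simp: \<gamma>_def N_def)
        qed
      qed
      show "small_ext ?X (\<lambda>y. (\<gamma> y i)\<^sup>2)" if i: "i \<in> Z" for i
      proof -
        obtain h where h: "h \<in> {1..\<tau>}" "\<beta>0 h = 0" "i = t 0 + h" using i by (auto simp: Z_def Z0_def)
        then have "(\<lambda>y. (\<gamma> y i)\<^sup>2) = (\<lambda>y. s h y - (\<beta>0 h)\<^sup>2)" by (auto simp: \<gamma>_def N_def s_nonneg)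
        then show ?thesis using s_small [OF h(1)] by simp
      qed
    qed (use that in auto)
    have "(\<Prod>i\<in>Z. \<gamma> y i ^ \<kappa> K i) = (\<Prod>h\<in>Z0 \<inter> K. sqrt (s h y))" for y
    proof -
      have "(\<Prod>i\<in>Z. \<gamma> y i ^ \<kappa> K i) = (\<Prod>h\<in>Z0. if h \<in> K then sqrt (s h y) else 1)"
        unfolding Z_def by (subst prod.reindex) (auto simp: inj_on_def \<kappa>_def \<gamma>_def N_def Z0_def intro!: prod.cong)
      then show ?thesis by (simp add: prod.If_cases Z0_def)
    qed
    then show ?thesis using P by (intro exI [of _ \<Phi>] exI [of _ \<rho>]) simp
  qed
  \<comment> \<open>The analytic factor and its radius are chosen simultaneously for all pairs (K,
    c), so that they can be combined in \<open>W\<close> and in the minimum \<rho>2.\<close>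
  have "\<forall>q. \<exists>p. snd q \<in> Basis \<longrightarrow> hol_ext ?X (fst p) \<and> snd p > 0 \<and> (\<forall>y. (\<forall>i\<in>?X. \<bar>y i\<bar> < snd p) \<longrightarrow>
      stem_comp \<tau> I f (fst q) (A (\<gamma> y)) \<bullet> snd q = (\<Prod>h\<in>Z0 \<inter> fst q. sqrt (s h y)) * fst p y)"
  proof
    fix q :: "nat set \<times> 'a"
    show "\<exists>p. snd q \<in> Basis \<longrightarrow> hol_ext ?X (fst p) \<and> snd p > 0 \<and> (\<forall>y. (\<forall>i\<in>?X. \<bar>y i\<bar> < snd p) \<longrightarrow>
      stem_comp \<tau> I f (fst q) (A (\<gamma> y)) \<bullet> snd q = (\<Prod>h\<in>Z0 \<inter> fst q. sqrt (s h y)) * fst p y)"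
    proof (cases "snd q \<in> Basis")
      case True
      from \<Phi> [OF this, of "fst q"] obtain \<Phi> \<rho> where "hol_ext ?X \<Phi>" "\<rho> > 0" "\<forall>y. (\<forall>i\<in>?X. \<bar>y i\<bar> < \<rho>) \<longrightarrow>
        stem_comp \<tau> I f (fst q) (A (\<gamma> y)) \<bullet> snd q = (\<Prod>h\<in>Z0 \<inter> fst q. sqrt (s h y)) * \<Phi> y" by blast
      then show ?thesis by (intro exI [of _ "(\<Phi>, \<rho>)"]) simp
    qed simp
  qed
  from choice [OF this] obtain P where P: "\<forall>q. snd q \<in> Basis \<longrightarrow> hol_ext ?X (fst (P q)) \<and> snd (P q) > 0 \<and>
      (\<forall>y. (\<forall>i\<in>?X. \<bar>y i\<bar> < snd (P q)) \<longrightarrow>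
      stem_comp \<tau> I f (fst q) (A (\<gamma> y)) \<bullet> snd q = (\<Prod>h\<in>Z0 \<inter> fst q. sqrt (s h y)) * fst (P q) y)"
    by blast
  define \<Phi> where "\<Phi> K c = fst (P (K, c))" for K c
  define \<rho> where "\<rho> K c = snd (P (K, c))" for K c
  have \<Phi>: "hol_ext ?X (\<Phi> K c)" "\<rho> K c > 0"
    "\<forall>i\<in>?X. \<bar>y i\<bar> < \<rho> K c \<Longrightarrow> stem_comp \<tau> I f K (A (\<gamma> y)) \<bullet> c = (\<Prod>h\<in>Z0 \<inter> K. sqrt (s h y)) * \<Phi> K c y"
    if "c \<in> Basis" for K c y
    using P [rule_format, of "(K, c)"] that by (auto simp: \<Phi>_def \<rho>_def)
  \<comment> \<open>Near p the blocks outside \<open>Z0\<close> stay away from 0, so their norms may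
    be cancelled.\<close>
  have pos: "\<exists>\<rho>>0. \<forall>h\<in>{1..\<tau>} - Z0. \<forall>y. (\<forall>i\<in>?X. \<bar>y i\<bar> < \<rho>) \<longrightarrow> s h y > 0"
  proof -
    have "\<exists>\<rho>>0. \<rho> \<le> 1 \<and> (\<forall>h\<in>{1..\<tau>} - Z0. hol_ext_at ?X \<rho> ((\<beta>0 h)\<^sup>2 / 2) (\<lambda>y. s h y - (\<beta>0 h)\<^sup>2))"
      by (rule small_ext_uniform) (use s_small in \<open>auto simp: Z0_def\<close>)
    then obtain \<rho> where \<rho>: "\<rho> > 0" "\<And>h. h \<in> {1..\<tau>} - Z0 \<Longrightarrow> hol_ext_at ?X \<rho> ((\<beta>0 h)\<^sup>2 / 2) (\<lambda>y. s h y - (\<beta>0 h)\<^sup>2)"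
      by blast
    have "s h y > 0" if h: "h \<in> {1..\<tau>} - Z0" and y: "\<forall>i\<in>?X. \<bar>y i\<bar> < \<rho>" for h y
    proof -
      have "\<bar>s h y - (\<beta>0 h)\<^sup>2\<bar> \<le> (\<beta>0 h)\<^sup>2 / 2" by (rule hol_ext_at_real_bound [OF \<rho>(2) [OF h] y])
      moreover have "(\<beta>0 h)\<^sup>2 > 0" using h by (auto simp: Z0_def)
      ultimately show ?thesis by linarith
    qed
    then show ?thesis using \<rho> by blast
  qed
  then obtain \<rho>1 where \<rho>1: "\<rho>1 > 0" "\<And>h y. h \<in> {1..\<tau>} - Z0 \<Longrightarrow> \<forall>i\<in>?X. \<bar>y i\<bar> < \<rho>1 \<Longrightarrow> s h y > 0" by blast
  define \<rho>2 where "\<rho>2 = Min ((\<lambda>(K, c). \<rho> K c) ` (Pow {1..\<tau>} \<times> (Basis :: 'a set)))"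
  have \<rho>2: "\<rho>2 > 0" unfolding \<rho>2_def by (subst Min_gr_iff) (use \<Phi>(2) in auto)
  have \<rho>2le: "\<rho>2 \<le> \<rho> K c" if "K \<in> Pow {1..\<tau>}" "c \<in> Basis" for K c
    unfolding \<rho>2_def by (rule Min_le) (use that in auto)
  define R where "R = min r0 (min \<rho>1 \<rho>2)"
  have R: "R > 0" using r0 \<rho>1 \<rho>2 by (simp add: R_def)
  define xh where "xh y h = (\<Sum>i\<in>blk h. (coord i p + y i) *\<^sub>R v i)" for y :: "nat \<Rightarrow> real" and h
  \<comment> \<open>\<open>xh\<close> is polynomial in y, and its ordered product is that of J times
    the norms of all blocks in K. The reciprocals outside \<open>Z0\<close> leave exactly those
    norms that the odd stem component supplies.\<close>
  define W where "W y = (\<Sum>K\<in>Pow {1..\<tau>}. \<Sum>c\<in>Basis.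
      ((\<Prod>h\<in>K - Z0. 1 / sqrt (s h y)) * \<Phi> K c y) *\<^sub>R (ordered_prod (xh y) K * c))" for y
  have W: "vec_ext ?X W"
    unfolding W_def
  proof (intro vec_ext_sum vec_ext_scaleR hol_ext_mult hol_ext_prod \<Phi>)
    fix K c h assume K: "K \<in> Pow {1..\<tau>}" "h \<in> K - Z0"
    then show "hol_ext ?X (\<lambda>y. 1 / sqrt (s h y))" by (intro inv_ext) auto
  next
    fix K and c :: 'a assume K: "K \<in> Pow {1..\<tau>}" "c \<in> Basis"
    then have "finite K" by (auto intro: finite_subset)
    have "vec_ext ?X (\<lambda>y. prod_list (map (\<lambda>h. \<Sum>i\<in>blk h. (coord i p + y i) *\<^sub>R v i) (sorted_list_of_set K)) * c)"
    proof (rule vec_ext_prod_list [OF vec_ext_const])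
      fix h i assume "h \<in> set (sorted_list_of_set K)" "i \<in> blk h"
      then have "h \<in> {1..\<tau>}" using K \<open>finite K\<close> by auto
      then have "i \<in> ?X" using blk_sub1 [of h] \<open>i \<in> blk h\<close> by auto
      then show "hol_ext ?X (\<lambda>y. coord i p + y i)"
        by (intro hol_ext_add hol_ext_const small_ext_imp_hol_ext small_ext_coord)
    qed auto
    then show "vec_ext ?X (\<lambda>y. ordered_prod (xh y) K * c)"
      by (simp add: ordered_prod_def xh_def [abs_def])
  qed (auto intro: finite_subset)
  have fW: "f (Y y) = W y" if y: "\<forall>i\<in>?X. \<bar>y i\<bar> < R" for y
  proof -
    have y0: "\<forall>i\<in>?X. \<bar>y i\<bar> < r0" "\<forall>i\<in>?X. \<bar>y i\<bar> < \<rho>1" "\<forall>i\<in>?X. \<bar>y i\<bar> < \<rho>2" using y by (auto simp: R_def)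
    \<comment> \<open>Where a block vanishes any unit represents the point, its coefficient being 0;
      \<open>I h\<close> is taken in order to stay in the torus.\<close>
    define J where "J = (\<lambda>h\<in>{1..\<tau>}. if s h y = 0 then I h else (1 / sqrt (s h y)) *\<^sub>R xh y h)"
    have xJ: "xh y h = sqrt (s h y) *\<^sub>R J h" if h: "h \<in> {1..\<tau>}" for h
    proof (cases "s h y = 0")
      case True
      then have "coord i p + y i = 0" if "i \<in> blk h" for i
        using that by (simp add: s_def sum_nonneg_eq_0_iff)
      then show ?thesis using True by (simp add: xh_def)
    next
      case False
      then show ?thesis using h s_nonneg [of h y] by (simp add: J_def)
    qed
    have J: "J \<in> TT"
      unfolding torus_iff
    proof (intro conjI ballI)
      show "J \<in> extensional {1..\<tau>}" by (simp add: J_def)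
      fix h assume h: "h \<in> {1..\<tau>}"
      show "J h \<in> sph h"
      proof (cases "s h y = 0")
        case True
        then show ?thesis using torus_component [OF I h] h by (simp add: J_def)
      next
        case False
        have Jh: "J h = (\<Sum>i\<in>blk h. ((coord i p + y i) / sqrt (s h y)) *\<^sub>R v i)"
          using False h by (simp add: J_def xh_def scaleR_right.sum)
        have c: "coord i (J h) = (coord i p + y i) / sqrt (s h y)" if "i \<in> blk h" for i
          unfolding Jh using that blk_subd [OF h] by (subst coord_sum) auto
        have "(\<Sum>i\<in>blk h. (coord i (J h))\<^sup>2) = (\<Sum>i\<in>blk h. (coord i p + y i)\<^sup>2 / s h y)"
          by (intro sum.cong refl) (simp add: c power_divide s_nonneg)
        also have "\<dots> = 1" using False by (simp add: s_def flip: sum_divide_distrib)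
        finally show ?thesis unfolding sphere_iff [OF h] using Jh c by simp
      qed
    qed
    have YJ: "Y y = fst (A (\<gamma> y)) + torus_comb \<tau> (\<lambda>h. sqrt (s h y)) J"
    proof -
      have "{0..n} = {0..t 0} \<union> {t 0 + 1..t \<tau>}" using t0_le t_tau by auto
      then have "(\<Sum>i\<in>?X. y i *\<^sub>R v i) = (\<Sum>i\<in>{0..t 0}. y i *\<^sub>R v i) + (\<Sum>i\<in>{t 0 + 1..t \<tau>}. y i *\<^sub>R v i)"
        by (simp only:) (rule sum.union_disjoint, auto)
      also have "(\<Sum>i\<in>{t 0 + 1..t \<tau>}. y i *\<^sub>R v i) = (\<Sum>h\<in>{1..\<tau>}. \<Sum>i\<in>blk h. y i *\<^sub>R v i)"
        unfolding blk_cover [OF order_refl] by (rule sum.UNION_disjoint) (use blk_disjoint in auto)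
      finally have "Y y = fst (A (\<gamma> y)) + (torus_comb \<tau> \<beta>0 I + (\<Sum>h\<in>{1..\<tau>}. \<Sum>i\<in>blk h. y i *\<^sub>R v i))"
        by (simp add: Y_def p A_def \<gamma>_def)
      also have "torus_comb \<tau> \<beta>0 I + (\<Sum>h\<in>{1..\<tau>}. \<Sum>i\<in>blk h. y i *\<^sub>R v i) = (\<Sum>h\<in>{1..\<tau>}. xh y h)"
        unfolding torus_comb_def sum.distrib [symmetric]
      proof (intro sum.cong refl)
        fix h assume h: "h \<in> {1..\<tau>}"
        have "\<beta>0 h *\<^sub>R I h = \<beta>0 h *\<^sub>R (\<Sum>i\<in>blk h. coord i (I h) *\<^sub>R v i)"
          using torusD(1) [OF I h] by simp
        also have "\<dots> = (\<Sum>i\<in>blk h. coord i p *\<^sub>R v i)"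
          unfolding scaleR_right.sum by (intro sum.cong refl) (simp add: cp [OF h])
        finally show "\<beta>0 h *\<^sub>R I h + (\<Sum>i\<in>blk h. y i *\<^sub>R v i) = xh y h"
          by (simp add: xh_def scaleR_add_left sum.distrib)
      qed
      also have "\<dots> = torus_comb \<tau> (\<lambda>h. sqrt (s h y)) J"
        unfolding torus_comb_def by (intro sum.cong refl xJ)
      finally show ?thesis .
    qed
    have A1: "fst (A (\<gamma> y)) = (\<Sum>i\<in>{0..t 0}. (coord i \<alpha>0 + y i) *\<^sub>R v i)"
      using D_sub(1) [OF D] by (simp add: A_def \<gamma>_def scaleR_add_left sum.distrib)
    define \<beta> where "\<beta> = (\<lambda>h\<in>{1..\<tau>}. sqrt (s h y))"
    \<comment> \<open>Membership of the point in \<Omega> only yields some representation;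
      \<open>slice_memD\<close> shows that the present one also lies over \<open>D\<close>.\<close>
    have DA: "(fst (A (\<gamma> y)), \<beta>) \<in> D"
      unfolding A1 \<beta>_def by (rule slice_memD [OF J]) (use r0(2) [OF y0(1)] YJ A1 in simp)
    have "Y y = fst (A (\<gamma> y)) + torus_comb \<tau> \<beta> J"
      unfolding YJ by (intro arg_cong2 [of _ _ _ _ "(+)"] refl torus_comb_cong) (simp add: \<beta>_def)
    then have "f (Y y) = (\<Sum>K\<in>Pow {1..\<tau>}. ordered_prod J K * stem_comp \<tau> I f K (fst (A (\<gamma> y)), \<beta>))"
      using stem_expansion [OF DA I J] by simp
    also have "\<dots> = W y"
      unfolding W_def
    proof (rule sum.cong [OF refl])
      fix K assume K: "K \<in> Pow {1..\<tau>}"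
      then have fin: "finite K" by (auto intro: finite_subset)
      have S0: "stem_comp \<tau> I f K (fst (A (\<gamma> y)), \<beta>) = stem_comp \<tau> I f K (fst (A (\<gamma> y)), snd (A (\<gamma> y)))"
        by (rule stem_comp_cong) (simp add: \<beta>_def A_def \<gamma>h)
      have S: "stem_comp \<tau> I f K (fst (A (\<gamma> y)), \<beta>) =
          (\<Sum>c\<in>Basis. ((\<Prod>h\<in>Z0 \<inter> K. sqrt (s h y)) * \<Phi> K c y) *\<^sub>R c)"
      proof -
        have "stem_comp \<tau> I f K (A (\<gamma> y)) \<bullet> c = (\<Prod>h\<in>Z0 \<inter> K. sqrt (s h y)) * \<Phi> K c y" if "c \<in> Basis" for c
          by (rule \<Phi>(3) [OF that]) (use y0(3) \<rho>2le [OF K that] in force)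
        then have "(\<Sum>c\<in>Basis. ((\<Prod>h\<in>Z0 \<inter> K. sqrt (s h y)) * \<Phi> K c y) *\<^sub>R c) =
            (\<Sum>c\<in>Basis. (stem_comp \<tau> I f K (A (\<gamma> y)) \<bullet> c) *\<^sub>R c)"
          by (intro sum.cong refl) simp
        then show ?thesis using S0 by (simp add: euclidean_representation)
      qed
      have "ordered_prod (xh y) K = ordered_prod (\<lambda>h. sqrt (s h y) *\<^sub>R J h) K"
        by (rule ordered_prod_cong [OF fin]) (use K xJ in auto)
      then have X: "ordered_prod (xh y) K = (\<Prod>h\<in>K. sqrt (s h y)) *\<^sub>R ordered_prod J K"
        by (simp add: ordered_prod_scaleR [OF fin])
      have cancel: "(\<Prod>h\<in>K - Z0. 1 / sqrt (s h y)) * (\<Prod>h\<in>K. sqrt (s h y)) = (\<Prod>h\<in>Z0 \<inter> K. sqrt (s h y))"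
      proof -
        have "(\<Prod>h\<in>K. sqrt (s h y)) = (\<Prod>h\<in>K - Z0. sqrt (s h y)) * (\<Prod>h\<in>Z0 \<inter> K. sqrt (s h y))"
          using prod.Int_Diff [OF fin, of "\<lambda>h. sqrt (s h y)" Z0] by (simp add: Int_commute mult.commute)
        moreover have "(\<Prod>h\<in>K - Z0. 1 / sqrt (s h y)) * (\<Prod>h\<in>K - Z0. sqrt (s h y)) = 1"
          unfolding prod.distrib [symmetric]
        proof (rule prod.neutral, rule ballI)
          fix h assume "h \<in> K - Z0"
          then have "h \<in> {1..\<tau>} - Z0" using K by auto
          then show "1 / sqrt (s h y) * sqrt (s h y) = 1" using \<rho>1(2) [OF _ y0(2), of h] by simp
        qed
        ultimately show ?thesis by (simp flip: mult.assoc)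
      qed
      show "ordered_prod J K * stem_comp \<tau> I f K (fst (A (\<gamma> y)), \<beta>) = (\<Sum>c\<in>Basis.
          ((\<Prod>h\<in>K - Z0. 1 / sqrt (s h y)) * \<Phi> K c y) *\<^sub>R (ordered_prod (xh y) K * c))"
        unfolding S sum_distrib_left
      proof (intro sum.cong refl)
        fix c :: 'a
        have "((\<Prod>h\<in>K - Z0. 1 / sqrt (s h y)) * \<Phi> K c y) *\<^sub>R (ordered_prod (xh y) K * c) =
           (((\<Prod>h\<in>K - Z0. 1 / sqrt (s h y)) * (\<Prod>h\<in>K. sqrt (s h y))) * \<Phi> K c y) *\<^sub>R (ordered_prod J K * c)"
          unfolding X by (simp add: mult_ac del: prod_dividef)
        then show "ordered_prod J K * ((\<Prod>h\<in>Z0 \<inter> K. sqrt (s h y)) * \<Phi> K c y) *\<^sub>R c =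
            ((\<Prod>h\<in>K - Z0. 1 / sqrt (s h y)) * \<Phi> K c y) *\<^sub>R (ordered_prod (xh y) K * c)"
          unfolding cancel by simp
      qed
    qed
    finally show ?thesis .
  qed
  have ext: "vec_ext ?X (\<lambda>y. f (Y y))"
    using W unfolding vec_ext_def by (auto intro: hol_ext_cong [OF _ R] simp: fW)
  have local: "f (Y y) = f (Y (\<lambda>i. if i \<in> ?X then y i else 0))" for y
    unfolding Y_def by (intro arg_cong [of _ _ f] arg_cong2 [of _ _ _ _ "(+)"] refl sum.cong) auto
  obtain r c where r: "r > 0" and c: "\<And>y. \<forall>i\<in>?X. \<bar>y i\<bar> < r \<Longrightarrow>
      ((\<lambda>k. (\<Prod>i\<in>?X. y i ^ k i) *\<^sub>R c k) has_sum f (Y y)) (?X \<rightarrow>\<^sub>E UNIV)"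
    using vec_ext_imp_power_series [OF _ ext local] by auto
  show "\<exists>r>0. \<exists>c :: (nat \<Rightarrow> nat) \<Rightarrow> 'a. \<forall>y :: nat \<Rightarrow> real. (\<forall>i\<in>{0..n}. \<bar>y i\<bar> < r) \<longrightarrow>
          p + (\<Sum>i=0..n. y i *\<^sub>R v i) \<in> \<Omega> \<and>
          ((\<lambda>k. (\<Prod>i=0..n. y i ^ k i) *\<^sub>R c k) has_sum f (p + (\<Sum>i=0..n. y i *\<^sub>R v i))) ({0..n} \<rightarrow>\<^sub>E UNIV)"
  proof (intro exI [of _ "min r r0"] exI [of _ c] conjI allI impI)
    show "min r r0 > 0" using r r0 by simp
    fix y :: "nat \<Rightarrow> real" assume y: "\<forall>i\<in>{0..n}. \<bar>y i\<bar> < min r r0"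
    show "p + (\<Sum>i=0..n. y i *\<^sub>R v i) \<in> \<Omega>" using r0(2) [of y] y by (simp add: Y_def)
    show "((\<lambda>k. (\<Prod>i=0..n. y i ^ k i) *\<^sub>R c k) has_sum f (p + (\<Sum>i=0..n. y i *\<^sub>R v i))) ({0..n} \<rightarrow>\<^sub>E UNIV)"
      using c [of y] y by (simp add: Y_def)
  qed
qed

end

theorem theorem7p7:
  fixes cj :: "'a::{real_algebra_1,euclidean_space} \<Rightarrow> 'a"
    and V :: "'a set"
    and v :: "nat \<Rightarrow> 'a"
    and n d \<tau> :: nat
    and t :: "nat \<Rightarrow> nat"
    and D :: "('a \<times> (nat \<Rightarrow> real)) set"
    and f :: "'a \<Rightarrow> 'a"
  assumes "star_involution cj"
    and "imag_units cj \<noteq> {}"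
    and "hypercomplex_subspace cj V"
    and "hypercomplex_basis cj V v n"
    and "n \<le> d"
    and "ordered_basis UNIV v d"
    and "list_of_steps n \<tau> t"
    and "D \<noteq> {}"
    and "openin (prod_topology (top_of_set (span_range v 0 (t 0)))
                  (product_topology (\<lambda>_. euclideanreal) {1..\<tau>})) D"
    and "\<forall>h\<in>{1..\<tau>}. \<forall>(\<alpha>, \<beta>)\<in>D. (\<alpha>, reflect {h} \<beta>) \<in> D"
    and "T_slice_domain V v d \<tau> t (T_symmetrize v d \<tau> t D)"
    and "T_regular v d \<tau> t (T_symmetrize v d \<tau> t D) f"
  shows "strongly_T_regular v d \<tau> t D f \<and>
    (\<forall>(\<alpha>, \<beta>)\<in>D. \<forall>I\<in>torus v d \<tau> t. \<forall>J\<in>torus v d \<tau> t.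
       f (\<alpha> + torus_comb \<tau> \<beta> J) =
         (1 / 2 ^ \<tau>) *\<^sub>R (\<Sum>K\<in>Pow {1..\<tau>}. \<Sum>H\<in>Pow {1..\<tau>}.
           (-1) ^ card (K \<inter> H) *\<^sub>R
             (ordered_prod J K * mult_inverse (ordered_prod I K)
               * f (\<alpha> + torus_comb \<tau> (reflect H \<beta>) I))) \<and>
       f (\<alpha> + torus_comb \<tau> \<beta> J) =
         (\<Sum>H\<in>Pow {1..\<tau>}. gamma_coeff \<tau> I J H * f (\<alpha> + torus_comb \<tau> (reflect H \<beta>) I))) \<and>
    real_analytic_on v n (T_symmetrize v d \<tau> t D) f"
proof -
  interpret T_setting cj V v n d \<tau> t D f
    by unfold_locales (use assms in auto)
  show ?thesis
    using strongly_regular representation_formulas real_analytic by blast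
qed

end
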